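(* Let $G$ be a finite simple graph of order $n$ with maximum degree $\Delta$. If $G$ is edge-$\Delta$-critical and $\Delta\geq \frac{2n}{3}+12$, then $G$ is Hamiltonian.
   Context: For a finite simple graph $G$ with maximum degree $\Delta$, the chromatic index $\chi'(G)$ is the least $k$ such that $G$ has a proper edge-coloring with $k$ colors. $G$ is called edge-$\Delta$-critical if $\chi'(G)=\Delta+1$ and $\chi'(H)\le \Delta$ for every proper subgraph $H$ of $G$. *)

theory Defs
  imports Complex_Main
begin

definition simple_graph :: "'a set \<Rightarrow> 'a set set \<Rightarrow> bool" where
  "simple_graph V E \<longleftrightarrow> finite V \<and> (\<forall>e\<in>E. e \<subseteq> V \<and> card e = 2)"

definition degree :: "'a set set \<Rightarrow> 'a \<Rightarrow> nat" where
  "degree E v = card {e\<in>E. v \<in> e}"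

definition max_degree :: "'a set \<Rightarrow> 'a set set \<Rightarrow> nat" where
  "max_degree V E = (if V = {} then 0 else Max (degree E ` V))"

definition proper_edge_coloring :: "'a set set \<Rightarrow> ('a set \<Rightarrow> nat) \<Rightarrow> nat \<Rightarrow> bool" where
  "proper_edge_coloring E c k \<longleftrightarrow>
     (\<forall>e\<in>E. c e < k) \<and>
     (\<forall>e\<in>E. \<forall>f\<in>E. e \<noteq> f \<and> e \<inter> f \<noteq> {} \<longrightarrow> c e \<noteq> c f)"

definition chromatic_index :: "'a set set \<Rightarrow> nat" where
  "chromatic_index E = (LEAST k. \<exists>c. proper_edge_coloring E c k)"

definition subgraph :: "'a set \<Rightarrow> 'a set set \<Rightarrow> 'a set \<Rightarrow> 'a set set \<Rightarrow> bool" where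
  "subgraph V' E' V E \<longleftrightarrow> V' \<subseteq> V \<and> E' \<subseteq> E \<and> (\<forall>e\<in>E'. e \<subseteq> V')"

definition edge_critical :: "'a set \<Rightarrow> 'a set set \<Rightarrow> bool" where
  "edge_critical V E \<longleftrightarrow>
     chromatic_index E = max_degree V E + 1 \<and>
     (\<forall>V' E'. subgraph V' E' V E \<and> (V', E') \<noteq> (V, E) \<longrightarrow>
        chromatic_index E' \<le> max_degree V E)"

definition hamiltonian :: "'a set \<Rightarrow> 'a set set \<Rightarrow> bool" where
  "hamiltonian V E \<longleftrightarrow>
     (\<exists>vs. distinct vs \<and> set vs = V \<and> length vs \<ge> 3 \<and>
        (\<forall>i < length vs. {vs ! i, vs ! ((i + 1) mod length vs)} \<in> E))"

end

theory Submission
  imports Defs "HOL-Combinatorics.Transposition"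
begin

text \<open>
Write \<open>n\<close> for the order, \<open>k\<close> for the maximum degree, \<open>d\<close> for degrees, and call a vertex low if
\<open>2 d < k\<close>. Low vertices are independent by Vizing's adjacency lemma. A Woodall-type recolouring
argument shows that for a low vertex \<open>x\<close> the sum over its neighbours \<open>y\<close> of \<open>1 / l(y)\<close> is at least 2,
where \<open>l(y)\<close> counts the low neighbours of \<open>y\<close>; by Hall's argument every low vertex gets two
private neighbours, so low vertices can be inner vertices of disjoint paths of length two (cherries).

Pass to a Bondy--Chvatal closure. There the set \<open>Uv\<close> of non-low vertices adjacent to all other non-low
vertices contains all vertices of degree \<open>k\<close>, and together with the set \<open>Bi\<close> of remaining vertices of
closure degree at least \<open>n/2\<close> it is a clique. A spanning linear forest without path ends at low
vertices extends to a Hamilton cycle as soon as it has fewer path ends in the remaining set \<open>Sm\<close> than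
in \<open>Uv\<close>. Vizing's adjacency lemma gives that the sum over all vertices \<open>x\<close> outside \<open>Uv\<close> of the
proportion of the neighbours of \<open>x\<close> lying in \<open>Uv\<close> is less than \<open>|Uv|\<close>, and this bounds the number of
edges such a forest needs inside \<open>Sm\<close> and between \<open>Sm\<close> and \<open>Bi\<close>. Vizing's theorem supplies them:
vertices of \<open>Sm\<close> have few neighbours outside \<open>Uv\<close>, so one class of an edge colouring (after
splitting vertices that may be used twice) is heavy enough, even after breaking cycles.
\<close>

section \<open>Graphs and edge colourings\<close>

text \<open>A vertex of degree \<open>k\<close> and a non-low vertex have degree sum at least 3k/2,
  which reaches n as soon as k is at least 2n/3; so vertices of maximum degree become universal
  among the non-low ones in the closure. Low vertices need not be reached by the closure, hence they
  must be hidden inside paths beforehand. The budget rests on one identity: for x outside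
  \<open>Uv\<close>, the proportions of its neighbours inside and outside \<open>Uv\<close> add up
  to 1. The first proportions sum to less than |Uv|; what the second ones contribute has to be
  recovered by cherries and forest edges. A forest edge inside \<open>Sm\<close> removes two path
  ends, one from \<open>Sm\<close> to \<open>Bi\<close> removes one, and some class among C colours
  has at least 1/C of the total weight. So C must be small against the degrees in \<open>Sm\<close>,
  yet large enough to accommodate their outer degrees. With low vertices C is about k/4, and private
  neighbours pay for breaking cycles; without them C is about a third of the minimum degree, and a
  reserve kept in each edge weight pays. The summand 12 leaves room for rounding C and for the extra
  colour in Vizing's theorem.\<close>

definition fin_graph :: "'a set set \<Rightarrow> bool" where
  "fin_graph E \<longleftrightarrow> finite E \<and> (\<forall>e\<in>E. card e = 2)"

definition nbrs :: "'a set set \<Rightarrow> 'a \<Rightarrow> 'a set" where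
  "nbrs E v = {w. {v, w} \<in> E}"

definition colorable :: "'a set set \<Rightarrow> nat \<Rightarrow> bool" where
  "colorable E k \<longleftrightarrow> (\<exists>c. proper_edge_coloring E c k)"

definition missing :: "'a set set \<Rightarrow> ('a set \<Rightarrow> nat) \<Rightarrow> nat \<Rightarrow> 'a \<Rightarrow> nat set" where
  "missing E c k v = {a. a < k \<and> (\<forall>e\<in>E. v \<in> e \<longrightarrow> c e \<noteq> a)}"

lemma fin_graph_subset: "fin_graph E \<Longrightarrow> F \<subseteq> E \<Longrightarrow> fin_graph F"
  unfolding fin_graph_def by (meson finite_subset subsetD)

lemma fin_graph_edge_neq: "fin_graph E \<Longrightarrow> {x, y} \<in> E \<Longrightarrow> x \<noteq> y"
  unfolding fin_graph_def by force

lemma fin_graph_edge_ex: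
  assumes "fin_graph E" "e \<in> E" "v \<in> e"
  obtains w where "e = {v, w}" "w \<noteq> v"
proof -
  have "card e = 2" using assms unfolding fin_graph_def by auto
  then obtain p q where "e = {p, q}" "p \<noteq> q" by (meson card_2_iff)
  then show ?thesis using assms(3) that by (metis doubleton_eq_iff insertE singletonD)
qed

lemma nbrs_sym: "w \<in> nbrs E v \<longleftrightarrow> v \<in> nbrs E w"
  unfolding nbrs_def by (simp add: insert_commute)

lemma degree_nbrs:
  assumes "fin_graph E"
  shows "degree E v = card (nbrs E v)"
proof -
  have "{e\<in>E. v \<in> e} = (\<lambda>w. {v, w}) ` nbrs E v"
    unfolding nbrs_def using fin_graph_edge_ex[OF assms] by blast
  moreover have "inj_on (\<lambda>w. {v, w}) (nbrs E v)"
    by (auto simp: inj_on_def doubleton_eq_iff)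
  ultimately show ?thesis unfolding degree_def by (simp add: card_image)
qed

lemma finite_nbrs:
  assumes "fin_graph E"
  shows "finite (nbrs E v)"
proof -
  have "finite ((\<lambda>w. {v, w}) ` nbrs E v)"
    by (rule finite_subset[of _ E]) (use assms in \<open>auto simp: nbrs_def fin_graph_def\<close>)
  moreover have "inj_on (\<lambda>w. {v, w}) (nbrs E v)"
    by (auto simp: inj_on_def doubleton_eq_iff)
  ultimately show ?thesis using finite_imageD by blast
qed

lemma nbrs_irrefl: "fin_graph E \<Longrightarrow> v \<notin> nbrs E v"
  unfolding nbrs_def fin_graph_def by force

lemma proper_inj_on:
  assumes "proper_edge_coloring E c k"
  shows "inj_on c {e\<in>E. v \<in> e}"
  using assms unfolding proper_edge_coloring_def inj_on_def by blast

lemma proper_eqD: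
  assumes "proper_edge_coloring E c k" "e \<in> E" "f \<in> E" "v \<in> e" "v \<in> f" "c e = c f"
  shows "e = f"
  using assms unfolding proper_edge_coloring_def by blast

lemma finite_missing [simp]: "finite (missing E c k v)"
  unfolding missing_def by simp

lemma missing_less: "a \<in> missing E c k v \<Longrightarrow> a < k"
  unfolding missing_def by simp

lemma missingD: "a \<in> missing E c k v \<Longrightarrow> e \<in> E \<Longrightarrow> v \<in> e \<Longrightarrow> c e \<noteq> a"
  unfolding missing_def by simp

lemma missingI: "a < k \<Longrightarrow> (\<And>e. e \<in> E \<Longrightarrow> v \<in> e \<Longrightarrow> c e \<noteq> a) \<Longrightarrow> a \<in> missing E c k v"
  unfolding missing_def by simp

lemma missing_edge: "a \<in> missing E c k v \<Longrightarrow> {v, w} \<in> E \<Longrightarrow> c {v, w} \<noteq> a"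
  unfolding missing_def by auto

lemma card_missing:
  assumes "fin_graph E" "proper_edge_coloring E c k"
  shows "card (missing E c k v) + degree E v = k"
proof -
  let ?I = "{e\<in>E. v \<in> e}"
  have fin: "finite ?I" using assms(1) unfolding fin_graph_def by auto
  have "missing E c k v = {..<k} - c ` ?I"
    unfolding missing_def by auto
  moreover have "c ` ?I \<subseteq> {..<k}"
    using assms(2) unfolding proper_edge_coloring_def by auto
  moreover have "card (c ` ?I) = degree E v"
    unfolding degree_def using card_image[OF proper_inj_on[OF assms(2)]] .
  moreover have "card (c ` ?I) \<le> card {..<k}"
    by (rule card_mono) (use calculation(2) in auto)
  ultimately show ?thesis
    using fin by (simp add: card_Diff_subset)
qed

lemma not_missing_edge:
  assumes "fin_graph E" "a < k" "a \<notin> missing E c k v"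
  obtains w where "{v, w} \<in> E" "c {v, w} = a" "w \<noteq> v"
proof -
  obtain e where "e \<in> E" "v \<in> e" "c e = a" using assms unfolding missing_def by auto
  then show ?thesis using fin_graph_edge_ex[OF assms(1)] that by metis
qed

section \<open>Two-coloured components, swaps on them, and the bound of two ends per
  component\<close>

section \<open>Kempe changes\<close>

text \<open>\<open>C\<close> is a union of components of the subgraph in the two colours. Working
  with vertex sets lets the effect of a swap on missing colours be read off from membership in
  \<open>C\<close>.\<close>

definition kclosed :: "'a set set \<Rightarrow> ('a set \<Rightarrow> nat) \<Rightarrow> nat \<Rightarrow> nat \<Rightarrow> 'a set \<Rightarrow> bool" where
  "kclosed E c a b C \<longleftrightarrow> (\<forall>e\<in>E. c e \<in> {a, b} \<longrightarrow> e \<subseteq> C \<or> e \<inter> C = {})"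

text \<open>Every edge meeting \<open>C\<close> is treated alike: edges of other colours that leave
  \<open>C\<close> are fixed by the transposition anyway.\<close>

definition kswap :: "('a set \<Rightarrow> nat) \<Rightarrow> nat \<Rightarrow> nat \<Rightarrow> 'a set \<Rightarrow> 'a set \<Rightarrow> nat" where
  "kswap c a b C e = (if e \<inter> C \<noteq> {} then transpose a b (c e) else c e)"

definition kcomp :: "'a set set \<Rightarrow> ('a set \<Rightarrow> nat) \<Rightarrow> nat \<Rightarrow> nat \<Rightarrow> 'a \<Rightarrow> 'a set" where
  "kcomp E c a b v = {w. (v, w) \<in> {(p, q). {p, q} \<in> E \<and> c {p, q} \<in> {a, b}}\<^sup>*}"

lemma transpose_less: "a < k \<Longrightarrow> b < k \<Longrightarrow> transpose a b i < k \<longleftrightarrow> i < (k::nat)"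
  unfolding transpose_def by auto

lemma kswap_at_in:
  assumes "v \<in> C" "v \<in> e"
  shows "kswap c a b C e = transpose a b (c e)"
  using assms unfolding kswap_def by auto

lemma kswap_at_out:
  assumes "kclosed E c a b C" "e \<in> E" "v \<notin> C" "v \<in> e"
  shows "kswap c a b C e = c e"
  using assms unfolding kswap_def kclosed_def by (auto simp: transpose_def)

text \<open>At a vertex of \<open>C\<close> all incident colours undergo the same transposition, at
  any other vertex none changes; so properness is preserved vertex by vertex.\<close>

lemma kswap_proper:
  assumes "proper_edge_coloring E c k" "kclosed E c a b C" "a < k" "b < k"
  shows "proper_edge_coloring E (kswap c a b C) k"
  unfolding proper_edge_coloring_def
proof (intro conjI ballI impI)
  fix e assume "e \<in> E"
  then have "c e < k" using assms(1) unfolding proper_edge_coloring_def by auto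
  then show "kswap c a b C e < k"
    unfolding kswap_def using transpose_less[OF assms(3,4)] by auto
next
  fix e f assume ef: "e \<in> E" "f \<in> E" "e \<noteq> f \<and> e \<inter> f \<noteq> {}"
  then obtain v where v: "v \<in> e" "v \<in> f" by auto
  have ne: "c e \<noteq> c f" using ef assms(1) unfolding proper_edge_coloring_def by auto
  show "kswap c a b C e \<noteq> kswap c a b C f"
  proof (cases "v \<in> C")
    case True
    then show ?thesis using ne kswap_at_in[OF True v(1)] kswap_at_in[OF True v(2)]
      by (metis transpose_involutory)
  next
    case False
    then show ?thesis
      using ne kswap_at_out[OF assms(2) ef(1) False v(1)] kswap_at_out[OF assms(2) ef(2) False v(2)] by simp
  qed
qed

lemma missing_kswap_out:
  assumes "kclosed E c a b C" "v \<notin> C"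
  shows "missing E (kswap c a b C) k v = missing E c k v"
  unfolding missing_def using kswap_at_out[OF assms(1) _ assms(2)] by auto

lemma missing_kswap_in:
  assumes "v \<in> C" "a < k" "b < k"
  shows "i \<in> missing E (kswap c a b C) k v \<longleftrightarrow> transpose a b i \<in> missing E c k v"
  unfolding missing_def using kswap_at_in[OF assms(1)] transpose_less[OF assms(2,3)]
  by (auto simp: transpose_eq_iff)

lemma kcomp_self: "v \<in> kcomp E c a b v"
  unfolding kcomp_def by simp

lemma kcomp_step:
  assumes "p \<in> kcomp E c a b v" "{p, q} \<in> E" "c {p, q} \<in> {a, b}"
  shows "q \<in> kcomp E c a b v"
  using assms unfolding kcomp_def by (auto intro: rtrancl_into_rtrancl)

lemma kcomp_closed:
  assumes "fin_graph E"
  shows "kclosed E c a b (kcomp E c a b v)"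
  unfolding kclosed_def
proof (intro ballI impI)
  fix e assume e: "e \<in> E" "c e \<in> {a, b}"
  obtain p q where pq: "e = {p, q}" using assms e unfolding fin_graph_def by (meson card_2_iff)
  have "p \<in> kcomp E c a b v \<longleftrightarrow> q \<in> kcomp E c a b v"
    using kcomp_step[of p E c a b v q] kcomp_step[of q E c a b v p] e pq by (auto simp: insert_commute)
  then show "e \<subseteq> kcomp E c a b v \<or> e \<inter> kcomp E c a b v = {}" using pq by auto
qed

lemma kcomp_subset: "kcomp E c a b v \<subseteq> insert v (\<Union>E)"
proof
  fix w assume "w \<in> kcomp E c a b v"
  then have "(v, w) \<in> {(p, q). {p, q} \<in> E \<and> c {p, q} \<in> {a, b}}\<^sup>*" unfolding kcomp_def by simp
  then show "w \<in> insert v (\<Union>E)" by (induction rule: rtrancl_induct) auto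
qed

lemma finite_kcomp: 
  assumes "fin_graph E" shows "finite (kcomp E c a b v)"
proof -
  have "finite (\<Union>E)" using assms unfolding fin_graph_def
    by (metis card.infinite finite_Union zero_neq_numeral)
  then show ?thesis using kcomp_subset[of E c a b v] by (meson finite_insert finite_subset)
qed

text \<open>The spanning tree bound: a set grown from \<open>v\<close> gains a new edge with each
  new vertex, and it cannot stall before it is the whole component.\<close>

lemma kcomp_edges:
  assumes "fin_graph E"
  shows "card (kcomp E c a b v) \<le> card {e\<in>E. c e \<in> {a, b} \<and> e \<subseteq> kcomp E c a b v} + 1"
proof -
  let ?C = "kcomp E c a b v"
  let ?F = "\<lambda>S. {e\<in>E. c e \<in> {a, b} \<and> e \<subseteq> S}"
  have finE: "finite E" using assms unfolding fin_graph_def by auto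
  have finC: "finite ?C" using finite_kcomp[OF assms] .
  have key: "\<exists>S\<subseteq>?C. v \<in> S \<and> card S = Suc n \<and> n \<le> card (?F S)" if "Suc n \<le> card ?C" for n
    using that
  proof (induction n)
    case 0
    show ?case by (rule exI[of _ "{v}"]) (auto simp: kcomp_self)
  next
    case (Suc n)
    then obtain S where S: "S \<subseteq> ?C" "v \<in> S" "card S = Suc n" "n \<le> card (?F S)" by auto
    have "\<exists>p q. p \<in> S \<and> q \<notin> S \<and> {p, q} \<in> E \<and> c {p, q} \<in> {a, b}"
    proof (rule ccontr)
      assume no: "\<not> ?thesis"
      have "w \<in> S" if "w \<in> ?C" for w
      proof -
        have "(v, w) \<in> {(p, q). {p, q} \<in> E \<and> c {p, q} \<in> {a, b}}\<^sup>*" using that unfolding kcomp_def by simp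
        then show ?thesis by (induction rule: rtrancl_induct) (use S(2) no in auto)
      qed
      then have "?C = S" using S(1) by auto
      then show False using Suc.prems S(3) by simp
    qed
    then obtain p q where pq: "p \<in> S" "q \<notin> S" "{p, q} \<in> E" "c {p, q} \<in> {a, b}" by auto
    have qC: "q \<in> ?C" using kcomp_step[of p E c a b v q] pq S(1) by auto
    have finS: "finite S" using S(1) finC finite_subset by auto
    have "insert {p, q} (?F S) \<subseteq> ?F (insert q S)" using pq by auto
    moreover have "card (insert {p, q} (?F S)) = Suc (card (?F S))"
      using finE pq by (subst card_insert_disjoint) auto
    moreover have "finite (?F (insert q S))" using finE by auto
    ultimately have le: "Suc (card (?F S)) \<le> card (?F (insert q S))"
      using card_mono[of "?F (insert q S)" "insert {p, q} (?F S)"] by linarith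
    have "card (insert q S) = Suc (Suc n)" using S(3) pq(2) finS by simp
    moreover have "insert q S \<subseteq> ?C" "v \<in> insert q S" using S(1,2) qC by auto
    moreover have "Suc n \<le> card (?F (insert q S))" using le S(4) by linarith
    ultimately show ?case by blast
  qed
  obtain n where n: "card ?C = Suc n"
    using kcomp_self[of v E c a b] finC by (metis card_eq_0_iff empty_iff not0_implies_Suc)
  have "Suc n \<le> card ?C" using n by simp
  from key[OF this] obtain S where S: "S \<subseteq> ?C" "card S = Suc n" "n \<le> card (?F S)" by blast
  have "S = ?C" using card_subset_eq[OF finC S(1)] S(2) n by simp
  then show ?thesis using S(3) n by simp
qed

lemma card_ab_edges_le:
  assumes "fin_graph E" "proper_edge_coloring E c k" "a < k" "b < k"
    and "X \<subseteq> {a, b}" "\<And>e. e \<in> E \<Longrightarrow> v \<in> e \<Longrightarrow> c e \<in> {a, b} \<Longrightarrow> c e \<in> X"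
  shows "card {e\<in>E. c e \<in> {a, b} \<and> v \<in> e} \<le> card X"
proof (rule card_inj_on_le[where f = c])
  show "inj_on c {e\<in>E. c e \<in> {a, b} \<and> v \<in> e}"
    using proper_inj_on[OF assms(2), of v] by (rule inj_on_subset) auto
  show "c ` {e \<in> E. c e \<in> {a, b} \<and> v \<in> e} \<subseteq> X" using assms(6) by auto
  show "finite X" using assms(5) finite_subset by blast
qed

text \<open>A Kempe chain is never shown to be a path; counting suffices. Degrees in the two colours
  are at most 2, and at most 1 on \<open>T\<close>, so twice the number of edges is at most 2|C| -
  |T|, while connectedness gives at least 2|C| - 2.\<close>

lemma kcomp_two_ends:
  assumes g: "fin_graph E" and p: "proper_edge_coloring E c k" and ab: "a < k" "b < k"
    and C: "C = kcomp E c a b v"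
    and T: "T \<subseteq> C" "\<And>t. t \<in> T \<Longrightarrow> a \<in> missing E c k t \<or> b \<in> missing E c k t"
  shows "card T \<le> 2"
proof -
  let ?F = "{e\<in>E. c e \<in> {a, b} \<and> e \<subseteq> C}"
  let ?d = "\<lambda>w. card {e\<in>?F. w \<in> e}"
  have finE: "finite E" using g unfolding fin_graph_def by auto
  then have finF: "finite ?F" by auto
  have finC: "finite C" using finite_kcomp[OF g] C by simp
  have "(\<Sum>w\<in>C. ?d w) = (\<Sum>e\<in>?F. card {w\<in>C. w \<in> e})"
    using sum_multicount_gen[OF finC finF] 
    by (simp add: sum.swap_restrict[OF finC finF, of "\<lambda>_ _. 1" "\<lambda>w e. w \<in> e", simplified])
  also have "\<dots> = (\<Sum>e\<in>?F. 2)"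
  proof (rule sum.cong[OF refl])
    fix e assume "e \<in> ?F"
    then have "{w\<in>C. w \<in> e} = e" "card e = 2" using g unfolding fin_graph_def by auto
    then show "card {w\<in>C. w \<in> e} = 2" by simp
  qed
  finally have s: "(\<Sum>w\<in>C. ?d w) = 2 * card ?F" by simp
  have le: "?d w \<le> (if w \<in> T then 1 else 2)" for w
  proof -
    have sub: "{e\<in>?F. w \<in> e} \<subseteq> {e\<in>E. c e \<in> {a, b} \<and> w \<in> e}" by auto
    have fin: "finite {e\<in>E. c e \<in> {a, b} \<and> w \<in> e}" using finE by auto
    have "card {e\<in>E. c e \<in> {a, b} \<and> w \<in> e} \<le> (if w \<in> T then 1 else 2)"
    proof (cases "w \<in> T")
      case True
      then consider "a \<in> missing E c k w" | "b \<in> missing E c k w" using T(2) by auto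
      then show ?thesis
      proof cases
        case 1
        then have "card {e\<in>E. c e \<in> {a, b} \<and> w \<in> e} \<le> card {b}"
          by (intro card_ab_edges_le[OF g p ab]) (auto simp: missing_def)
        then show ?thesis using True by simp
      next
        case 2
        then have "card {e\<in>E. c e \<in> {a, b} \<and> w \<in> e} \<le> card {a}"
          by (intro card_ab_edges_le[OF g p ab]) (auto simp: missing_def)
        then show ?thesis using True by simp
      qed
    next
      case False
      have "card {e\<in>E. c e \<in> {a, b} \<and> w \<in> e} \<le> card {a, b}"
        by (intro card_ab_edges_le[OF g p ab]) auto
      also have "\<dots> \<le> 2" by (simp add: card_insert_if)
      finally show ?thesis using False by simp
    qed
    then show ?thesis using card_mono[OF fin sub] by linarith
  qed
  have "2 * card ?F \<le> (\<Sum>w\<in>C. if w \<in> T then 1 else 2)" unfolding s[symmetric] by (rule sum_mono) (use le in auto)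
  also have "\<dots> + card T = 2 * card C"
  proof -
    have "(\<Sum>w\<in>C. if w \<in> T then 1 else 2) + (\<Sum>w\<in>C. if w \<in> T then 1 else 0) = (\<Sum>w\<in>C. (2::nat))"
      unfolding sum.distrib[symmetric] by (rule sum.cong) auto
    moreover have "(\<Sum>w\<in>C. if w \<in> T then 1 else (0::nat)) = card T"
      using T(1) finC by (simp add: sum.If_cases Int_absorb1)
    ultimately show ?thesis by simp
  qed
  finally have "2 * card ?F + card T \<le> 2 * card C" by simp
  moreover have "card C \<le> card ?F + 1" using kcomp_edges[OF g, of c a b v] C by simp
  ultimately show ?thesis by linarith
qed

lemma kcomp_third_end:
  assumes "fin_graph E" "proper_edge_coloring E c k" "a < k" "b < k"
    and "distinct [x, y, z]" "y \<in> kcomp E c a b v" "x \<in> kcomp E c a b v" 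
    and "\<And>t. t \<in> {x, y, z} \<Longrightarrow> a \<in> missing E c k t \<or> b \<in> missing E c k t"
  shows "z \<notin> kcomp E c a b v"
proof
  assume "z \<in> kcomp E c a b v"
  then have "card {x, y, z} \<le> 2"
    using kcomp_two_ends[OF assms(1-4) refl, of "{x,y,z}" v] assms(6,7,8) by blast
  then show False using assms(5) by simp
qed

lemma kcomp_eq:
  assumes "w \<in> kcomp E c a b v"
  shows "kcomp E c a b w = kcomp E c a b v"
proof -
  let ?r = "{(p, q). {p, q} \<in> E \<and> c {p, q} \<in> {a, b}}"
  have "sym ?r" unfolding sym_def by (auto simp: insert_commute)
  then have "sym (?r\<^sup>*)" by (rule sym_rtrancl)
  moreover have "(v, w) \<in> ?r\<^sup>*" using assms unfolding kcomp_def by simp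
  ultimately have "(w, v) \<in> ?r\<^sup>*" by (meson symD)
  then show ?thesis using \<open>(v, w) \<in> ?r\<^sup>*\<close> unfolding kcomp_def by (auto intro: rtrancl_trans)
qed

section \<open>Vizing fans around one end of an uncoloured edge\<close>

section \<open>Fans\<close>

text \<open>Each spoke at \<open>y\<close> has a colour missing at the preceding vertex. The first
  vertex is unconstrained because its spoke will be the uncoloured edge.\<close>

fun fanp :: "'a set set \<Rightarrow> ('a set \<Rightarrow> nat) \<Rightarrow> nat \<Rightarrow> 'a \<Rightarrow> 'a list \<Rightarrow> bool" where
  "fanp E c k y [] = False"
| "fanp E c k y [v] = True"
| "fanp E c k y (v # w # p) = ({y, w} \<in> E \<and> c {y, w} \<in> missing E c k v \<and> fanp E c k y (w # p))"

lemma fanp_append: "fanp E c k y (p @ v # q) \<longleftrightarrow> fanp E c k y (p @ [v]) \<and> fanp E c k y (v # q)"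
proof (induction p)
  case (Cons u p)
  then show ?case by (cases p) auto
qed (cases q; simp)

text \<open>One rotation step: the gap moves from \<open>xy\<close> to \<open>wy\<close>. A missing
  colour is lost only at \<open>x\<close>, so fan conditions at other vertices survive.\<close>

lemma shift_proper:
  assumes g: "fin_graph E" and e: "{x, y} \<in> E" and p: "proper_edge_coloring (E - {{x, y}}) c k"
    and w: "{y, w} \<in> E - {{x, y}}" "c {y, w} \<in> missing (E - {{x, y}}) c k x"
  defines "c' \<equiv> c({x, y} := c {y, w})"
  shows "proper_edge_coloring (E - {{w, y}}) c' k"
    and "v \<noteq> x \<Longrightarrow> missing (E - {{x, y}}) c k v \<subseteq> missing (E - {{w, y}}) c' k v"
    and "missing (E - {{w, y}}) c' k x = missing (E - {{x, y}}) c k x - {c {y, w}}"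
    and "v \<noteq> x \<Longrightarrow> v \<noteq> w \<Longrightarrow> missing (E - {{w, y}}) c' k v = missing (E - {{x, y}}) c k v"
proof -
  have xy: "x \<noteq> y" using fin_graph_edge_neq[OF g e] .
  have wx: "w \<noteq> x" using w(1) by (auto simp: insert_commute)
  have ne: "{w, y} \<noteq> {x, y}" using w(1) by (auto simp: insert_commute)
  have wy: "{w, y} = {y, w}" by (rule insert_commute)
  have wyn: "w \<noteq> y" using w(1) g fin_graph_edge_neq[of E y w] by auto
  have ck: "c {y, w} < k" using missing_less[OF w(2)] .
  have mx: "c f \<noteq> c {y, w}" if "f \<in> E - {{x, y}}" "x \<in> f" for f
    using missingD[OF w(2) that] .
  have my: "c f \<noteq> c {y, w}" if "f \<in> E - {{x, y}}" "f \<noteq> {w, y}" "y \<in> f" for f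
    using p that w(1) wy unfolding proper_edge_coloring_def by blast
  show "proper_edge_coloring (E - {{w, y}}) c' k"
    unfolding proper_edge_coloring_def
  proof (intro conjI ballI impI)
    fix f assume "f \<in> E - {{w, y}}"
    then show "c' f < k" using p ck unfolding proper_edge_coloring_def c'_def by auto
  next
    fix f h assume fh: "f \<in> E - {{w, y}}" "h \<in> E - {{w, y}}" "f \<noteq> h \<and> f \<inter> h \<noteq> {}"
    show "c' f \<noteq> c' h"
    proof (cases "f = {x, y} \<or> h = {x, y}")
      case False
      then show ?thesis using p fh unfolding proper_edge_coloring_def c'_def by auto
    next
      case True
      have m: "c g \<noteq> c {y, w}" if "g \<in> E - {{w, y}}" "g \<noteq> {x, y}" "g \<inter> {x, y} \<noteq> {}" for g
      proof -
        have "x \<in> g \<or> y \<in> g" using that(3) by blast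
        moreover have "g \<in> E - {{x, y}}" "g \<noteq> {w, y}" using that(1,2) by auto
        ultimately show ?thesis using mx[of g] my[of g] by metis
      qed
      from True show ?thesis
      proof
        assume f: "f = {x, y}"
        then have "h \<noteq> {x, y}" "h \<inter> {x, y} \<noteq> {}" using fh(3) by auto
        then show ?thesis using m[OF fh(2)] f unfolding c'_def by simp
      next
        assume h: "h = {x, y}"
        then have "f \<noteq> {x, y}" "f \<inter> {x, y} \<noteq> {}" using fh(3) by auto
        then show ?thesis using m[OF fh(1)] h unfolding c'_def by simp
      qed
    qed
  qed
  show sub: "missing (E - {{x, y}}) c k v \<subseteq> missing (E - {{w, y}}) c' k v" if "v \<noteq> x"
  proof
    fix a assume a: "a \<in> missing (E - {{x, y}}) c k v"
    have "c' f \<noteq> a" if f: "f \<in> E - {{w, y}}" "v \<in> f" for f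
    proof (cases "f = {x, y}")
      case True
      then have "v = y" using f(2) \<open>v \<noteq> x\<close> by blast
      then show ?thesis using missingD[OF a w(1)] True unfolding c'_def by simp
    next
      case False
      have "c' f = c f" using False unfolding c'_def by simp
      then show ?thesis using missingD[OF a, of f] f False by simp
    qed
    then show "a \<in> missing (E - {{w, y}}) c' k v" by (intro missingI missing_less[OF a])
  qed
  show "missing (E - {{w, y}}) c' k v = missing (E - {{x, y}}) c k v" if "v \<noteq> x" "v \<noteq> w"
  proof -
    have "a \<in> missing (E - {{x, y}}) c k v" if a: "a \<in> missing (E - {{w, y}}) c' k v" for a
    proof -
      have "c f \<noteq> a" if f: "f \<in> E - {{x, y}}" "v \<in> f" for f
      proof (cases "f = {w, y}")
        case True
        then have "v = y" using f(2) \<open>v \<noteq> w\<close> by blast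
        then have "c' {x, y} \<noteq> a" using missingD[OF a, of "{x, y}"] e ne by simp
        then show ?thesis using True wy unfolding c'_def by simp
      next
        case False
        have "c' f = c f" using f(1) unfolding c'_def by simp
        then show ?thesis using missingD[OF a, of f] f False by simp
      qed
      then show ?thesis by (intro missingI missing_less[OF a])
    qed
    then show ?thesis using sub[OF that(1)] by blast
  qed
  show "missing (E - {{w, y}}) c' k x = missing (E - {{x, y}}) c k x - {c {y, w}}"
  proof -
    have "{f \<in> E - {{w, y}}. x \<in> f} = insert {x, y} {f \<in> E - {{x, y}}. x \<in> f}"
    proof (intro equalityI subsetI)
      fix f assume "f \<in> {f \<in> E - {{w, y}}. x \<in> f}"
      then show "f \<in> insert {x, y} {f \<in> E - {{x, y}}. x \<in> f}" by simp
    next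
      fix f assume f: "f \<in> insert {x, y} {f \<in> E - {{x, y}}. x \<in> f}"
      then have "f \<in> E" "x \<in> f" using e by auto
      moreover have "f \<noteq> {w, y}" using \<open>x \<in> f\<close> wx xy by auto
      ultimately show "f \<in> {f \<in> E - {{w, y}}. x \<in> f}" by simp
    qed
    moreover have "missing F d k x = {..<k} - d ` {f\<in>F. x \<in> f}" for F and d :: "'a set \<Rightarrow> nat"
      unfolding missing_def by auto
    moreover have "c' ` {f \<in> E - {{x, y}}. x \<in> f} = c ` {f \<in> E - {{x, y}}. x \<in> f}"
      unfolding c'_def by (rule image_cong) simp_all
    moreover have "c' {x, y} = c {y, w}" unfolding c'_def by simp
    ultimately show ?thesis by (simp only: image_insert) blast
  qed
qed

lemma color_last_edge:
  assumes p: "proper_edge_coloring (E - {{x, y}}) c k"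
    and a: "a \<in> missing (E - {{x, y}}) c k x" "a \<in> missing (E - {{x, y}}) c k y"
  shows "colorable E k"
proof -
  have "proper_edge_coloring E (c({x, y} := a)) k"
    unfolding proper_edge_coloring_def
  proof (intro conjI ballI impI)
    fix f assume "f \<in> E"
    then show "(c({x, y} := a)) f < k" using p missing_less[OF a(1)] unfolding proper_edge_coloring_def by simp
  next
    fix f h assume fh: "f \<in> E" "h \<in> E" "f \<noteq> h \<and> f \<inter> h \<noteq> {}"
    have m: "c g \<noteq> a" if "g \<in> E - {{x, y}}" "x \<in> g \<or> y \<in> g" for g
      using a that unfolding missing_def by auto
    show "(c({x, y} := a)) f \<noteq> (c({x, y} := a)) h"
    proof (cases "f = {x, y} \<or> h = {x, y}")
      case False
      then have "f \<in> E - {{x, y}}" "h \<in> E - {{x, y}}" using fh(1,2) by simp_all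
      then have "c f \<noteq> c h" using p fh(3) unfolding proper_edge_coloring_def by blast
      then show ?thesis using False by simp
    next
      case True
      then show ?thesis
      proof
        assume f: "f = {x, y}"
        have "h \<noteq> {x, y}" "{x, y} \<inter> h \<noteq> {}" using fh(3) f by metis+
        then have "h \<in> E - {{x, y}}" "x \<in> h \<or> y \<in> h" using fh(2) by blast+
        then show ?thesis using m[of h] f by simp
      next
        assume h: "h = {x, y}"
        have "f \<noteq> {x, y}" "f \<inter> {x, y} \<noteq> {}" using fh(3) h by metis+
        then have "f \<in> E - {{x, y}}" "x \<in> f \<or> y \<in> f" using fh(1) by blast+
        then show ?thesis using m[of f] h by simp
      qed
    qed
  qed
  then show ?thesis unfolding colorable_def by blast
qed

text \<open>Rotating along the whole fan moves the gap to the last spoke without losing missing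
  colours at the last vertex or at \<open>y\<close>; a common one would then complete the colouring.
  Distinctness keeps \<open>x\<close>, whose missing set shrinks, from reappearing.\<close>

lemma fan_center_disjoint:
  assumes "fin_graph E" "\<not> colorable E k"
    and "{x, y} \<in> E" "proper_edge_coloring (E - {{x, y}}) c k"
    and "distinct (x # p)" "fanp (E - {{x, y}}) c k y (x # p)"
  shows "missing (E - {{x, y}}) c k (last (x # p)) \<inter> missing (E - {{x, y}}) c k y = {}"
  using assms(3-6)
proof (induction p arbitrary: x c)
  case Nil
  then show ?case using color_last_edge[OF Nil(2)] assms(2) by auto
next
  case (Cons w p)
  define c' where "c' = c({x, y} := c {y, w})"
  have w: "{y, w} \<in> E - {{x, y}}" "c {y, w} \<in> missing (E - {{x, y}}) c k x"
    and fp: "fanp (E - {{x, y}}) c k y (w # p)" using Cons.prems(4) by auto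
  note sh = shift_proper[OF assms(1) Cons.prems(1,2) w, folded c'_def]
  have xy: "x \<noteq> y" using fin_graph_edge_neq[OF assms(1) Cons.prems(1)] .
  have "fanp (E - {{w, y}}) c' k y (w # p)"
  proof -
    have "fanp (E - {{w, y}}) c' k y (v # q)"
      if "fanp (E - {{x, y}}) c k y (v # q)" "v \<noteq> x" "x \<notin> set q" "w \<notin> set q" for v q
      using that
    proof (induction q arbitrary: v)
      case (Cons u q)
      have u: "u \<noteq> x" "u \<noteq> w" "{y, u} \<in> E - {{x, y}}" "c {y, u} \<in> missing (E - {{x, y}}) c k v"
        using Cons.prems by auto
      have "{y, u} \<in> E - {{w, y}}" using u by (auto simp: doubleton_eq_iff)
      moreover have "c' {y, u} = c {y, u}" using u xy unfolding c'_def by (auto simp: doubleton_eq_iff)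
      moreover have "c {y, u} \<in> missing (E - {{w, y}}) c' k v" using sh(2)[OF Cons.prems(2)] u(4) by blast
      moreover have "fanp (E - {{w, y}}) c' k y (u # q)"
      proof (rule Cons.IH)
        show "fanp (E - {{x, y}}) c k y (u # q)" using Cons.prems(1) by simp
        show "u \<noteq> x" "x \<notin> set q" "w \<notin> set q" using Cons.prems(3,4) by auto
      qed
      ultimately show ?case by simp
    qed simp
    from this[OF fp] show ?thesis using Cons.prems(3) by (metis distinct.simps(2) list.set_intros(1,2))
  qed
  moreover have "{w, y} \<in> E" using w(1) by (auto simp: insert_commute)
  ultimately have "missing (E - {{w, y}}) c' k (last (w # p)) \<inter> missing (E - {{w, y}}) c' k y = {}"
    using Cons.IH[of w c'] sh(1) Cons.prems(3) by simp
  moreover have "last (w # p) \<noteq> x"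
  proof
    assume "last (w # p) = x"
    then have "x \<in> set (w # p)" using last_in_set[of "w # p"] by simp
    then show False using Cons.prems(3) by simp
  qed
  moreover have "last (x # w # p) = last (w # p)" by simp
  moreover have "missing (E - {{x, y}}) c k (last (w # p)) \<subseteq> missing (E - {{w, y}}) c' k (last (w # p))"
    using sh(2) \<open>last (w # p) \<noteq> x\<close> .
  moreover have "missing (E - {{x, y}}) c k y \<subseteq> missing (E - {{w, y}}) c' k y"
    by (rule sh(2)) (use xy in simp)
  ultimately show ?case by (simp only:) blast
qed

text \<open>The part between two occurrences of a vertex can be cut out, since the fan condition
  only relates consecutive vertices.\<close>

lemma fanp_distinct:
  assumes "fanp E c k y (x # p)"
  shows "\<exists>q. fanp E c k y (x # q) \<and> last (x # q) = last (x # p) \<and> distinct (x # q)"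
  using assms
proof (induction "length p" arbitrary: p rule: less_induct)
  case less
  show ?case
  proof (cases "distinct (x # p)")
    case True
    then show ?thesis using less.prems by blast
  next
    case False
    then have "\<exists>xs ys zs v. x # p = xs @ [v] @ ys @ [v] @ zs" by (rule not_distinct_decomp)
    then obtain xs ys zs v where d: "x # p = xs @ v # ys @ v # zs" by auto
    have "fanp E c k y (xs @ v # (ys @ v # zs))" "fanp E c k y ((xs @ v # ys) @ v # zs)"
      using less.prems unfolding d by simp_all
    then have f: "fanp E c k y (xs @ v # zs)"
      by (simp only: fanp_append[of E c k y xs v "ys @ v # zs"] fanp_append[of E c k y "xs @ v # ys" v zs] fanp_append[of E c k y xs v zs])
    obtain q where q: "xs @ v # zs = x # q" using d by (cases xs) simp_all
    have "last (x # q) = last (x # p)" unfolding d q[symmetric] by simp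
    moreover have "length (x # q) < length (x # p)" unfolding d q[symmetric] by simp
    ultimately show ?thesis using less.hyps[of q] f q by simp
  qed
qed

lemma fan_center_disjoint_gen:
  assumes "fin_graph E" "\<not> colorable E k"
    and "{x, y} \<in> E" "proper_edge_coloring (E - {{x, y}}) c k"
    and "fanp (E - {{x, y}}) c k y (x # p)"
  shows "missing (E - {{x, y}}) c k (last (x # p)) \<inter> missing (E - {{x, y}}) c k y = {}"
proof -
  obtain q where q: "fanp (E - {{x, y}}) c k y (x # q)" "last (x # q) = last (x # p)" "distinct (x # q)"
    using fanp_distinct[OF assms(5)] by (elim exE conjE)
  show ?thesis using fan_center_disjoint[OF assms(1-4) q(3,1)] q(2) by simp
qed

text \<open>The swap makes \<open>d\<close> missing at the last fan vertex while it stays missing at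
  \<open>y\<close>. The fan survives: its spokes are untouched because \<open>y\<close> is off the
  chain, \<open>d\<close> is missing at no fan vertex, and no earlier fan vertex on the chain misses
  \<open>a\<close>.\<close>

lemma fan_swap:
  assumes g: "fin_graph E" "\<not> colorable E k" "{x, y} \<in> E"
    and p: "proper_edge_coloring (E - {{x, y}}) c k"
    and fp: "fanp (E - {{x, y}}) c k y (x # p)" and w: "last (x # p) = w"
    and a: "a \<in> missing (E - {{x, y}}) c k w" and d: "d \<in> missing (E - {{x, y}}) c k y"
    and y: "y \<notin> kcomp (E - {{x, y}}) c a d w"
    and only: "\<And>i v. i < length p \<Longrightarrow> v = (x # p) ! i \<Longrightarrow> a \<in> missing (E - {{x, y}}) c k v \<Longrightarrow> v \<notin> kcomp (E - {{x, y}}) c a d w"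
  shows False
proof -
  let ?F = "E - {{x, y}}"
  let ?C = "kcomp ?F c a d w"
  define c' where "c' = kswap c a d ?C"
  have gF: "fin_graph ?F" using g(1) fin_graph_subset by blast
  have cl: "kclosed ?F c a d ?C" using kcomp_closed[OF gF] .
  have ak: "a < k" "d < k" using missing_less[OF d] missing_less a by simp_all
  have p': "proper_edge_coloring ?F c' k" unfolding c'_def using kswap_proper[OF p cl ak] .
  have dm: "d \<notin> missing ?F c k v" if "fanp ?F c k y (x # q)" "last (x # q) = v" for q v
    using fan_center_disjoint_gen[OF g p that(1)] that(2) d by auto
  have pre: "fanp ?F c' k y (x # take j p)" if "j \<le> length p" for j
    using that
  proof (induction j)
    case (Suc j)
    have j: "j < length p" using Suc.prems by simp
    let ?u = "(x # p) ! j" and ?v = "p ! j"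
    have split: "x # p = take j (x # p) @ ?u # ?v # drop (Suc j) p"
    proof -
      have "drop j (x # p) = ?u # drop (Suc j) (x # p)" using j Cons_nth_drop_Suc[of j "x # p"] by simp
      moreover have "drop (Suc j) (x # p) = ?v # drop (Suc j) p" using j by (simp add: Cons_nth_drop_Suc)
      ultimately show ?thesis by (metis append_take_drop_id)
    qed
    have tk: "x # take j p = take j (x # p) @ [?u]" using j by (metis take_Suc_Cons take_Suc_conv_app_nth length_Cons less_SucI)
    have "fanp ?F c k y (take j (x # p) @ ?u # ?v # drop (Suc j) p)" using fp split by simp
    then have "fanp ?F c k y (take j (x # p) @ [?u])" and uv: "fanp ?F c k y (?u # ?v # drop (Suc j) p)"
      by (simp_all only: fanp_append[of _ _ _ _ "take j (x # p)" ?u "?v # drop (Suc j) p"])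
    then have fpu: "fanp ?F c k y (x # take j p)" "last (x # take j p) = ?u" using tk by auto
    have v: "{y, ?v} \<in> ?F" "c {y, ?v} \<in> missing ?F c k ?u" using uv by auto
    have c'v: "c' {y, ?v} = c {y, ?v}"
      unfolding c'_def using kswap_at_out[OF cl v(1) y] by simp
    have "c {y, ?v} \<in> missing ?F c' k ?u"
    proof (cases "?u \<in> ?C")
      case False
      then show ?thesis unfolding c'_def using missing_kswap_out[OF cl False] v(2) by simp
    next
      case True
      have "a \<notin> missing ?F c k ?u" using only[OF j refl] True by blast
      moreover have "d \<notin> missing ?F c k ?u" using dm[OF fpu] .
      ultimately have "c {y, ?v} \<noteq> a" "c {y, ?v} \<noteq> d" using v(2) by metis+
      then have "transpose a d (c {y, ?v}) = c {y, ?v}" by simp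
      then show ?thesis unfolding c'_def using missing_kswap_in[OF True ak] v(2) by metis
    qed
    then have "fanp ?F c' k y (?u # [?v])" using v(1) c'v by simp
    moreover have "fanp ?F c' k y (take j (x # p) @ [?u])" using Suc tk by simp
    ultimately have "fanp ?F c' k y (take j (x # p) @ ?u # [?v])" by (simp only: fanp_append[of _ _ _ _ "take j (x # p)" ?u "[?v]"])
    moreover have "x # take (Suc j) p = take j (x # p) @ ?u # [?v]"
      using j tk by (simp add: take_Suc_conv_app_nth)
    ultimately show ?case by simp
  qed simp
  have f': "fanp ?F c' k y (x # p)" using pre[of "length p"] by simp
  have "d \<in> missing ?F c' k w"
    unfolding c'_def using missing_kswap_in[OF kcomp_self[of w ?F c a d] ak, of d ?F c] a by simp
  moreover have "d \<in> missing ?F c' k y"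
    unfolding c'_def using missing_kswap_out[OF cl y] d by simp
  ultimately show False using fan_center_disjoint_gen[OF g p' f'] w by blast
qed

text \<open>Let \<open>w1\<close> end a shortest fan whose last vertex misses \<open>a\<close>, and
  \<open>w2\<close> a shortest such fan with a different last vertex. \<open>fan_swap\<close> forces
  \<open>y\<close> onto the chain of \<open>w1\<close>, which then has its two ends and omits
  \<open>w2\<close>. Now \<open>fan_swap\<close> applies at \<open>w2\<close>: an earlier fan vertex
  missing \<open>a\<close> can only be \<open>w1\<close>, which is off the chain of
  \<open>w2\<close>.\<close>

lemma fan_elementary:
  assumes g: "fin_graph E" "\<not> colorable E k" "{x, y} \<in> E"
    and p: "proper_edge_coloring (E - {{x, y}}) c k"
    and ne: "missing (E - {{x, y}}) c k y \<noteq> {}"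
    and q: "fanp (E - {{x, y}}) c k y (x # q)" "last (x # q) = w"
    and q': "fanp (E - {{x, y}}) c k y (x # q')" "last (x # q') = w'" and ww: "w \<noteq> w'"
  shows "missing (E - {{x, y}}) c k w \<inter> missing (E - {{x, y}}) c k w' = {}"
proof (rule ccontr)
  let ?F = "E - {{x, y}}"
  assume "\<not> ?thesis"
  then obtain a where a: "a \<in> missing ?F c k w" "a \<in> missing ?F c k w'" by blast
  obtain d where d: "d \<in> missing ?F c k y" using ne by blast
  have gF: "fin_graph ?F" using g(1) fin_graph_subset by blast
  have ak: "a < k" "d < k" using missing_less[OF d] missing_less a by simp_all
  define P where "P r \<longleftrightarrow> fanp ?F c k y (x # r) \<and> a \<in> missing ?F c k (last (x # r))" for r
  have prefix: "P (take i r)" if "P r" "i < length r" "a \<in> missing ?F c k ((x # r) ! i)" for r i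
  proof -
    have "x # r = take (Suc i) (x # r) @ drop (Suc i) (x # r)" by (metis append_take_drop_id)
    moreover have t: "take (Suc i) (x # r) = take i (x # r) @ [(x # r) ! i]" using that(2) by (simp add: take_Suc_conv_app_nth del: take_Suc_Cons)
    ultimately have "fanp ?F c k y (take i (x # r) @ (x # r) ! i # drop (Suc i) (x # r))" using that(1) unfolding P_def by (metis append.assoc append_Cons append_Nil)
    then have "fanp ?F c k y (take (Suc i) (x # r))" using fanp_append t by metis
    moreover have "last (take (Suc i) (x # r)) = (x # r) ! i" using t by simp
    ultimately show ?thesis using that(3) unfolding P_def by simp
  qed
  have "P q" "P q'" using q q' a unfolding P_def by simp_all
  from ex_has_least_nat[of P q length, OF \<open>P q\<close>] obtain r
    where r: "P r" "\<And>s. P s \<Longrightarrow> length r \<le> length s" by auto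
  define w1 where "w1 = last (x # r)"
  have w1: "a \<in> missing ?F c k w1" "fanp ?F c k y (x # r)" using r(1) unfolding P_def w1_def by blast+
  have yw1: "y \<in> kcomp ?F c a d w1"
  proof (rule ccontr)
    assume "y \<notin> kcomp ?F c a d w1"
    then show False
    proof (rule fan_swap[OF g p w1(2) w1_def[symmetric] w1(1) d])
      fix i v assume "i < length r" "v = (x # r) ! i" "a \<in> missing ?F c k v"
      then have "P (take i r)" using prefix[OF r(1)] by blast
      then have "length r \<le> length (take i r)" using r(2) by blast
      then show "v \<notin> kcomp ?F c a d w1" using \<open>i < length r\<close> by simp
    qed
  qed
  define P2 where "P2 s \<longleftrightarrow> P s \<and> last (x # s) \<noteq> w1" for s
  have "P2 q \<or> P2 q'" using \<open>P q\<close> \<open>P q'\<close> q(2) q'(2) ww unfolding P2_def by metis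
  then obtain s0 where "P2 s0" by auto
  from ex_has_least_nat[of P2 s0 length, OF this] obtain s
    where s: "P2 s" "\<And>t. P2 t \<Longrightarrow> length s \<le> length t" by auto
  define w2 where "w2 = last (x # s)"
  have w2: "a \<in> missing ?F c k w2" "fanp ?F c k y (x # s)" "w2 \<noteq> w1" using s(1) unfolding P2_def P_def w2_def by blast+
  have wy: "v \<noteq> y" if "P t" "last (x # t) = v" for t v
  proof
    assume "v = y"
    then have "a \<in> missing ?F c k y" using that unfolding P_def by blast
    moreover have "missing ?F c k v \<inter> missing ?F c k y = {}" using fan_center_disjoint_gen[OF g p] that unfolding P_def by blast
    ultimately show False using \<open>v = y\<close> by blast
  qed
  have w2n: "w2 \<notin> kcomp ?F c a d w1"
  proof (rule kcomp_third_end[OF gF p ak])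
    show "distinct [w1, y, w2]" using wy[OF r(1) w1_def[symmetric]] wy[of s w2] s(1) w2_def w2(3) unfolding P2_def by auto
    show "y \<in> kcomp ?F c a d w1" by (rule yw1)
    show "w1 \<in> kcomp ?F c a d w1" by (rule kcomp_self)
  qed (use w1 w2 d in blast)
  then have dis: "v \<notin> kcomp ?F c a d w2" if "v \<in> kcomp ?F c a d w1" for v
    using that kcomp_eq kcomp_self by metis
  show False
  proof (rule fan_swap[OF g p w2(2) w2_def[symmetric] w2(1) d])
    show "y \<notin> kcomp ?F c a d w2" using dis yw1 by blast
    fix i v assume i: "i < length s" "v = (x # s) ! i" "a \<in> missing ?F c k v"
    then have t: "P (take i s)" using prefix[of s i] s(1) unfolding P2_def by blast
    have "last (x # take i s) = v"
    proof -
      have "x # take i s = take i (x # s) @ [(x # s) ! i]" using i(1) by (metis take_Suc_Cons take_Suc_conv_app_nth length_Cons less_SucI)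
      then show ?thesis using i(2) by simp
    qed
    moreover have "\<not> P2 (take i s)" using s(2)[of "take i s"] i(1) by auto
    ultimately have "v = w1" using t unfolding P2_def by blast
    then show "v \<notin> kcomp ?F c a d w2" using dis kcomp_self by metis
  qed
qed

section \<open>Vizing's adjacency lemma and Vizing's theorem\<close>

lemma degree_Diff_edge:
  assumes "fin_graph E" "{x, y} \<in> E"
  shows "degree E v = degree (E - {{x, y}}) v + (if v = x \<or> v = y then 1 else 0)"
proof (cases "v = x \<or> v = y")
  case True
  then have "{e\<in>E. v \<in> e} = insert {x, y} {e \<in> E - {{x, y}}. v \<in> e}" using assms(2) by blast
  moreover have "finite {e \<in> E - {{x, y}}. v \<in> e}" using assms(1) unfolding fin_graph_def by simp
  ultimately show ?thesis using True unfolding degree_def by simp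
next
  case False
  then have "{e\<in>E. v \<in> e} = {e \<in> E - {{x, y}}. v \<in> e}" by blast
  then show ?thesis using False unfolding degree_def by simp
qed

text \<open>Let \<open>R\<close> be the set of all last vertices of fans. Colours missing on
  \<open>R\<close> are pairwise distinct and never missing at \<open>y\<close>, so the spokes to
  \<open>R\<close> other than \<open>xy\<close> carry exactly these colours, each once. A vertex of
  \<open>R\<close> with degree below \<open>k\<close> offsets its spoke by a missing colour of its
  own; hence the colours missing at \<open>x\<close> force as many vertices of degree
  \<open>k\<close>.\<close>

lemma fan_degree_count:
  assumes g: "fin_graph E" "\<not> colorable E k" "{x, y} \<in> E"
    and p: "proper_edge_coloring (E - {{x, y}}) c k"
    and deg: "\<And>v. degree E v \<le> k"
  shows "k + 1 \<le> degree E x + card {v \<in> nbrs E y. v \<noteq> x \<and> degree E v = k}"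
proof -
  let ?F = "E - {{x, y}}"
  let ?M = "missing ?F c k"
  have gF: "fin_graph ?F" using g(1) fin_graph_subset by blast
  have xy: "x \<noteq> y" using fin_graph_edge_neq[OF g(1,3)] .
  have cm: "card (?M v) + degree ?F v = k" for v using card_missing[OF gF p] .
  have dE: "degree E v = degree ?F v + (if v = x \<or> v = y then 1 else 0)" for v
    using degree_Diff_edge[OF g(1,3)] .
  have "card (?M y) > 0" using cm[of y] dE[of y] deg[of y] by simp
  then have ne: "?M y \<noteq> {}" by auto
  define R where "R = {w. \<exists>q. fanp ?F c k y (x # q) \<and> last (x # q) = w}"
  define R' where "R' = R - {x}"
  have xR: "x \<in> R" unfolding R_def by (intro CollectI exI[of _ "[]"]) simp
  have dis: "?M w \<inter> ?M w' = {}" if "w \<in> R" "w' \<in> R" "w \<noteq> w'" for w w'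
    using that fan_elementary[OF g p ne] unfolding R_def by blast
  have disy: "?M w \<inter> ?M y = {}" if "w \<in> R" for w
    using that fan_center_disjoint_gen[OF g p] unfolding R_def by blast
  have step: "v \<in> R" if "w \<in> R" "{y, v} \<in> ?F" "c {y, v} \<in> ?M w" for v w
  proof -
    obtain q where q: "fanp ?F c k y (x # q)" "last (x # q) = w" using \<open>w \<in> R\<close> unfolding R_def by blast
    obtain r where sp: "x # q = r @ [w]" using q(2) append_butlast_last_id[of "x # q"] by (metis list.distinct(1))
    have "fanp ?F c k y (r @ [w])" using q(1) sp by simp
    moreover have "fanp ?F c k y (w # [v])" using that by simp
    ultimately have rv: "fanp ?F c k y (r @ w # [v])" by (simp only: fanp_append[of ?F c k y r w "[v]"])
    have "(x # q) @ [v] = (r @ [w]) @ [v]" by (simp only: sp)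
    then have "x # (q @ [v]) = r @ w # [v]" by (simp only: append.assoc append.simps)
    then have "fanp ?F c k y (x # (q @ [v]))" using rv by (simp only:)
    then show ?thesis unfolding R_def by (intro CollectI exI[of _ "q @ [v]"]) simp
  qed
  have pred: "\<exists>w\<in>R. {y, v} \<in> ?F \<and> c {y, v} \<in> ?M w" if "v \<in> R'" for v
  proof -
    have "v \<in> R" "v \<noteq> x" using that unfolding R'_def by simp_all
    then obtain q where q: "fanp ?F c k y (x # q)" "last (x # q) = v" unfolding R_def by (elim CollectE exE conjE)
    have "q \<noteq> []" using q(2) \<open>v \<noteq> x\<close> by (metis last_ConsL)
    then have q2: "q = butlast q @ [v]" using q(2) append_butlast_last_id[of q] by simp
    obtain r u where r: "x # butlast q = r @ [u]" by (metis rev_exhaust list.distinct(1))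
    have "x # q = (x # butlast q) @ [v]" using q2 by simp
    then have eq: "x # q = r @ u # [v]" by (simp only: r append.assoc append.simps)
    then have "fanp ?F c k y (r @ u # [v])" using q(1) by (simp only:)
    then have u: "fanp ?F c k y (x # butlast q)" "fanp ?F c k y (u # [v])"
      unfolding r by (simp_all only: fanp_append[of ?F c k y r u "[v]"])
    have "last (x # butlast q) = u" unfolding r by simp
    then have "u \<in> R" using u(1) unfolding R_def by blast
    moreover have "{y, v} \<in> ?F" "c {y, v} \<in> ?M u" using u(2) by simp_all
    ultimately have "u \<in> R" "{y, v} \<in> ?F" "c {y, v} \<in> ?M u" by blast+
    then show ?thesis by blast
  qed
  have finR': "finite R'"
    by (rule finite_subset[OF _ finite_nbrs[OF gF, of y]]) (use pred in \<open>auto simp: nbrs_def\<close>)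
  have finR: "finite R" using finR' unfolding R'_def by simp
  let ?G = "\<Union>w\<in>R. ?M w"
  have bij: "bij_betw (\<lambda>v. c {y, v}) R' ?G"
    unfolding bij_betw_def
  proof
    show "inj_on (\<lambda>v. c {y, v}) R'"
    proof (rule inj_onI)
      fix v v' assume v: "v \<in> R'" "v' \<in> R'" "c {y, v} = c {y, v'}"
      have "{y, v} \<in> ?F" "{y, v'} \<in> ?F" using pred v by blast+
      then have "{y, v} = {y, v'}" using proper_eqD[OF p, of "{y, v}" "{y, v'}" y] v(3) by blast
      then show "v = v'" by (metis doubleton_eq_iff)
    qed
    show "(\<lambda>v. c {y, v}) ` R' = ?G"
    proof
      show "(\<lambda>v. c {y, v}) ` R' \<subseteq> ?G" using pred by blast
      show "?G \<subseteq> (\<lambda>v. c {y, v}) ` R'"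
      proof
        fix a assume "a \<in> ?G"
        then obtain w where w: "w \<in> R" "a \<in> ?M w" by blast
        have "a \<notin> ?M y" using disy[OF w(1)] w(2) by blast
        then obtain v where v: "{y, v} \<in> ?F" "c {y, v} = a"
          using not_missing_edge[OF gF missing_less[OF w(2)]] by metis
        have "v \<in> R" using step[OF w(1) v(1)] v(2) w(2) by simp
        moreover have "v \<noteq> x" using v(1) by (auto simp: insert_commute)
        ultimately show "a \<in> (\<lambda>v. c {y, v}) ` R'" using v(2) unfolding R'_def by blast
      qed
    qed
  qed
  have "card R' = card ?G" using bij_betw_same_card[OF bij] .
  also have "\<dots> = (\<Sum>w\<in>R. card (?M w))"
    by (rule card_UN_disjoint) (use finR dis in auto)
  also have "\<dots> = card (?M x) + (\<Sum>w\<in>R'. card (?M w))"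
    unfolding R'_def using sum.remove[OF finR xR] by simp
  finally have eq: "card R' = card (?M x) + (\<Sum>w\<in>R'. card (?M w))" .
  let ?K = "{w\<in>R'. degree E w = k}"
  have yR: "y \<notin> R'" using pred[of y] gF unfolding fin_graph_def by force
  have "card (R' - ?K) \<le> (\<Sum>w\<in>R' - ?K. card (?M w))"
  proof -
    have "1 \<le> card (?M w)" if "w \<in> R' - ?K" for w
      using that cm[of w] dE[of w] deg[of w] yR unfolding R'_def by auto
    then have "(\<Sum>w\<in>R' - ?K. 1) \<le> (\<Sum>w\<in>R' - ?K. card (?M w))" by (intro sum_mono)
    then show ?thesis by simp
  qed
  also have "\<dots> \<le> (\<Sum>w\<in>R'. card (?M w))" by (rule sum_mono2) (use finR' in auto)
  finally have "card (?M x) + card (R' - ?K) \<le> card R'" using eq by simp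
  moreover have "card (R' - ?K) + card ?K = card R'"
    using finR' by (metis (no_types, lifting) card_Diff_subset card_mono finite_subset le_add_diff_inverse2 mem_Collect_eq subsetI)
  ultimately have "card (?M x) \<le> card ?K" by simp
  also have "\<dots> \<le> card {v \<in> nbrs E y. v \<noteq> x \<and> degree E v = k}"
  proof (rule card_mono)
    show "finite {v \<in> nbrs E y. v \<noteq> x \<and> degree E v = k}" using finite_nbrs[OF g(1)] by simp
    show "?K \<subseteq> {v \<in> nbrs E y. v \<noteq> x \<and> degree E v = k}"
      using pred unfolding nbrs_def R'_def by blast
  qed
  finally show ?thesis using cm[of x] dE[of x] by simp
qed

lemma colorable_mono: "colorable E j \<Longrightarrow> j \<le> k \<Longrightarrow> colorable E k"
  unfolding colorable_def proper_edge_coloring_def by (meson order_less_le_trans)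

text \<open>When all degrees are below \<open>k\<close>, the fan count for the last edge finds no
  vertex of degree \<open>k\<close> and would force a degree above \<open>k\<close>.\<close>

theorem vizing:
  assumes "fin_graph E" "\<And>v. degree E v < k"
  shows "colorable E k"
proof -
  have "finite E" using assms(1) unfolding fin_graph_def by simp
  then show ?thesis using assms
  proof (induction E rule: finite_induct)
    case empty
    then show ?case unfolding colorable_def proper_edge_coloring_def by simp
  next
    case (insert e E)
    have gE: "fin_graph E" using insert.prems(1) fin_graph_subset by blast
    have le: "degree E v \<le> degree (insert e E) v" for v
      unfolding degree_def by (rule card_mono) (use insert.hyps in auto)
    have "colorable E k" by (rule insert.IH[OF gE]) (use le insert.prems(2) in \<open>meson order_le_less_trans\<close>)
    then obtain c where c: "proper_edge_coloring E c k" unfolding colorable_def by blast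
    obtain x y where xy: "e = {x, y}" using insert.prems(1) unfolding fin_graph_def by (metis card_2_iff insertI1)
    show ?case
    proof (rule ccontr)
      assume nc: "\<not> colorable (insert e E) k"
      have eq: "insert e E - {{x, y}} = E" using insert.hyps(2) xy by simp
      have "k + 1 \<le> degree (insert e E) x + card {v \<in> nbrs (insert e E) y. v \<noteq> x \<and> degree (insert e E) v = k}"
        using fan_degree_count[OF insert.prems(1) nc, of x y c] xy c eq insert.prems(2) by (simp add: less_imp_le)
      moreover have "{v \<in> nbrs (insert e E) y. v \<noteq> x \<and> degree (insert e E) v = k} = {}"
        using insert.prems(2) by (metis (mono_tags, lifting) Collect_empty_eq less_irrefl)
      ultimately have "k + 1 \<le> degree (insert e E) x" by simp
      then show False using insert.prems(2)[of x] by simp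
    qed
  qed
qed

section \<open>Low vertices at a common neighbour\<close>

lemma recolor_edge:
  assumes p: "proper_edge_coloring F c k" and e: "e \<in> F"
    and a: "\<And>v. v \<in> e \<Longrightarrow> a \<in> missing F c k v" and ne: "e \<noteq> {}"
  shows "proper_edge_coloring F (c(e := a)) k"
    and "v \<notin> e \<Longrightarrow> missing F (c(e := a)) k v = missing F c k v"
    and "v \<in> e \<Longrightarrow> missing F (c(e := a)) k v = insert (c e) (missing F c k v - {a})"
proof -
  obtain v0 where "v0 \<in> e" using ne by blast
  then have ak: "a < k" using missing_less[OF a] by blast
  have ck: "c e < k" using p e unfolding proper_edge_coloring_def by blast
  have m: "c f \<noteq> a" if "f \<in> F" "f \<inter> e \<noteq> {}" for f
  proof -
    from that(2) obtain v where "v \<in> f" "v \<in> e" by blast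
    then show ?thesis using missingD[OF a that(1)] by blast
  qed
  show "proper_edge_coloring F (c(e := a)) k"
    unfolding proper_edge_coloring_def
  proof (intro conjI ballI impI)
    fix f assume "f \<in> F"
    then show "(c(e := a)) f < k" using p ak unfolding proper_edge_coloring_def by simp
  next
    fix f h assume fh: "f \<in> F" "h \<in> F" "f \<noteq> h \<and> f \<inter> h \<noteq> {}"
    consider "f = e" | "h = e" | "f \<noteq> e" "h \<noteq> e" by blast
    then show "(c(e := a)) f \<noteq> (c(e := a)) h"
    proof cases
      case 1
      then have "h \<noteq> e" "h \<inter> e \<noteq> {}" using fh(3) by (metis, metis Int_commute)
      then show ?thesis using m[OF fh(2)] 1 by simp
    next
      case 2
      then have "f \<noteq> e" "f \<inter> e \<noteq> {}" using fh(3) by metis+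
      then show ?thesis using m[OF fh(1)] 2 by simp
    next
      case 3
      then show ?thesis using p fh unfolding proper_edge_coloring_def by simp
    qed
  qed
  show "missing F (c(e := a)) k v = missing F c k v" if "v \<notin> e"
  proof -
    have "(c(e := a)) f = c f" if "v \<in> f" for f using that \<open>v \<notin> e\<close> by (metis fun_upd_other)
    then show ?thesis unfolding missing_def by simp
  qed
  show "missing F (c(e := a)) k v = insert (c e) (missing F c k v - {a})" if "v \<in> e"
  proof (rule set_eqI)
    fix i
    show "i \<in> missing F (c(e := a)) k v \<longleftrightarrow> i \<in> insert (c e) (missing F c k v - {a})"
    proof
      assume i: "i \<in> missing F (c(e := a)) k v"
      have "i \<noteq> a" using missingD[OF i e that] by simp
      moreover have "i \<in> missing F c k v" if "i \<noteq> c e"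
      proof (rule missingI[OF missing_less[OF i]])
        fix f assume "f \<in> F" "v \<in> f"
        then show "c f \<noteq> i" using missingD[OF i, of f] that by (cases "f = e") simp_all
      qed
      ultimately show "i \<in> insert (c e) (missing F c k v - {a})" by blast
    next
      assume i: "i \<in> insert (c e) (missing F c k v - {a})"
      show "i \<in> missing F (c(e := a)) k v"
      proof (rule missingI)
        show "i < k" using i ck missing_less[of i F c k v] by blast
        fix f assume f: "f \<in> F" "v \<in> f"
        show "(c(e := a)) f \<noteq> i"
        proof (cases "f = e")
          case True
          have "c e \<noteq> a" using m[OF e] ne by blast
          then show ?thesis using i True by auto
        next
          case False
          then have "c f \<noteq> c e" using proper_eqD[OF p f(1) e f(2) that] by blast
          then show ?thesis using i False missingD[OF _ f, of i c k] by auto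
        qed
      qed
    qed
  qed
qed

section \<open>Critical graphs and Woodall-type recolouring around a low vertex\<close>

locale critical_graph =
  fixes E :: "'a set set" and k :: nat
  assumes graph: "fin_graph E"
    and degree_le: "degree E v \<le> k"
    and not_colorable: "\<not> colorable E k"
    and critical: "e \<in> E \<Longrightarrow> colorable (E - {e}) k"
begin

definition low :: "'a \<Rightarrow> bool" where
  "low v \<longleftrightarrow> 2 * degree E v < k"

lemma vizing_adjacency:
  assumes "{x, y} \<in> E"
  shows "k + 1 \<le> degree E x + card {v \<in> nbrs E y. v \<noteq> x \<and> degree E v = k}"
proof -
  obtain c where "proper_edge_coloring (E - {{x, y}}) c k"
    using critical[OF assms] unfolding colorable_def by blast
  then show ?thesis using fan_degree_count[OF graph not_colorable assms _ degree_le] by blast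
qed

text \<open>The neighbour \<open>x\<close> of \<open>y\<close> is left out of the count in the
  adjacency lemma, which turns the 1 there into 2.\<close>

lemma edge_degree_sum:
  assumes "{x, y} \<in> E"
  shows "k + 2 \<le> degree E x + degree E y"
proof -
  have "x \<in> nbrs E y" using assms unfolding nbrs_def by (simp add: insert_commute)
  then have "{v \<in> nbrs E y. v \<noteq> x \<and> degree E v = k} \<subset> nbrs E y" by blast
  then have "card {v \<in> nbrs E y. v \<noteq> x \<and> degree E v = k} < card (nbrs E y)"
    using finite_nbrs[OF graph] by (rule psubset_card_mono[rotated])
  then show ?thesis using vizing_adjacency[OF assms] degree_nbrs[OF graph, of y] by simp
qed

lemma low_independent: "{x, y} \<in> E \<Longrightarrow> low x \<Longrightarrow> \<not> low y"
  using edge_degree_sum[of x y] unfolding low_def by auto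

end

text \<open>Only the uncoloured edge is fixed; the colouring of \<open>F\<close> stays a parameter
  of each lemma because the arguments run through several recolourings.\<close>

locale critical_coloring = critical_graph +
  fixes x y :: 'a and F :: "'a set set"
  assumes xy: "{x, y} \<in> E"
    and F: "F = E - {{x, y}}"
    and low_x: "low x"
begin

lemma graph_F: "fin_graph F"
  unfolding F using graph fin_graph_subset by blast

lemma x_neq_y: "x \<noteq> y"
  using fin_graph_edge_neq[OF graph xy] .

lemma y_not_low: "\<not> low y"
  using low_independent[OF xy low_x] .

lemma missing_card:
  assumes "proper_edge_coloring F c k"
  shows "card (missing F c k v) + degree E v = k + (if v = x \<or> v = y then 1 else 0)"
  using card_missing[OF graph_F assms, of v] degree_Diff_edge[OF graph xy, of v] F by simp

lemma missing_xy_disjoint: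
  assumes "proper_edge_coloring F c k"
  shows "missing F c k x \<inter> missing F c k y = {}"
  using color_last_edge[of E x y c k] assms not_colorable unfolding F by blast

lemma missing_y_nonempty:
  assumes "proper_edge_coloring F c k"
  shows "missing F c k y \<noteq> {}"
  using missing_card[OF assms, of y] degree_le[of y] by auto

text \<open>Otherwise swapping the chain at \<open>x\<close> would make \<open>b\<close> missing at
  both ends of the uncoloured edge.\<close>

lemma linked:
  assumes p: "proper_edge_coloring F c k" and a: "a \<in> missing F c k x" and b: "b \<in> missing F c k y"
  shows "y \<in> kcomp F c a b x"
proof (rule ccontr)
  let ?C = "kcomp F c a b x"
  assume y: "y \<notin> ?C"
  have ak: "a < k" "b < k" using missing_less[OF a] missing_less[OF b] by auto
  have cl: "kclosed F c a b ?C" using kcomp_closed[OF graph_F] .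
  have p': "proper_edge_coloring F (kswap c a b ?C) k" using kswap_proper[OF p cl ak] .
  have "b \<in> missing F (kswap c a b ?C) k x"
    using missing_kswap_in[OF kcomp_self[of x F c a b] ak, of b F c] a by simp
  moreover have "b \<in> missing F (kswap c a b ?C) k y" using missing_kswap_out[OF cl y] b by simp
  ultimately show False using missing_xy_disjoint[OF p'] by blast
qed

text \<open>The chain joining \<open>x\<close> to \<open>y\<close> already has both its ends there,
  so a chain ending at another vertex \<open>v\<close> avoids them, and its swap changes no colour
  at \<open>x\<close> or \<open>y\<close>.\<close>

lemma linked_swap:
  assumes p: "proper_edge_coloring F c k" and a: "a \<in> missing F c k x" and b: "b \<in> missing F c k y"
    and v: "v \<noteq> x" "v \<noteq> y" "a \<in> missing F c k v \<or> b \<in> missing F c k v"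
  obtains c' where "proper_edge_coloring F c' k"
    "missing F c' k x = missing F c k x" "missing F c' k y = missing F c k y"
    "\<And>e. e \<in> F \<Longrightarrow> x \<in> e \<or> y \<in> e \<Longrightarrow> c' e = c e"
    "\<And>e. c e \<noteq> a \<Longrightarrow> c e \<noteq> b \<Longrightarrow> c' e = c e"
    "\<And>e. c' e = c e \<or> c' e = transpose a b (c e)"
    "\<And>e. v \<in> e \<Longrightarrow> c' e = transpose a b (c e)"
    "\<And>i. i \<in> missing F c' k v \<longleftrightarrow> transpose a b i \<in> missing F c k v"
proof -
  let ?C = "kcomp F c a b v"
  let ?D = "kcomp F c a b x"
  have ak: "a < k" "b < k" using missing_less[OF a] missing_less[OF b] by auto
  have yD: "y \<in> ?D" using linked[OF p a b] .
  have "v \<notin> ?D"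
    by (rule kcomp_third_end[OF graph_F p ak _ yD kcomp_self]) (use x_neq_y v a b in auto)
  then have nC: "w \<notin> ?C" if "w \<in> ?D" for w using that kcomp_eq kcomp_self by metis
  then have xC: "x \<notin> ?C" and yC: "y \<notin> ?C" using yD kcomp_self by metis+
  have cl: "kclosed F c a b ?C" using kcomp_closed[OF graph_F] .
  let ?c = "kswap c a b ?C"
  show ?thesis
  proof (rule that[of ?c])
    show "proper_edge_coloring F ?c k" using kswap_proper[OF p cl ak] .
    show "missing F ?c k x = missing F c k x" using missing_kswap_out[OF cl xC] .
    show "missing F ?c k y = missing F c k y" using missing_kswap_out[OF cl yC] .
    show "?c e = c e" if "e \<in> F" "x \<in> e \<or> y \<in> e" for e
      using kswap_at_out[OF cl that(1) xC] kswap_at_out[OF cl that(1) yC] that(2) by blast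
    show "?c e = c e" if "c e \<noteq> a" "c e \<noteq> b" for e
      using that unfolding kswap_def by simp
    show "?c e = c e \<or> ?c e = transpose a b (c e)" for e unfolding kswap_def by simp
    show "?c e = transpose a b (c e)" if "v \<in> e" for e using kswap_at_in[OF kcomp_self that] .
    show "i \<in> missing F ?c k v \<longleftrightarrow> transpose a b i \<in> missing F c k v" for i
      using missing_kswap_in[OF kcomp_self ak] .
  qed
qed

text \<open>This is what being low is for. At \<open>x\<close> there are k + 1 - d(x) missing
  colours, thanks to the uncoloured edge, at \<open>u\<close> there are k - d(u), and d(x) + d(u) <
  k; so at least two are shared and one of them differs from \<open>b\<close>.\<close>

lemma common_missing_avoiding:
  assumes p: "proper_edge_coloring F c k" and u: "low u" "u \<noteq> x"
  obtains a where "a \<in> missing F c k x" "a \<in> missing F c k u" "a \<noteq> b"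
proof -
  let ?X = "missing F c k x" and ?U = "missing F c k u"
  have "u \<noteq> y" using u(1) y_not_low by blast
  then have "card ?X + degree E x = k + 1" "card ?U + degree E u = k"
    using missing_card[OF p, of x] missing_card[OF p, of u] u(2) by auto
  then have "card ?X + card ?U > k + 1" using u(1) low_x unfolding low_def by linarith
  moreover have "card (?X \<union> ?U) \<le> card {..<k}" by (rule card_mono) (auto dest: missing_less)
  ultimately have "card (?X \<inter> ?U) > 1" using card_Un_Int[of ?X ?U] by simp
  then have "\<not> (?X \<inter> ?U \<subseteq> {b})" using card_mono[of "{b}" "?X \<inter> ?U"] by auto
  then show ?thesis using that by blast
qed

text \<open>Move the gap from \<open>xy\<close> to \<open>xz\<close>. Then \<open>x\<close>,
  \<open>v\<close> is a fan around \<open>z\<close>, so the two share no missing colour, but low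
  vertices always share one.\<close>

lemma woodall_missing_x:
  assumes p: "proper_edge_coloring F c k"
    and z: "{x, z} \<in> F" "c {x, z} \<in> missing F c k y"
    and v: "{z, v} \<in> E" "low v" "v \<noteq> x" "c {z, v} \<in> missing F c k x"
  shows False
proof -
  have yx: "{y, x} = {x, y}" "{z, x} = {x, z}" by (simp_all add: insert_commute)
  have zE: "{x, z} \<in> E" "z \<noteq> y" using z(1) F by auto
  have zx: "z \<noteq> x" using fin_graph_edge_neq[OF graph zE(1)] by simp
  have vy: "v \<noteq> y" using v(2) y_not_low by blast
  have vz: "v \<noteq> z" using fin_graph_edge_neq[OF graph v(1)] by simp
  define c' where "c' = c({x, y} := c {x, z})"
  have sh: "proper_edge_coloring (E - {{x, z}}) c' k"
    "\<And>w. w \<noteq> y \<Longrightarrow> w \<noteq> z \<Longrightarrow> missing (E - {{x, z}}) c' k w = missing F c k w"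
    using shift_proper(1,4)[of E y x c k z] graph xy p z unfolding yx F c'_def by blast+
  have fx: "fanp (E - {{x, z}}) c' k z (x # [v])"
  proof -
    have "{z, v} \<in> E - {{x, z}}" using v(1,3) zx by (simp_all add: doubleton_eq_iff)
    moreover have "c' {z, v} = c {z, v}" unfolding c'_def using zE(2) zx by (simp_all add: doubleton_eq_iff)
    moreover have "missing (E - {{x, z}}) c' k x = missing F c k x" using sh(2) x_neq_y zx by auto
    ultimately show ?thesis using v(4) by simp
  qed
  interpret z: critical_coloring E k x z "E - {{x, z}}"
    by unfold_locales (use zE low_x in simp_all)
  have "missing (E - {{x, z}}) c' k x \<inter> missing (E - {{x, z}}) c' k v = {}"
    by (rule fan_elementary[OF graph not_colorable zE(1) sh(1) z.missing_y_nonempty[OF sh(1)], of "[]" x "[v]" v])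
      (use fx v(3) in auto)
  then show False using z.common_missing_avoiding[OF sh(1) v(2,3), of undefined] by blast
qed

text \<open>Swap the colour of \<open>zv\<close> with a colour missing at both \<open>x\<close> and
  \<open>v\<close>, along the chain at \<open>v\<close>: this gives \<open>zv\<close> a colour
  missing at \<open>x\<close> and changes nothing at \<open>x\<close> or \<open>y\<close>.\<close>

lemma woodall_missing_y:
  assumes p: "proper_edge_coloring F c k"
    and z: "{x, z} \<in> F" "c {x, z} \<in> missing F c k y"
    and v: "{z, v} \<in> E" "low v" "v \<noteq> x" "c {z, v} \<in> missing F c k y"
  shows False
proof -
  have vy: "v \<noteq> y" using v(2) y_not_low by blast
  obtain a where a: "a \<in> missing F c k x" "a \<in> missing F c k v" using common_missing_avoiding[OF p v(2,3)] .
  obtain c' where c': "proper_edge_coloring F c' k"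
    "missing F c' k x = missing F c k x" "missing F c' k y = missing F c k y"
    "\<And>e. e \<in> F \<Longrightarrow> x \<in> e \<or> y \<in> e \<Longrightarrow> c' e = c e"
    "\<And>e. v \<in> e \<Longrightarrow> c' e = transpose a (c {z, v}) (c e)"
    using linked_swap[OF p a(1) v(4,3) vy] a(2) by metis
  have "c' {x, z} = c {x, z}" using c'(4) z(1) by blast
  moreover have "c' {z, v} = a" using c'(5)[of "{z, v}"] by simp
  ultimately show False using woodall_missing_x[OF c'(1) z(1) _ v(1,2,3)] c'(2,3) z(2) a(1) by simp
qed

text \<open>The chain through \<open>x\<close> and \<open>y\<close> is full, so the Kempe chain ending at \<open>u\<close> avoids both.\<close>

lemma low_vertex_misses:
  assumes p: "proper_edge_coloring F c k" and u: "low u" "u \<noteq> x" and b: "b \<in> missing F c k y"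
  obtains c' a where "proper_edge_coloring F c' k" "b \<in> missing F c' k u"
    "missing F c' k x = missing F c k x" "missing F c' k y = missing F c k y"
    "\<And>e. e \<in> F \<Longrightarrow> x \<in> e \<or> y \<in> e \<Longrightarrow> c' e = c e"
    "a \<in> missing F c k x" "a \<noteq> d"
    "\<And>e. c' e = c e \<or> c' e = transpose a b (c e)"
proof -
  have uy: "u \<noteq> y" using u(1) y_not_low by blast
  obtain a where a: "a \<in> missing F c k x" "a \<in> missing F c k u" "a \<noteq> d" using common_missing_avoiding[OF p u] .
  show ?thesis
  proof (cases "b \<in> missing F c k u")
    case True
    then show ?thesis using that[of c a] p a by blast
  next
    case False
    obtain c' where c': "proper_edge_coloring F c' k"
      "missing F c' k x = missing F c k x" "missing F c' k y = missing F c k y"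
      "\<And>e. e \<in> F \<Longrightarrow> x \<in> e \<or> y \<in> e \<Longrightarrow> c' e = c e"
      "\<And>e. c' e = c e \<or> c' e = transpose a b (c e)"
      "\<And>i. i \<in> missing F c' k u \<longleftrightarrow> transpose a b i \<in> missing F c k u"
      using linked_swap[OF p a(1) b u(2) uy] a(2) by metis
    have "b \<in> missing F c' k u" using c'(6)[of b] a(2) by simp
    then show ?thesis using that[of c' a] c' a by blast
  qed
qed

text \<open>
Giving \<open>yu\<close> the colour of \<open>xz\<close> frees the common colour at \<open>y\<close>; the chain at \<open>v\<close> then avoids \<open>x\<close> and
\<open>y\<close>, so \<open>zv\<close> can be moved to a colour missing at \<open>x\<close> before \<open>yu\<close> gets its old colour back.
\<close>

lemma woodall_common_color:
  assumes p: "proper_edge_coloring F c k"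
    and z: "{x, z} \<in> F" "c {x, z} \<in> missing F c k y"
    and v: "{z, v} \<in> E" "low v" "v \<noteq> x"
    and u: "{y, u} \<in> F" "low u" "c {y, u} = c {z, v}"
  shows False
proof -
  define c0 where "c0 = c {x, z}"
  define c1 where "c1 = c {z, v}"
  have zE: "{x, z} \<in> E" "z \<noteq> y" using z(1) F by auto
  have zx: "z \<noteq> x" using fin_graph_edge_neq[OF graph zE(1)] by simp
  have zl: "\<not> low z" using low_independent[OF zE(1) low_x] .
  have ux: "u \<noteq> x" using u(1) F by (auto simp: insert_commute)
  have uy: "u \<noteq> y" "v \<noteq> y" "u \<noteq> z" "v \<noteq> z" using u(2) v(2) y_not_low zl by blast+
  have zvF: "{z, v} \<in> F" using v(1) zx zE(2) unfolding F by (auto simp: doubleton_eq_iff)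
  have ne: "{x, z} \<noteq> {y, u}" "{z, v} \<noteq> {y, u}" using ux uy(3) zE(2) x_neq_y by (metis doubleton_eq_iff)+
  have c1y: "c1 \<notin> missing F c k y" using missing_edge[OF _ u(1)] u(3) c1_def by metis
  have c0y: "c0 \<in> missing F c k y" using z(2) c0_def by simp
  have c1x: "c1 \<notin> missing F c k x" using woodall_missing_x[OF p z v] c1_def by blast
  \<comment> \<open>Choosing the partner colour \<open>a\<close> different from \<open>c1\<close>
    protects \<open>zv\<close>: the swap exchanges only \<open>a\<close> and \<open>c0\<close>, and
    neither is \<open>c1\<close>.\<close>
  obtain c2 a where c2: "proper_edge_coloring F c2 k" "c0 \<in> missing F c2 k u"
    "missing F c2 k x = missing F c k x" "missing F c2 k y = missing F c k y"
    "\<And>e. e \<in> F \<Longrightarrow> x \<in> e \<or> y \<in> e \<Longrightarrow> c2 e = c e"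
    "a \<in> missing F c k x" "a \<noteq> c1" "\<And>e. c2 e = c e \<or> c2 e = transpose a c0 (c e)"
    by (rule low_vertex_misses[OF p u(2) ux c0y, where d = c1]) (rule that; assumption)
  have "c1 \<noteq> a" "c1 \<noteq> c0" using c2(7) c1y c0y by auto
  then have c2zv: "c2 {z, v} = c1" using c2(8)[of "{z, v}"] c1_def by auto
  have c2yu: "c2 {y, u} = c1" using c2(5)[OF u(1)] u(3) c1_def by simp
  have c2xz: "c2 {x, z} = c0" using c2(5)[OF z(1)] c0_def by simp
  define c3 where "c3 = c2({y, u} := c0)"
  have r3: "c0 \<in> missing F c2 k w" if "w \<in> {y, u}" for w using that c2(2,4) c0y by auto
  have c3: "proper_edge_coloring F c3 k" "missing F c3 k x = missing F c k x"
    "c1 \<in> missing F c3 k y" "c3 {z, v} = c1" "c3 {x, z} = c0" "c3 {y, u} = c0"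
    using recolor_edge[OF c2(1) u(1) r3] c2(3) c2yu c2zv c2xz ne ux x_neq_y unfolding c3_def by auto
  obtain a3 where a3: "a3 \<in> missing F c3 k x" "a3 \<in> missing F c3 k v" using common_missing_avoiding[OF c3(1) v(2,3)] .
  obtain c4 where c4: "proper_edge_coloring F c4 k"
    "missing F c4 k x = missing F c3 k x" "missing F c4 k y = missing F c3 k y"
    "\<And>e. e \<in> F \<Longrightarrow> x \<in> e \<or> y \<in> e \<Longrightarrow> c4 e = c3 e"
    "\<And>e. v \<in> e \<Longrightarrow> c4 e = transpose a3 c1 (c3 e)"
    using linked_swap[OF c3(1) a3(1) c3(3) v(3) uy(2)] a3(2) by metis
  have c4zv: "c4 {z, v} = a3" using c4(5)[of "{z, v}"] c3(4) by simp
  have c14: "c1 \<in> missing F c4 k y" using c4(3) c3(3) by simp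
  \<comment> \<open>Likewise \<open>a5\<close> is kept away from \<open>a3\<close>, so that
    \<open>zv\<close> retains its new colour while \<open>c1\<close> becomes missing at
    \<open>u\<close>.\<close>
  obtain c5 a5 where c5: "proper_edge_coloring F c5 k" "c1 \<in> missing F c5 k u"
    "missing F c5 k x = missing F c4 k x" "missing F c5 k y = missing F c4 k y"
    "\<And>e. e \<in> F \<Longrightarrow> x \<in> e \<or> y \<in> e \<Longrightarrow> c5 e = c4 e"
    "a5 \<in> missing F c4 k x" "a5 \<noteq> a3" "\<And>e. c5 e = c4 e \<or> c5 e = transpose a5 c1 (c4 e)"
    by (rule low_vertex_misses[OF c4(1) u(2) ux c14, where d = a3]) (rule that; assumption)
  have "a3 \<noteq> c1" using a3(1) c3(2) c1x by metis
  then have c5zv: "c5 {z, v} = a3" using c5(8)[of "{z, v}"] c4zv c5(7) by auto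
  have c5yu: "c5 {y, u} = c0" using c5(5)[OF u(1)] c4(4)[OF u(1)] c3(6) by simp
  have c5xz: "c5 {x, z} = c0" using c5(5)[OF z(1)] c4(4)[OF z(1)] c3(5) by simp
  define c6 where "c6 = c5({y, u} := c1)"
  have r6: "c1 \<in> missing F c5 k w" if "w \<in> {y, u}" for w using that c5(2,4) c14 by auto
  have c6: "proper_edge_coloring F c6 k" "missing F c6 k x = missing F c k x"
    "c0 \<in> missing F c6 k y" "c6 {z, v} = a3" "c6 {x, z} = c0"
    using recolor_edge[OF c5(1) u(1) r6] c5(3) c4(2) c3(2) c5yu c5zv c5xz ne ux x_neq_y unfolding c6_def by auto
  show False using woodall_missing_x[OF c6(1) z(1) _ v] c6(2-5) a3(1) c3(2) by simp
qed

text \<open>Leaving out \<open>x\<close> makes the count uniform: one less than the number of low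
  neighbours both at \<open>y\<close>, where \<open>xy\<close> is uncoloured, and at other
  neighbours of \<open>x\<close>, where the edge to \<open>x\<close> is coloured.\<close>

definition low_colors :: "('a set \<Rightarrow> nat) \<Rightarrow> 'a \<Rightarrow> nat set" where
  "low_colors c w = {c {w, v} | v. {w, v} \<in> F \<and> low v \<and> v \<noteq> x}"

lemma woodall_base:
  assumes p: "proper_edge_coloring F c k"
    and z: "{x, z} \<in> F" "c {x, z} \<in> missing F c k y"
    and v: "{z, v} \<in> E" "low v" "v \<noteq> x"
  shows "c {z, v} \<notin> missing F c k x \<union> missing F c k y \<union> low_colors c y"
proof -
  have "c {z, v} \<notin> low_colors c y"
  proof
    assume "c {z, v} \<in> low_colors c y"
    then obtain u where "{y, u} \<in> F" "low u" "c {y, u} = c {z, v}" unfolding low_colors_def by auto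
    then show False using woodall_common_color[OF p z v] by blast
  qed
  then show ?thesis using woodall_missing_x[OF p z v] woodall_missing_y[OF p z v] by blast
qed

text \<open>A colour on \<open>yu\<close> with \<open>u\<close> low is as good as one missing at
  \<open>y\<close>, since recolouring \<open>yu\<close> with a missing colour \<open>b\<close>
  releases it. This trades \<open>b\<close> into the low colours and the old colour into the missing
  ones, so the forbidden union stays the same.\<close>

lemma woodall:
  assumes p: "proper_edge_coloring F c k"
    and z: "{x, z} \<in> F" "c {x, z} \<in> missing F c k y \<union> low_colors c y"
    and v: "{z, v} \<in> E" "low v" "v \<noteq> x"
  shows "c {z, v} \<notin> missing F c k x \<union> missing F c k y \<union> low_colors c y"
proof (cases "c {x, z} \<in> missing F c k y")
  case True
  then show ?thesis using woodall_base[OF p z(1) _ v] by blast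
next
  case False
  then obtain u where u: "{y, u} \<in> F" "low u" "u \<noteq> x" "c {y, u} = c {x, z}"
    using z(2) unfolding low_colors_def by auto
  define c0 where "c0 = c {x, z}"
  define c1 where "c1 = c {z, v}"
  have zE: "{x, z} \<in> E" "z \<noteq> y" using z(1) F by auto
  have zx: "z \<noteq> x" using fin_graph_edge_neq[OF graph zE(1)] by simp
  have zl: "\<not> low z" using low_independent[OF zE(1) low_x] .
  have uy: "u \<noteq> y" "v \<noteq> y" "u \<noteq> z" "v \<noteq> z" using u(2) v(2) y_not_low zl by blast+
  have zvF: "{z, v} \<in> F" using v(1) zx zE(2) unfolding F by (auto simp: doubleton_eq_iff)
  have ne: "{x, z} \<noteq> {y, u}" "{z, v} \<noteq> {y, u}" using u(3) uy(3) zE(2) x_neq_y by (metis doubleton_eq_iff)+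
  obtain b where b: "b \<in> missing F c k y" using missing_y_nonempty[OF p] by blast
  obtain c2 a where c2: "proper_edge_coloring F c2 k" "b \<in> missing F c2 k u"
    "missing F c2 k x = missing F c k x" "missing F c2 k y = missing F c k y"
    "\<And>e. e \<in> F \<Longrightarrow> x \<in> e \<or> y \<in> e \<Longrightarrow> c2 e = c e"
    "a \<in> missing F c k x" "a \<noteq> 0" "\<And>e. c2 e = c e \<or> c2 e = transpose a b (c e)"
    by (rule low_vertex_misses[OF p u(2,3) b, where d = 0]) (rule that; assumption)
  have c2yu: "c2 {y, u} = c0" using c2(5)[OF u(1)] u(4) c0_def by simp
  have c2xz: "c2 {x, z} = c0" using c2(5)[OF z(1)] c0_def by simp
  define c3 where "c3 = c2({y, u} := b)"
  have r3: "b \<in> missing F c2 k w" if "w \<in> {y, u}" for w using that c2(2,4) b by auto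
  have c3: "proper_edge_coloring F c3 k" "missing F c3 k x = missing F c k x"
    "missing F c3 k y = insert c0 (missing F c k y - {b})" "c3 {z, v} = c2 {z, v}" "c3 {x, z} = c0" "c3 {y, u} = b"
    using recolor_edge[OF c2(1) u(1) r3] c2(3,4) c2yu c2xz ne u(3) x_neq_y unfolding c3_def by auto
  have "c3 {x, z} \<in> missing F c3 k y" using c3(3,5) by simp
  note base = woodall_base[OF c3(1) z(1) this v]
  have bl: "b \<in> low_colors c3 y" unfolding low_colors_def using u(1-3) c3(6) by blast
  show ?thesis
  proof
    assume asm: "c {z, v} \<in> missing F c k x \<union> missing F c k y \<union> low_colors c y"
    have "c3 {z, v} \<in> missing F c3 k x \<union> missing F c3 k y \<union> low_colors c3 y"
    \<comment> \<open>Making \<open>b\<close> missing at \<open>u\<close> may have exchanged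
      \<open>a\<close> and \<open>b\<close> on \<open>zv\<close>, but both are in the forbidden
      union: \<open>a\<close> is missing at \<open>x\<close>, and \<open>b\<close> is now the colour
      of \<open>yu\<close>.\<close>
    proof (cases "c1 = a \<or> c1 = b")
      case True
      then have "c3 {z, v} = a \<or> c3 {z, v} = b" using c2(8)[of "{z, v}"] c3(4) c1_def by auto
      then show ?thesis using bl c2(6) c3(2) by blast
    next
      case False
      then have eq: "c3 {z, v} = c1" using c2(8)[of "{z, v}"] c3(4) c1_def by auto
      consider "c1 \<in> missing F c k x" | "c1 \<in> missing F c k y" | "c1 \<in> low_colors c y"
        using asm c1_def by blast
      then show ?thesis
      proof cases
        case 1
        then show ?thesis using eq c3(2) by simp
      next
        case 2
        then show ?thesis using eq c3(3) False by simp
      next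
        case 3
        then obtain w where w: "{y, w} \<in> F" "low w" "w \<noteq> x" "c {y, w} = c1" unfolding low_colors_def by auto
        have "w \<noteq> u"
        proof
          assume "w = u"
          then have "c {z, v} = c {x, z}" using w(4) u(4) c1_def by simp
          then have "{z, v} = {x, z}" using proper_eqD[OF p zvF z(1), of z] by blast
          then show False using v(3) zx by (simp_all add: doubleton_eq_iff)
        qed
        then have "{y, w} \<noteq> {y, u}" by (simp_all add: doubleton_eq_iff)
        then have "c3 {y, w} = c1" using c2(5)[OF w(1)] w(4) unfolding c3_def by simp
        then have "c1 \<in> low_colors c3 y" unfolding low_colors_def using w by blast
        then show ?thesis using eq by simp
      qed
    qed
    then show False using base by blast
  qed
qed

end

section \<open>How many low vertices can share the neighbours of a low vertex\<close>

section \<open>Private neighbours of low vertices\<close>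

lemma ratio_plus_inverse_ge_2: "p > 0 \<Longrightarrow> q > 0 \<Longrightarrow> p / q + q / p \<ge> (2::real)"
proof -
  assume pq: "p > 0" "q > 0"
  have "p / q + q / p - 2 = (p - q)\<^sup>2 / (p * q)" using pq by (simp add: field_simps power2_eq_square)
  also have "\<dots> \<ge> 0" using pq by simp
  finally show ?thesis by simp
qed

context critical_graph
begin

definition low_nbrs :: "'a \<Rightarrow> 'a set" where
  "low_nbrs y = {v \<in> nbrs E y. low v}"

lemma finite_low_nbrs: "finite (low_nbrs y)"
  unfolding low_nbrs_def using finite_nbrs[OF graph] by simp

end

context critical_coloring
begin

text \<open>Otherwise \<open>x\<close>, \<open>u\<close> would be a fan around \<open>y\<close>,
  whose vertices share no missing colour, although both are low.\<close>

lemma low_colors_missing_x: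
  assumes p: "proper_edge_coloring F c k"
  shows "low_colors c y \<inter> missing F c k x = {}"
proof (rule ccontr)
  assume "\<not> ?thesis"
  then obtain u where u: "{y, u} \<in> F" "low u" "u \<noteq> x" "c {y, u} \<in> missing F c k x"
    unfolding low_colors_def by blast
  have "missing (E - {{x, y}}) c k x \<inter> missing (E - {{x, y}}) c k u = {}"
    by (rule fan_elementary[OF graph not_colorable xy, of c "[]" x "[u]" u])
      (use p u missing_y_nonempty[OF p] in \<open>auto simp: F\<close>)
  then show False using common_missing_avoiding[OF p u(2,3), of 0] unfolding F by blast
qed

lemma F_nbr:
  assumes "w \<noteq> x"
  shows "{w, v} \<in> F \<and> v \<noteq> x \<longleftrightarrow> v \<in> nbrs E w \<and> v \<noteq> x"
  using assms unfolding F nbrs_def by (auto simp: doubleton_eq_iff)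

lemma card_low_colors:
  assumes p: "proper_edge_coloring F c k" and w: "{x, w} \<in> E"
  shows "card (low_colors c w) + 1 = card (low_nbrs w)"
proof -
  have wx: "w \<noteq> x" using fin_graph_edge_neq[OF graph w] by simp
  have "low_colors c w = (\<lambda>v. c {w, v}) ` (low_nbrs w - {x})"
    unfolding low_colors_def low_nbrs_def using F_nbr[OF wx] by blast
  moreover have "inj_on (\<lambda>v. c {w, v}) (low_nbrs w - {x})"
  proof (rule inj_onI)
    fix v v' assume v: "v \<in> low_nbrs w - {x}" "v' \<in> low_nbrs w - {x}" "c {w, v} = c {w, v'}"
    then have "{w, v} \<in> F" "{w, v'} \<in> F" using F_nbr[OF wx] unfolding low_nbrs_def by blast+
    then have "{w, v} = {w, v'}" using proper_eqD[OF p, of "{w, v}" "{w, v'}" w] v(3) by blast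
    then show "v = v'" by (metis doubleton_eq_iff)
  qed
  ultimately have "card (low_colors c w) = card (low_nbrs w - {x})" by (simp add: card_image)
  moreover have "x \<in> low_nbrs w" unfolding low_nbrs_def nbrs_def using low_x w by (simp add: insert_commute)
  ultimately show ?thesis using finite_low_nbrs[of w] by (metis card_Suc_Diff1 Suc_eq_plus1)
qed

text \<open>No colour of \<open>T\<close> is missing at \<open>x\<close>, so each occurs on an edge
  \<open>xz\<close>. By \<open>woodall\<close> the low colours at such a \<open>z\<close> avoid
  \<open>T\<close> and the k + 1 - d(x) colours missing at \<open>x\<close>, so at most d(x) - 1 -
  |T| remain. One colour missing at \<open>y\<close> makes up for \<open>x\<close> itself, so |T| is
  at least the number of low neighbours of \<open>y\<close>.\<close>

lemma many_small_low_nbrs: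
  obtains Z where "Z \<subseteq> nbrs E x" "card Z = card (low_nbrs y)"
    "\<And>z. z \<in> Z \<Longrightarrow> card (low_nbrs z) + card (low_nbrs y) \<le> degree E x"
proof -
  obtain c where p: "proper_edge_coloring F c k"
    using critical[OF xy] unfolding colorable_def F by blast
  define T where "T = missing F c k y \<union> low_colors c y"
  have low_fin: "finite (low_colors c w)" for w
  proof -
    have "low_colors c w \<subseteq> c ` F" unfolding low_colors_def by blast
    then show ?thesis using graph_F unfolding fin_graph_def by (meson finite_imageI finite_subset)
  qed
  have less: "i < k" if "i \<in> low_colors c w" for i w
    using that p unfolding low_colors_def proper_edge_coloring_def by blast
  have my: "card (missing F c k y) \<ge> 1" using missing_y_nonempty[OF p] by (simp add: Suc_le_eq card_gt_0_iff)
  have "missing F c k y \<inter> low_colors c y = {}"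
    unfolding low_colors_def missing_def by blast
  then have "card T = card (missing F c k y) + card (low_colors c y)"
    unfolding T_def using low_fin by (simp add: card_Un_disjoint)
  then have cT: "card T \<ge> card (low_nbrs y)" using my card_low_colors[OF p xy] by simp
  have Tx: "T \<inter> missing F c k x = {}"
    using low_colors_missing_x[OF p] missing_xy_disjoint[OF p] unfolding T_def by blast
  have Tk: "T \<subseteq> {..<k}" unfolding T_def using less missing_less[of _ F c k y] by blast
  then have finT: "finite T" by (meson finite_lessThan finite_subset)
  define Zs where "Zs = {z. {x, z} \<in> F \<and> c {x, z} \<in> T}"
  have "bij_betw (\<lambda>z. c {x, z}) Zs T"
    unfolding bij_betw_def
  proof
    show "inj_on (\<lambda>z. c {x, z}) Zs"
    proof (rule inj_onI)
      fix v v' assume v: "v \<in> Zs" "v' \<in> Zs" "c {x, v} = c {x, v'}"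
      then have "{x, v} = {x, v'}" using proper_eqD[OF p, of "{x, v}" "{x, v'}" x] unfolding Zs_def by blast
      then show "v = v'" by (metis doubleton_eq_iff)
    qed
    show "(\<lambda>z. c {x, z}) ` Zs = T"
    proof
      show "(\<lambda>z. c {x, z}) ` Zs \<subseteq> T" unfolding Zs_def by blast
      show "T \<subseteq> (\<lambda>z. c {x, z}) ` Zs"
      proof
        fix t assume t: "t \<in> T"
        have "t < k" "t \<notin> missing F c k x" using t Tk Tx by blast+
        then obtain z where "{x, z} \<in> F" "c {x, z} = t" using not_missing_edge[OF graph_F] by metis
        then show "t \<in> (\<lambda>z. c {x, z}) ` Zs" using t unfolding Zs_def by blast
      qed
    qed
  qed
  then have cZ: "card Zs = card T" using bij_betw_same_card by blast
  have small: "card (low_nbrs z) + card T \<le> degree E x" if "z \<in> Zs" for z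
  proof -
    have z: "{x, z} \<in> F" "c {x, z} \<in> missing F c k y \<union> low_colors c y" using that unfolding Zs_def T_def by simp_all
    have zE: "{x, z} \<in> E" using z(1) F by simp
    let ?M = "missing F c k x"
    have "low_colors c z \<subseteq> {..<k} - (?M \<union> T)"
    proof
      fix i assume i: "i \<in> low_colors c z"
      then obtain v where v: "i = c {z, v}" "{z, v} \<in> F" "low v" "v \<noteq> x"
        unfolding low_colors_def by (elim CollectE exE conjE)
      have "{z, v} \<in> E" using v(2) F by simp
      then have "i \<notin> ?M \<union> T" using woodall[OF p z _ v(3,4)] v(1) unfolding T_def by (simp add: Un_assoc)
      then show "i \<in> {..<k} - (?M \<union> T)" using less[OF i] by simp
    qed
    then have "card (low_colors c z) \<le> card ({..<k} - (?M \<union> T))" by (intro card_mono) auto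
    also have "\<dots> = k - card (?M \<union> T)"
    proof -
      have "?M \<union> T \<subseteq> {..<k}" using Tk missing_less[of _ F c k x] by blast
      then show ?thesis using finT by (simp add: card_Diff_subset)
    qed
    also have "card (?M \<union> T) = card ?M + card T" using Tx finT by (simp add: card_Un_disjoint Int_commute)
    finally have "card (low_colors c z) \<le> k - (card ?M + card T)" .
    moreover have "card ?M + card T \<le> k"
    proof -
      have "card (?M \<union> T) \<le> card {..<k}" by (rule card_mono) (use Tk missing_less[of _ F c k x] in blast)+
      then show ?thesis using \<open>card (?M \<union> T) = card ?M + card T\<close> by simp
    qed
    moreover have "card ?M + degree E x = k + 1" using missing_card[OF p, of x] by simp
    ultimately show ?thesis using card_low_colors[OF p zE] by simp
  qed
  obtain Z where Z: "Z \<subseteq> Zs" "card Z = card (low_nbrs y)"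
    using cT cZ by (metis obtain_subset_with_card_n)
  show ?thesis
  proof (rule that[OF _ Z(2)])
    show "Z \<subseteq> nbrs E x" using Z(1) unfolding Zs_def nbrs_def F by blast
    show "card (low_nbrs z) + card (low_nbrs y) \<le> degree E x" if "z \<in> Z" for z
      using small[of z] that Z(1) cT by (meson add_le_cancel_left le_trans subsetD)
  qed
qed

end

context critical_graph
begin

text \<open>Let \<open>y\<close> be the neighbour with the most low neighbours, P in number. Then P
  neighbours of \<open>x\<close> have at most q = d(x) - P low neighbours, the other q have at most
  P, and the sum is at least P/q + q/P.\<close>

lemma low_weight:
  assumes x: "low x" and d: "degree E x > 0"
  shows "2 \<le> (\<Sum>y\<in>nbrs E x. 1 / real (card (low_nbrs y)))"
proof -
  let ?N = "nbrs E x" and ?l = "\<lambda>y. card (low_nbrs y)"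
  have fin: "finite ?N" using finite_nbrs[OF graph] .
  have dN: "degree E x = card ?N" using degree_nbrs[OF graph] .
  then have ne: "?N \<noteq> {}" using d by auto
  have pos: "?l y \<ge> 1" if "y \<in> ?N" for y
  proof -
    have "x \<in> low_nbrs y" unfolding low_nbrs_def using x that nbrs_sym[of y E x] by simp
    then show ?thesis using finite_low_nbrs[of y] by (metis One_nat_def Suc_leI card_gt_0_iff empty_iff)
  qed
  define P where "P = Max (?l ` ?N)"
  have "P \<in> ?l ` ?N" unfolding P_def using fin ne by simp
  then obtain y where y: "y \<in> ?N" "?l y = P" by auto
  have max: "?l z \<le> P" if "z \<in> ?N" for z unfolding P_def using fin that by simp
  interpret critical_coloring E k x y "E - {{x, y}}"
    by unfold_locales (use y x in \<open>simp_all add: nbrs_def\<close>)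
  obtain Z where Z: "Z \<subseteq> ?N" "card Z = P" "\<And>z. z \<in> Z \<Longrightarrow> ?l z + P \<le> degree E x"
    using many_small_low_nbrs y(2) by metis
  have P1: "P \<ge> 1" using pos[OF y(1)] y(2) by simp
  then obtain z0 where "z0 \<in> Z" using Z(2) by (metis card.empty equals0I not_one_le_zero)
  then have dP: "degree E x \<ge> P + 1" using Z(3)[of z0] pos[of z0] Z(1) by force
  define q where "q = degree E x - P"
  have q: "q \<ge> 1" "degree E x = P + q" using dP unfolding q_def by auto
  have finZ: "finite Z" using Z(1) fin finite_subset by blast
  have "real P / real q = (\<Sum>z\<in>Z. 1 / real q)" using Z(2) by simp
  also have "\<dots> \<le> (\<Sum>z\<in>Z. 1 / real (?l z))"
  proof (rule sum_mono)
    fix z assume z: "z \<in> Z"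
    then have "?l z \<le> q" "?l z \<ge> 1" using Z(3)[OF z] q(2) pos[of z] Z(1) by auto
    then show "1 / real q \<le> 1 / real (?l z)" by (simp add: frac_le)
  qed
  finally have a: "real P / real q \<le> (\<Sum>z\<in>Z. 1 / real (?l z))" .
  have "card (?N - Z) = q" using Z(1,2) fin finZ q(2) dN by (simp add: card_Diff_subset)
  then have "real q / real P = (\<Sum>z\<in>?N - Z. 1 / real P)" by simp
  also have "\<dots> \<le> (\<Sum>z\<in>?N - Z. 1 / real (?l z))"
  proof (rule sum_mono)
    fix z assume z: "z \<in> ?N - Z"
    then have "?l z \<le> P" "?l z \<ge> 1" using max pos by auto
    then show "1 / real P \<le> 1 / real (?l z)" by (simp add: frac_le)
  qed
  finally have b: "real q / real P \<le> (\<Sum>z\<in>?N - Z. 1 / real (?l z))" .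
  have "(\<Sum>y\<in>?N. 1 / real (?l y)) = (\<Sum>z\<in>Z. 1 / real (?l z)) + (\<Sum>z\<in>?N - Z. 1 / real (?l z))"
    using sum.subset_diff[OF Z(1) fin, of "\<lambda>z. 1 / real (?l z)"] by simp
  then show ?thesis using a b ratio_plus_inverse_ge_2[of "real P" "real q"] P1 q(1) by linarith
qed

end

section \<open>Two-fold assignments by alternating paths\<close>

definition owned :: "('h \<Rightarrow> 'l option) \<Rightarrow> 'l \<Rightarrow> 'h set" where
  "owned m x = {y. m y = Some x}"

definition valid_assignment :: "('l \<Rightarrow> 'h set) \<Rightarrow> ('h \<Rightarrow> 'l option) \<Rightarrow> bool" where
  "valid_assignment Adj m \<longleftrightarrow> (\<forall>y x. m y = Some x \<longrightarrow> y \<in> Adj x)"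

text \<open>An augmenting path recorded only by its vertices in \<open>Y\<close>; the vertices
  between them are the owners given by \<open>m\<close>, and the last vertex is free.\<close>

fun augp :: "('l \<Rightarrow> 'h set) \<Rightarrow> 'h set \<Rightarrow> ('h \<Rightarrow> 'l option) \<Rightarrow> 'l \<Rightarrow> 'h list \<Rightarrow> bool" where
  "augp Adj Y m x [] = False"
| "augp Adj Y m x [y] = (y \<in> Adj x \<inter> Y \<and> m y = None)"
| "augp Adj Y m x (y # y' # ys) = (y \<in> Adj x \<inter> Y \<and> (\<exists>x'. m y = Some x' \<and> augp Adj Y m x' (y' # ys)))"

lemma augp_cong:
  "(\<And>y. y \<in> set ys \<Longrightarrow> m' y = m y) \<Longrightarrow> augp Adj Y m x ys \<Longrightarrow> augp Adj Y m' x ys"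
  by (induction Adj Y m x ys rule: augp.induct) auto

lemma augp_tail: "augp Adj Y m x (as @ y # bs) \<Longrightarrow> bs \<noteq> [] \<Longrightarrow> \<exists>x'. m y = Some x' \<and> augp Adj Y m x' bs"
proof (induction as arbitrary: x)
  case Nil
  then show ?case by (cases bs) auto
next
  case (Cons a as)
  then show ?case by (cases "as @ y # bs") auto
qed

lemma augp_replace_tail:
  "augp Adj Y m x (as @ y # bs) \<Longrightarrow> m y = Some x' \<Longrightarrow> augp Adj Y m x' cs \<Longrightarrow> augp Adj Y m x (as @ y # cs)"
proof (induction as arbitrary: x)
  case Nil
  have "cs \<noteq> []" using Nil(3) by auto
  then obtain c cs' where "cs = c # cs'" by (cases cs) auto
  then show ?case using Nil by (cases bs) auto
next
  case (Cons a as)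
  obtain b bs' where b: "as @ y # bs = b # bs'" by (cases as) auto
  obtain c cs' where c: "as @ y # cs = c # cs'" by (cases as) auto
  show ?case using Cons b c by auto
qed

lemma augp_distinct:
  assumes "augp Adj Y m x ys"
  shows "\<exists>zs. augp Adj Y m x zs \<and> distinct zs"
  using assms
proof (induction "length ys" arbitrary: ys rule: less_induct)
  case less
  show ?case
  proof (cases "distinct ys")
    case True
    then show ?thesis using less.prems by blast
  next
    case False
    then have "\<exists>as bs cs y. ys = as @ [y] @ bs @ [y] @ cs" by (rule not_distinct_decomp)
    then obtain as bs cs y where d: "ys = as @ y # bs @ y # cs" by auto
    obtain x1 where x1: "m y = Some x1" "augp Adj Y m x1 (bs @ y # cs)"
      using augp_tail[of Adj Y m x as y "bs @ y # cs"] less.prems d by auto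
    have "cs \<noteq> []"
    proof
      assume "cs = []"
      then have "augp Adj Y m x1 (bs @ [y])" using x1(2) by simp
      moreover have "augp Adj Y m u (bs @ [y]) \<Longrightarrow> m y = None" for u
      proof (induction bs arbitrary: u)
        case (Cons b bs)
        then show ?case by (cases "bs @ [y]") auto
      qed simp
      ultimately show False using x1(1) by simp
    qed
    then have "augp Adj Y m x1 cs" using augp_tail[OF x1(2)] x1(1) by auto
    then have "augp Adj Y m x (as @ y # cs)"
      using augp_replace_tail[of Adj Y m x as y "bs @ y # cs" x1 cs] less.prems d x1(1) by simp
    moreover have "length (as @ y # cs) < length ys" using d by simp
    ultimately show ?thesis using less.hyps by blast
  qed
qed

text \<open>Flip the path: its first vertex passes to \<open>x\<close>, and the rest compensates the
  former owner. Only the free last vertex becomes newly assigned.\<close>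

lemma augment:
  assumes "augp Adj Y m x ys" "distinct ys" "valid_assignment Adj m" "\<And>v. finite (owned m v)"
  shows "\<exists>m' y. valid_assignment Adj m' \<and> (\<forall>u. u \<notin> Y \<longrightarrow> m' u = m u) \<and> m y = None \<and> y \<in> Y \<and>
    {u. m' u \<noteq> None} = insert y {u. m u \<noteq> None} \<and> (\<forall>v. finite (owned m' v)) \<and>
    (\<forall>v. card (owned m' v) = card (owned m v) + (if v = x then 1 else 0))"
  using assms
proof (induction ys arbitrary: x m)
  case Nil
  then show ?case by simp
next
  case (Cons y ys)
  show ?case
  proof (cases ys)
    case Nil
    define m' where "m' = m(y := Some x)"
    have y: "y \<in> Adj x" "y \<in> Y" "m y = None" using Cons.prems(1) Nil by auto
    have o: "owned m' v = (if v = x then insert y (owned m v) else owned m v)" for v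
      unfolding owned_def m'_def using y(3) by auto
    have "y \<notin> owned m x" unfolding owned_def using y(3) by simp
    then have "card (owned m' v) = card (owned m v) + (if v = x then 1 else 0)" "finite (owned m' v)" for v
      unfolding o using Cons.prems(4)[of v] by auto
    moreover have "valid_assignment Adj m'" using Cons.prems(3) y(1) unfolding valid_assignment_def m'_def by auto
    moreover have "{u. m' u \<noteq> None} = insert y {u. m u \<noteq> None}" unfolding m'_def by auto
    moreover have "\<forall>u. u \<notin> Y \<longrightarrow> m' u = m u" unfolding m'_def using y(2) by auto
    ultimately show ?thesis using y by blast
  next
    case ys: (Cons y' ys')
    obtain x' where x': "m y = Some x'" "augp Adj Y m x' ys" "y \<in> Adj x" "y \<in> Y"
      using Cons.prems(1) ys by auto
    define m1 where "m1 = m(y := Some x)"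
    have a1: "augp Adj Y m1 x' ys"
      by (rule augp_cong[OF _ x'(2)]) (use Cons.prems(2) in \<open>auto simp: m1_def\<close>)
    have v1: "valid_assignment Adj m1" using Cons.prems(3) x'(3) unfolding valid_assignment_def m1_def by auto
    have o1: "owned m1 v = (if v = x then insert y (owned m v) else owned m v - {y})" for v
      unfolding owned_def m1_def by auto
    have f1: "finite (owned m1 v)" for v unfolding o1 using Cons.prems(4)[of v] by auto
    have yo: "y \<in> owned m v \<longleftrightarrow> v = x'" for v unfolding owned_def using x'(1) by auto
    \<comment> \<open>Both corrections are kept in one equation because the former owner may be
      \<open>x\<close> itself, in which case they cancel.\<close>
    have c1: "card (owned m1 v) + (if v = x' then 1 else 0) = card (owned m v) + (if v = x then 1 else 0)" for v
    proof (cases "v = x'")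
      case True
      then have yv: "y \<in> owned m v" using yo by simp
      have e: "card (owned m v - {y}) + 1 = card (owned m v)"
        using card_Suc_Diff1[OF Cons.prems(4) yv] by simp
      have i: "insert y (owned m v) = owned m v" using yv by blast
      show ?thesis
      proof (cases "v = x")
        case xx: True
        have "owned m1 v = owned m v" using o1[of v] i xx by metis
        then show ?thesis using True xx by metis
      next
        case xx: False
        have "owned m1 v = owned m v - {y}" using o1[of v] xx by metis
        then show ?thesis using e True xx by simp
      qed
    next
      case False
      then have "y \<notin> owned m v" using yo by simp
      then have i: "owned m v - {y} = owned m v" "card (insert y (owned m v)) = card (owned m v) + 1"
        using card_insert_disjoint[OF Cons.prems(4)] by (blast, metis Suc_eq_plus1)
      show ?thesis
      proof (cases "v = x")
        case xx: True
        have "owned m1 v = insert y (owned m v)" using o1[of v] xx by metis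
        then show ?thesis using False xx i(2) by simp
      next
        case xx: False
        have "owned m1 v = owned m v" using o1[of v] xx i(1) by metis
        then show ?thesis using False xx by simp
      qed
    qed
    have "distinct ys" using Cons.prems(2) by simp
    from Cons.IH[OF a1 this v1 f1] obtain m' u where m': "valid_assignment Adj m'"
      "\<forall>u. u \<notin> Y \<longrightarrow> m' u = m1 u" "m1 u = None" "u \<in> Y"
      "{u. m' u \<noteq> None} = insert u {u. m1 u \<noteq> None}" "\<forall>v. finite (owned m' v)"
      "\<forall>v. card (owned m' v) = card (owned m1 v) + (if v = x' then 1 else 0)" by blast
    have "\<forall>u. u \<notin> Y \<longrightarrow> m' u = m u" using m'(2) x'(4) unfolding m1_def by auto
    moreover have "m u = None" using m'(3) unfolding m1_def by (auto split: if_splits)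
    moreover have "{w. m' w \<noteq> None} = insert u {w. m w \<noteq> None}"
    proof -
      have "{w. m1 w \<noteq> None} = {w. m w \<noteq> None}" unfolding m1_def using x'(1) by auto
      then show ?thesis using m'(5) by simp
    qed
    moreover have "\<forall>v. card (owned m' v) = card (owned m v) + (if v = x then 1 else 0)"
    proof
      fix v
      show "card (owned m' v) = card (owned m v) + (if v = x then 1 else 0)"
        using m'(7)[rule_format, of v] c1[of v] by (simp only:)
    qed
    ultimately show ?thesis using m'(1,4,6) by (intro exI[of _ m'] exI[of _ u] conjI)
  qed
qed

lemma augp_reach:
  assumes "(x, x') \<in> {(p, q). \<exists>y\<in>Adj p \<inter> Y. m y = Some q}\<^sup>*" "y \<in> Adj x' \<inter> Y" "m y = None"
  shows "\<exists>ys. augp Adj Y m x ys"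
  using assms(1)
proof (induction rule: converse_rtrancl_induct)
  case base
  have "augp Adj Y m x' [y]" using assms(2,3) by simp
  then show ?case by blast
next
  case (step p q)
  then obtain ys u where u: "augp Adj Y m q ys" "u \<in> Adj p \<inter> Y" "m u = Some q" by blast
  then have "augp Adj Y m p (u # ys)" by (cases ys) auto
  then show ?case by blast
qed

lemma of_nat_divide_le_1: "a \<le> b \<Longrightarrow> real a / real b \<le> 1"
  by (cases "b = 0") simp_all

text \<open>Take an assignment covering as much as possible and, among these, as much of
  \<open>Y\<close> as possible. A vertex with fewer than two private neighbours would reach a set
  whose neighbourhood is entirely owned by that set, hence less than twice as large, against the
  weights. The final \<open>A\<close> is closed, as otherwise an assigned vertex outside
  \<open>Y\<close> could be traded for a free one inside \<open>Y\<close>.\<close>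

theorem two_fold_assignment:
  fixes Adj :: "'l \<Rightarrow> 'h set"
  assumes finL: "finite L" and adj: "\<And>x. x \<in> L \<Longrightarrow> finite (Adj x)" and none: "\<And>x. x \<notin> L \<Longrightarrow> Adj x = {}"
    and weight: "\<And>x. x \<in> L \<Longrightarrow> 2 \<le> (\<Sum>y\<in>Adj x. 1 / real (card {x'\<in>L. y \<in> Adj x'}))"
  shows "\<exists>m A. valid_assignment Adj m \<and> (\<forall>x\<in>L. card (owned m x) = 2) \<and> A \<subseteq> L \<and>
    (\<forall>x\<in>A. \<forall>y\<in>Adj x \<inter> Y. \<exists>x'\<in>A. m y = Some x') \<and> (\<forall>x\<in>L - A. owned m x \<subseteq> Y)"
proof -
  define H where "H = (\<Union>x\<in>L. Adj x)"
  have finH: "finite H" unfolding H_def using finL adj by blast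
  have adjH: "Adj x \<subseteq> H" for x unfolding H_def using none by (cases "x \<in> L") auto
  define cov where "cov m = {u. m u \<noteq> None}" for m :: "'h \<Rightarrow> 'l option"
  define ok where "ok m \<longleftrightarrow> valid_assignment Adj m \<and> (\<forall>v. card (owned m v) \<le> 2)" for m
  \<comment> \<open>A lexicographic order in one number: the second count never exceeds |H|.\<close>
  define f where "f m = card (cov m) * (card H + 1) + card (cov m \<inter> Y)" for m
  have covH: "cov m \<subseteq> H" if "ok m" for m
    using that adjH unfolding ok_def valid_assignment_def cov_def by (metis (mono_tags, lifting) mem_Collect_eq not_None_eq subsetD subsetI)
  have fown: "finite (owned m v)" if "ok m" for m v
    by (rule finite_subset[OF _ finH]) (use covH[OF that] in \<open>auto simp: cov_def owned_def\<close>)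
  have bound: "f m \<le> card H * (card H + 1) + card H" if "ok m" for m
  proof -
    have "card (cov m) \<le> card H" "card (cov m \<inter> Y) \<le> card H"
      using covH[OF that] finH by (meson card_mono, meson Int_lower1 card_mono subset_trans)
    then show ?thesis unfolding f_def by (meson add_mono mult_le_mono1)
  qed
  have ok0: "ok (\<lambda>_. None)" unfolding ok_def valid_assignment_def owned_def by simp
  have "\<exists>m. ok m \<and> (\<forall>m'. ok m' \<longrightarrow> f m' \<le> f m)"
    using ex_has_greatest_nat[of ok "\<lambda>_. None" f "card H * (card H + 1) + card H + 1"] ok0 bound by fastforce
  then obtain m where m: "ok m" "\<And>m'. ok m' \<Longrightarrow> f m' \<le> f m" by blast
  have val: "valid_assignment Adj m" using m(1) unfolding ok_def by blast
  have fincov: "finite (cov m)" using covH[OF m(1)] finH finite_subset by blast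
  have two: "card (owned m x) = 2" if x: "x \<in> L" for x
  proof (rule ccontr)
    assume "card (owned m x) \<noteq> 2"
    then have lt: "card (owned m x) < 2" using m(1) unfolding ok_def by (metis le_neq_implies_less)
    define R where "R = {(p, q). \<exists>y\<in>Adj p \<inter> UNIV. m y = Some q}"
    define A where "A = {q. (x, q) \<in> R\<^sup>*}"
    have xA: "x \<in> A" unfolding A_def by simp
    have AL: "A \<subseteq> L"
    proof
      fix q assume "q \<in> A"
      then have "(x, q) \<in> R\<^sup>*" unfolding A_def by simp
      then show "q \<in> L"
      proof (induction rule: rtrancl_induct)
        case (step p q)
        then obtain y where "m y = Some q" unfolding R_def by blast
        then have "y \<in> Adj q" using val unfolding valid_assignment_def by blast
        then show ?case using none by blast
      qed (rule x)
    qed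
    have finA: "finite A" using AL finL finite_subset by blast
    have cl: "\<exists>q\<in>A. m y = Some q" if p: "p \<in> A" "y \<in> Adj p" for p y
    proof (cases "m y")
      case None
      have "(x, p) \<in> R\<^sup>*" using p(1) unfolding A_def by simp
      then obtain ys where ys: "augp Adj UNIV m x ys"
        using augp_reach[of x p Adj UNIV m y] p(2) None unfolding R_def by auto
      from augp_distinct[OF ys] obtain zs where zs: "augp Adj UNIV m x zs" "distinct zs" by (elim exE conjE)
      from augment[OF zs val fown[OF m(1)]] obtain m' u where m': "valid_assignment Adj m'" "m u = None"
        "{u. m' u \<noteq> None} = insert u {u. m u \<noteq> None}"
        "\<forall>v. card (owned m' v) = card (owned m v) + (if v = x then 1 else 0)" by blast
      have okm': "ok m'" unfolding ok_def using m'(1,4) lt m(1) unfolding ok_def by auto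
      have "cov m' = insert u (cov m)" "u \<notin> cov m" using m'(2,3) unfolding cov_def by auto
      then have "card (cov m') = card (cov m) + 1" using fincov by simp
      moreover have "card (cov m \<inter> Y) \<le> card H"
        using covH[OF m(1)] finH by (meson Int_lower1 card_mono subset_trans)
      ultimately have "f m < f m'" unfolding f_def by simp
      then show ?thesis using m(2)[OF okm'] by simp
    next
      case (Some q)
      have "(p, q) \<in> R" unfolding R_def using p(2) Some by auto
      then have "q \<in> A" using p(1) unfolding A_def by (auto intro: rtrancl_into_rtrancl)
      then show ?thesis using Some by blast
    qed
    let ?N = "\<Union>q\<in>A. Adj q"
    have finN: "finite ?N" using finA AL adj by blast
    have "?N \<subseteq> (\<Union>q\<in>A. owned m q)" using cl unfolding owned_def by blast
    moreover have "finite (\<Union>q\<in>A. owned m q)" using finA fown[OF m(1)] by blast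
    ultimately have "card ?N \<le> card (\<Union>q\<in>A. owned m q)" by (rule card_mono[rotated])
    also have "\<dots> \<le> (\<Sum>q\<in>A. card (owned m q))" using card_UN_le[OF finA] by blast
    also have "\<dots> < (\<Sum>q\<in>A. 2)"
      by (rule sum_strict_mono_ex1[OF finA]) (use m(1) lt xA in \<open>auto simp: ok_def\<close>)
    finally have less: "card ?N < 2 * card A" by simp
    \<comment> \<open>Each vertex of the neighbourhood of \<open>A\<close> hands out weight at most
      1 to \<open>A\<close>, whereas each vertex of \<open>A\<close> receives at least 2.\<close>
    have "2 * real (card A) = (\<Sum>q\<in>A. 2)" by simp
    also have "\<dots> \<le> (\<Sum>q\<in>A. \<Sum>y\<in>Adj q. 1 / real (card {x'\<in>L. y \<in> Adj x'}))"
      by (rule sum_mono) (use weight AL in blast)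
    also have "\<dots> = (\<Sum>q\<in>A. \<Sum>y | y \<in> ?N \<and> y \<in> Adj q. 1 / real (card {x'\<in>L. y \<in> Adj x'}))"
      by (intro sum.cong refl) auto
    also have "\<dots> = (\<Sum>y\<in>?N. \<Sum>q | q \<in> A \<and> y \<in> Adj q. 1 / real (card {x'\<in>L. y \<in> Adj x'}))"
      by (rule sum.swap_restrict[OF finA finN])
    also have "\<dots> \<le> (\<Sum>y\<in>?N. 1)"
    proof (rule sum_mono)
      fix y assume "y \<in> ?N"
      have "card {q. q \<in> A \<and> y \<in> Adj q} \<le> card {x'\<in>L. y \<in> Adj x'}"
        by (rule card_mono) (use AL finL in auto)
      then have "real (card {q. q \<in> A \<and> y \<in> Adj q}) / real (card {x'\<in>L. y \<in> Adj x'}) \<le> 1"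
        by (rule of_nat_divide_le_1)
      then show "(\<Sum>q | q \<in> A \<and> y \<in> Adj q. 1 / real (card {x'\<in>L. y \<in> Adj x'})) \<le> 1"
        by (simp only: sum_constant times_divide_eq_right mult_1_right)
    qed
    finally show False using less by simp
  qed
  define R where "R = {(p, q). \<exists>y\<in>Adj p \<inter> Y. m y = Some q}"
  define A where "A = {q. \<exists>x\<in>L. \<not> owned m x \<subseteq> Y \<and> (x, q) \<in> R\<^sup>*}"
  have "A \<subseteq> L"
  proof
    fix q assume "q \<in> A"
    then obtain x where x: "x \<in> L" "(x, q) \<in> R\<^sup>*" unfolding A_def by blast
    from x(2) show "q \<in> L"
    proof (induction rule: rtrancl_induct)
      case (step p q)
      then obtain y where "m y = Some q" unfolding R_def by blast
      then have "y \<in> Adj q" using val unfolding valid_assignment_def by blast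
      then show ?case using none by blast
    qed (rule x(1))
  qed
  moreover have "\<exists>q\<in>A. m y = Some q" if p: "p \<in> A" "y \<in> Adj p \<inter> Y" for p y
  proof (cases "m y")
    case None
    obtain x where x: "x \<in> L" "\<not> owned m x \<subseteq> Y" "(x, p) \<in> R\<^sup>*" using p(1) unfolding A_def by blast
    then obtain ys where ys: "augp Adj Y m x ys"
      using augp_reach[of x p Adj Y m y] p(2) None unfolding R_def by auto
    from augp_distinct[OF ys] obtain zs where zs: "augp Adj Y m x zs" "distinct zs" by (elim exE conjE)
    from augment[OF zs val fown[OF m(1)]] obtain m' u where m': "valid_assignment Adj m'" "m u = None" "u \<in> Y"
      "{u. m' u \<noteq> None} = insert u {u. m u \<noteq> None}" "\<forall>u. u \<notin> Y \<longrightarrow> m' u = m u" "\<forall>v. finite (owned m' v)"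
      "\<forall>v. card (owned m' v) = card (owned m v) + (if v = x then 1 else 0)" by blast
    obtain t where t: "m t = Some x" "t \<notin> Y" using x(2) unfolding owned_def by blast
    then have t': "m' t = Some x" using m'(5) by simp
    \<comment> \<open>Release the vertex outside \<open>Y\<close>: \<open>x\<close> still owns two,
      the total coverage is unchanged, and the coverage of \<open>Y\<close> has grown.\<close>
    define m2 where "m2 = m'(t := None)"
    have o2: "owned m2 v = owned m' v - {t}" for v unfolding owned_def m2_def by auto
    have "card (owned m2 v) \<le> 2" for v
    proof (cases "v = x")
      case True
      have "t \<in> owned m' x" unfolding owned_def using t' by simp
      then have "card (owned m' x - {t}) + 1 = card (owned m' x)" using m'(6) by (metis Suc_eq_plus1 card_Suc_Diff1)
      then show ?thesis using m'(7) two[OF x(1)] True unfolding o2 by simp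
    next
      case False
      have "card (owned m2 v) \<le> card (owned m' v)" unfolding o2 by (rule card_mono) (use m'(6) in auto)
      also have "\<dots> \<le> 2" using m'(7) m(1) False unfolding ok_def by simp
      finally show ?thesis .
    qed
    moreover have "valid_assignment Adj m2" using m'(1) unfolding valid_assignment_def m2_def by auto
    ultimately have ok2: "ok m2" unfolding ok_def by blast
    have tc: "t \<in> cov m" "u \<notin> cov m" "t \<noteq> u" unfolding cov_def using t m'(2) by auto
    have c2: "cov m2 = insert u (cov m) - {t}" unfolding cov_def m2_def using m'(4) by auto
    have "card (cov m2) = card (cov m)" unfolding c2 using tc fincov by simp
    moreover have "cov m2 \<inter> Y = insert u (cov m \<inter> Y)" unfolding c2 using t(2) m'(3) by auto
    then have "card (cov m2 \<inter> Y) = card (cov m \<inter> Y) + 1" using tc fincov by simp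
    ultimately have "f m < f m2" unfolding f_def by simp
    then show ?thesis using m(2)[OF ok2] by simp
  next
    case (Some q)
    have "(p, q) \<in> R" unfolding R_def using p(2) Some by auto
    then have "q \<in> A" using p(1) unfolding A_def by (auto intro: rtrancl_into_rtrancl)
    then show ?thesis using Some by blast
  qed
  moreover have "owned m x \<subseteq> Y" if "x \<in> L - A" for x
    using that unfolding A_def by blast
  ultimately show ?thesis using val two by blast
qed

section \<open>Closing Hamilton paths and adding edges under the degree sum condition\<close>

section \<open>The Bondy--Chvatal closure\<close>

abbreviation adj :: "'a set set \<Rightarrow> 'a \<Rightarrow> 'a \<Rightarrow> bool" where
  "adj E a b \<equiv> {a, b} \<in> E"

lemma successively_adj_rev: "successively (adj E) (rev p) \<longleftrightarrow> successively (adj E) p"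
  by (simp add: successively_rev insert_commute)

lemma hamiltonian_iff:
  "hamiltonian V E \<longleftrightarrow> (\<exists>p. distinct p \<and> set p = V \<and> length p \<ge> 3 \<and> successively (adj E) p \<and> adj E (last p) (hd p))"
proof -
  have "(\<forall>i < length p. {p ! i, p ! ((i + 1) mod length p)} \<in> E) \<longleftrightarrow> successively (adj E) p \<and> adj E (last p) (hd p)"
    if len: "length p \<ge> 3" for p :: "'a list"
  proof -
    obtain n where n: "length p = Suc n" using len by (cases p) auto
    have ne: "p \<noteq> []" using len by auto
    have lh: "last p = p ! n" "hd p = p ! 0" using n ne by (simp_all add: last_conv_nth hd_conv_nth)
    have m: "(i + 1) mod length p = i + 1" if "i < n" for i using that n by simp
    have mn: "(n + 1) mod length p = 0" using n by simp
    show ?thesis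
    proof
      assume a: "\<forall>i < length p. {p ! i, p ! ((i + 1) mod length p)} \<in> E"
      have "adj E (p ! i) (p ! Suc i)" if "Suc i < length p" for i
        using a[rule_format, of i] m[of i] that n by simp
      moreover have "adj E (last p) (hd p)" using a[rule_format, of n] mn n lh by simp
      ultimately show "successively (adj E) p \<and> adj E (last p) (hd p)" by (simp add: successively_conv_nth)
    next
      assume a: "successively (adj E) p \<and> adj E (last p) (hd p)"
      show "\<forall>i < length p. {p ! i, p ! ((i + 1) mod length p)} \<in> E"
      proof (intro allI impI)
        fix i assume i: "i < length p"
        show "{p ! i, p ! ((i + 1) mod length p)} \<in> E"
        proof (cases "i < n")
          case True
          then show ?thesis using a m[OF True] n by (simp add: successively_conv_nth)
        next
          case False
          then have "i = n" using i n by simp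
          then show ?thesis using a mn lh by simp
        qed
      qed
    qed
  qed
  then show ?thesis unfolding hamiltonian_def by blast
qed

lemma simple_graph_fin_graph: "simple_graph V E \<Longrightarrow> fin_graph E"
  unfolding simple_graph_def fin_graph_def by (meson PowI finite_Pow_iff finite_subset subsetI)

text \<open>The path has n - 1 edges. Those whose later vertex is adjacent to \<open>hd p\<close>
  and those whose earlier vertex is adjacent to \<open>last p\<close> number at least n together, so
  one edge is of both kinds and can be replaced by the two chords.\<close>

lemma hamiltonian_path_closes:
  assumes g: "simple_graph V E" and p: "distinct p" "set p = V" "length p \<ge> 3" "successively (adj E) p"
    and d: "card V \<le> degree E (hd p) + degree E (last p)"
  shows "hamiltonian V E"
proof -
  define n where "n = length p"
  have gE: "fin_graph E" using simple_graph_fin_graph[OF g] .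
  have n: "n \<ge> 3" "card V = n" using p unfolding n_def by (auto simp: distinct_card)
  have ne: "p \<noteq> []" using p(3) by auto
  define a where "a = hd p"
  define b where "b = last p"
  have ab: "a = p ! 0" "b = p ! (n - 1)" unfolding a_def b_def n_def using ne by (simp_all add: last_conv_nth hd_conv_nth)
  have nV: "nbrs E v \<subseteq> V" for v using g unfolding simple_graph_def nbrs_def by auto
  define S where "S = {i. i < n - 1 \<and> adj E a (p ! Suc i)}"
  define T where "T = {i. i < n - 1 \<and> adj E (p ! i) b}"
  have idx: "\<exists>i<n. p ! i = v" if "v \<in> V" for v using that p(2) unfolding n_def by (metis in_set_conv_nth)
  have "nbrs E a \<subseteq> (\<lambda>i. p ! Suc i) ` S"
  proof
    fix v assume v: "v \<in> nbrs E a"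
    then obtain i where i: "i < n" "p ! i = v" using idx nV by blast
    have "v \<noteq> a" using v nbrs_irrefl[OF gE] by blast
    then have "i \<noteq> 0" using i(2) ab(1) by metis
    then obtain j where "i = Suc j" by (cases i) auto
    then have "j \<in> S" "v = p ! Suc j" using i v unfolding S_def nbrs_def by simp_all
    then show "v \<in> (\<lambda>i. p ! Suc i) ` S" by blast
  qed
  then have "card (nbrs E a) \<le> card S"
    by (rule surj_card_le[rotated]) (simp add: S_def)
  then have dS: "degree E a \<le> card S" using degree_nbrs[OF gE] by simp
  have "nbrs E b \<subseteq> (\<lambda>i. p ! i) ` T"
  proof
    fix v assume v: "v \<in> nbrs E b"
    then obtain i where i: "i < n" "p ! i = v" using idx nV by blast
    have "v \<noteq> b" using v nbrs_irrefl[OF gE] by blast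
    then have "i \<noteq> n - 1" using i(2) ab(2) by metis
    moreover have "adj E v b" using v unfolding nbrs_def by (simp add: insert_commute)
    ultimately have "i \<in> T" using i unfolding T_def by simp
    then show "v \<in> (\<lambda>i. p ! i) ` T" using i(2) by blast
  qed
  then have "card (nbrs E b) \<le> card T"
    by (rule surj_card_le[rotated]) (simp add: T_def)
  then have dT: "degree E b \<le> card T" using degree_nbrs[OF gE] by simp
  have "S \<inter> T \<noteq> {}"
  proof
    assume "S \<inter> T = {}"
    then have "card S + card T = card (S \<union> T)" by (subst card_Un_disjoint) (auto simp: S_def T_def)
    also have "\<dots> \<le> card {..<n - 1}" by (rule card_mono) (auto simp: S_def T_def)
    finally show False using d dS dT n unfolding a_def b_def by simp
  qed
  then obtain i where i: "i < n - 1" "adj E a (p ! Suc i)" "adj E (p ! i) b" unfolding S_def T_def by blast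
  define r where "r = take (Suc i) p" define s where "s = drop (Suc i) p"
  have rs: "p = r @ s" "r \<noteq> []" "s \<noteq> []" using i ne unfolding r_def s_def n_def by auto
  have lr: "last r = p ! i" "hd r = a" unfolding r_def a_def using i n ne
    by (simp_all add: last_conv_nth n_def hd_take)
  have ls: "hd s = p ! Suc i" "last s = b" unfolding s_def b_def using i n
    by (simp_all add: hd_drop_conv_nth n_def)
  let ?q = "r @ rev s"
  have "successively (adj E) r" "successively (adj E) s"
    using p(4) rs by (simp_all add: successively_append_iff)
  then have "successively (adj E) ?q"
    using i(3) lr ls rs successively_adj_rev[of E s] by (simp add: successively_append_iff hd_rev)
  moreover have "adj E (last ?q) (hd ?q)"
    using i(2) lr ls rs by (simp add: last_rev insert_commute)
  moreover have "distinct ?q" "set ?q = V" "length ?q \<ge> 3" using p(1-3) rs by auto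
  ultimately show ?thesis unfolding hamiltonian_iff by blast
qed

text \<open>Rotated so that the new edge closes it, a Hamilton cycle becomes a Hamilton path of the
  old graph between \<open>u\<close> and \<open>v\<close>.\<close>

lemma closure_step:
  assumes g: "simple_graph V E" and uv: "u \<in> V" "v \<in> V" "u \<noteq> v"
    and d: "card V \<le> degree E u + degree E v"
    and h: "hamiltonian V (insert {u, v} E)"
  shows "hamiltonian V E"
proof -
  let ?E = "insert {u, v} E"
  obtain p where p: "distinct p" "set p = V" "length p \<ge> 3" "successively (adj ?E) p" "adj ?E (last p) (hd p)"
    using h unfolding hamiltonian_iff by blast
  have close: ?thesis
    if q: "distinct q" "set q = V" "length q \<ge> 3" "successively (adj ?E) q" "adj ?E (last q) (hd q)" "\<not> adj E (last q) (hd q)" for q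
  proof -
    have e: "{last q, hd q} = {u, v}" using q(5,6) by blast
    have qne: "q \<noteq> []" using q(3) by auto
    have "adj E (q ! i) (q ! Suc i)" if i: "Suc i < length q" for i
    proof -
      have "adj ?E (q ! i) (q ! Suc i)" using q(4) i by (simp add: successively_conv_nth)
      moreover have "{q ! i, q ! Suc i} \<noteq> {last q, hd q}"
      proof
        assume "{q ! i, q ! Suc i} = {last q, hd q}"
        then have "(q ! i = last q \<and> q ! Suc i = hd q) \<or> (q ! i = hd q \<and> q ! Suc i = last q)"
          by (metis doubleton_eq_iff)
        then have "i = length q - 1 \<and> Suc i = 0 \<or> i = 0 \<and> Suc i = length q - 1"
          using q(1) i qne by (auto simp: last_conv_nth hd_conv_nth nth_eq_iff_index_eq)
        then show False using i q(3) by auto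
      qed
      ultimately show ?thesis using e by blast
    qed
    then have "successively (adj E) q" by (simp add: successively_conv_nth)
    moreover have "card V \<le> degree E (hd q) + degree E (last q)"
      using d e by (metis add.commute doubleton_eq_iff)
    ultimately show ?thesis using hamiltonian_path_closes[OF g q(1-3)] by blast
  qed
  show ?thesis
  proof (cases "adj E (last p) (hd p)")
    case False
    then show ?thesis using close[OF p] by blast
  next
    case True
    show ?thesis
    proof (cases "successively (adj E) p")
      case True
      then show ?thesis using p \<open>adj E (last p) (hd p)\<close> unfolding hamiltonian_iff by blast
    next
      case False
      then obtain i where i: "Suc i < length p" "\<not> adj E (p ! i) (p ! Suc i)" by (auto simp: successively_conv_nth)
      define r where "r = take (Suc i) p" define s where "s = drop (Suc i) p"
      have rs: "p = r @ s" "r \<noteq> []" "s \<noteq> []" using i(1) p(3) unfolding r_def s_def by auto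
      have lr: "last r = p ! i" unfolding r_def using take_Suc_conv_app_nth[of i p] i(1) by simp
      have ls: "hd s = p ! Suc i" unfolding s_def using i(1) by (simp add: hd_drop_conv_nth)
      have "successively (adj ?E) r" "successively (adj ?E) s" "adj ?E (last r) (hd s)"
        using p(4) rs by (simp_all add: successively_append_iff)
      moreover have "last s = last p" "hd r = hd p" using rs by simp_all
      ultimately have "successively (adj ?E) (s @ r)" "adj ?E (last (s @ r)) (hd (s @ r))" "\<not> adj E (last (s @ r)) (hd (s @ r))"
        using p(5) rs i(2) lr ls by (simp_all add: successively_append_iff)
      moreover have "distinct (s @ r)" "set (s @ r) = V" "length (s @ r) \<ge> 3" using p(1-3) rs by auto
      ultimately show ?thesis using close by blast
    qed
  qed
qed

text \<open>Take a graph with the most edges among those extending \<open>E\<close> whose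
  hamiltonicity implies that of \<open>E\<close>; by \<open>closure_step\<close> no qualifying pair
  is left to add.\<close>

lemma closure_exists:
  assumes g: "simple_graph V E"
  obtains E' where "E \<subseteq> E'" "simple_graph V E'" "hamiltonian V E' \<Longrightarrow> hamiltonian V E"
    "\<And>u v. u \<in> V \<Longrightarrow> v \<in> V \<Longrightarrow> u \<noteq> v \<Longrightarrow> card V \<le> degree E' u + degree E' v \<Longrightarrow> {u, v} \<in> E'"
proof -
  define P where "P F \<longleftrightarrow> E \<subseteq> F \<and> simple_graph V F \<and> (hamiltonian V F \<longrightarrow> hamiltonian V E)" for F
  have finV: "finite V" using g unfolding simple_graph_def by blast
  have sub: "F \<subseteq> Pow V" if "P F" for F using that unfolding P_def simple_graph_def by blast
  have "P E" using g unfolding P_def by blast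
  have "card F \<le> card (Pow V)" if "P F" for F using sub[OF that] finV by (simp add: card_mono)
  then have "\<exists>F. P F \<and> (\<forall>F'. P F' \<longrightarrow> card F' \<le> card F)"
    using ex_has_greatest_nat[of P E card "card (Pow V) + 1"] \<open>P E\<close> by fastforce
  then obtain F where F: "P F" "\<And>F'. P F' \<Longrightarrow> card F' \<le> card F" by blast
  have "{u, v} \<in> F" if uv: "u \<in> V" "v \<in> V" "u \<noteq> v" "card V \<le> degree F u + degree F v" for u v
  proof (rule ccontr)
    assume n: "{u, v} \<notin> F"
    have gF: "simple_graph V F" using F(1) unfolding P_def by blast
    have "simple_graph V (insert {u, v} F)" using gF uv unfolding simple_graph_def by auto
    moreover have "hamiltonian V (insert {u, v} F) \<longrightarrow> hamiltonian V E"
      using closure_step[OF gF uv] F(1) unfolding P_def by blast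
    ultimately have "P (insert {u, v} F)" using F(1) unfolding P_def by blast
    moreover have "finite F" using sub[OF F(1)] finV finite_subset by blast
    ultimately show False using F(2)[of "insert {u, v} F"] n by simp
  qed
  then show ?thesis using that[of F] F(1) unfolding P_def by blast
qed

section \<open>Spanning linear forests as sets of disjoint paths, measured by their ends\<close>

section \<open>Path systems\<close>

definition path_system :: "'a set set \<Rightarrow> 'a set \<Rightarrow> 'a list set \<Rightarrow> bool" where
  "path_system E V P \<longleftrightarrow> finite P \<and> (\<forall>p\<in>P. p \<noteq> [] \<and> distinct p \<and> successively (adj E) p) \<and>
     (\<forall>p\<in>P. \<forall>q\<in>P. p \<noteq> q \<longrightarrow> set p \<inter> set q = {}) \<and> (\<Union>p\<in>P. set p) = V"

text \<open>A one-vertex path counts twice, so that for every vertex its number of ends plus its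
  degree in the forest is 2.\<close>

definition path_ends :: "'a set \<Rightarrow> 'a list \<Rightarrow> nat" where
  "path_ends X p = of_bool (hd p \<in> X) + of_bool (last p \<in> X)"

definition ends :: "'a set \<Rightarrow> 'a list set \<Rightarrow> nat" where
  "ends X P = (\<Sum>p\<in>P. path_ends X p)"

lemma path_ends_rev: "p \<noteq> [] \<Longrightarrow> path_ends X (rev p) = path_ends X p"
  unfolding path_ends_def by (simp add: hd_rev last_rev)

lemma orient_last:
  assumes "p \<noteq> []" "a = hd p \<or> a = last p"
  obtains p' where "p' = p \<or> p' = rev p" "last p' = a"
  using assms by (metis last_rev)

lemma orient_hd:
  assumes "p \<noteq> []" "a = hd p \<or> a = last p"
  obtains p' where "p' = p \<or> p' = rev p" "hd p' = a"
  using assms by (metis hd_rev)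

lemma merge_paths:
  assumes ps: "path_system E V P" and p: "p \<in> P" "a = hd p \<or> a = last p"
    and q: "q \<in> P" "b = hd q \<or> b = last q" and pq: "p \<noteq> q" and ab: "adj E a b"
  obtains P' r where "path_system E V P'" "card P = Suc (card P')"
    "\<And>X. ends X P' + of_bool (a \<in> X) + of_bool (b \<in> X) = ends X P"
    "P' = insert r (P - {p, q})" "set r = set p \<union> set q"
proof -
  have fin: "finite P" and pne: "p \<noteq> []" "q \<noteq> []"
    and dj: "\<And>s t. s \<in> P \<Longrightarrow> t \<in> P \<Longrightarrow> s \<noteq> t \<Longrightarrow> set s \<inter> set t = {}"
    using ps p(1) q(1) unfolding path_system_def by blast+
  obtain p' where p': "p' = p \<or> p' = rev p" "last p' = a" using orient_last[OF pne(1) p(2)] .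
  obtain q' where q': "q' = q \<or> q' = rev q" "hd q' = b" using orient_hd[OF pne(2) q(2)] .
  have ne': "p' \<noteq> []" "q' \<noteq> []" using p'(1) q'(1) pne by auto
  have set': "set p' = set p" "set q' = set q" using p'(1) q'(1) by auto
  have e': "path_ends X p' = path_ends X p" "path_ends X q' = path_ends X q" for X
    using p'(1) q'(1) path_ends_rev pne by metis+
  have good: "distinct p \<and> successively (adj E) p" "distinct q \<and> successively (adj E) q"
    using ps p(1) q(1) unfolding path_system_def by blast+
  then have good': "distinct p' \<and> successively (adj E) p'" "distinct q' \<and> successively (adj E) q'"
    using p'(1) q'(1) successively_adj_rev distinct_rev by metis+
  define r where "r = p' @ q'"
  have setr: "set r = set p \<union> set q" unfolding r_def using set' by simp
  have rP: "r \<notin> P - {p, q}"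
  proof
    assume r: "r \<in> P - {p, q}"
    then have "set r \<inter> set p = {}" using dj[of r p] p(1) by blast
    then show False using setr pne by auto
  qed
  define P' where "P' = insert r (P - {p, q})"
  have "path_system E V P'"
    unfolding path_system_def
  proof (intro conjI)
    show "finite P'" unfolding P'_def using fin by simp
    have "distinct r" unfolding r_def using good' set' dj[OF p(1) q(1) pq] by simp
    moreover have "successively (adj E) r" unfolding r_def using good' ne' p'(2) q'(2) ab
      by (simp add: successively_append_iff)
    moreover have "r \<noteq> []" unfolding r_def using ne' by simp
    ultimately show "\<forall>p\<in>P'. p \<noteq> [] \<and> distinct p \<and> successively (adj E) p"
      unfolding P'_def using ps unfolding path_system_def by blast
    have rd: "set r \<inter> set s = {}" if "s \<in> P - {p, q}" for s
      using that dj[of s p] dj[of s q] p(1) q(1) setr by blast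
    show "\<forall>s\<in>P'. \<forall>t\<in>P'. s \<noteq> t \<longrightarrow> set s \<inter> set t = {}"
    proof (intro ballI impI)
      fix s t assume st: "s \<in> P'" "t \<in> P'" "s \<noteq> t"
      show "set s \<inter> set t = {}"
      proof (cases "s = r")
        case True
        then show ?thesis using rd[of t] st unfolding P'_def by blast
      next
        case False
        then have s: "s \<in> P - {p, q}" using st unfolding P'_def by blast
        show ?thesis
        proof (cases "t = r")
          case True
          then show ?thesis using rd[OF s] by blast
        next
          case False
          then show ?thesis using s st dj[of s t] unfolding P'_def by blast
        qed
      qed
    qed
    have "(\<Union>p\<in>P. set p) = V" using ps unfolding path_system_def by blast
    moreover have "(\<Union>p\<in>P'. set p) = set p \<union> set q \<union> (\<Union>p\<in>P - {p, q}. set p)" unfolding P'_def using setr by simp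
    ultimately show "(\<Union>p\<in>P'. set p) = V" using p(1) q(1) by blast
  qed
  moreover have Peq: "P = insert p (insert q (P - {p, q}))" using p(1) q(1) by blast
  have fin2: "finite (P - {p, q})" using fin by simp
  have "card P = Suc (Suc (card (P - {p, q})))"
    by (subst Peq) (use fin2 pq in \<open>simp add: card_insert_disjoint\<close>)
  then have "card P = Suc (card P')" unfolding P'_def using rP fin2 by simp
  moreover have "ends X P' + of_bool (a \<in> X) + of_bool (b \<in> X) = ends X P" for X
  proof -
    have "ends X P = path_ends X p + (path_ends X q + ends X (P - {p, q}))"
      unfolding ends_def by (subst Peq) (use fin2 pq in simp)
    moreover have "ends X P' = path_ends X r + ends X (P - {p, q})"
      unfolding ends_def P'_def using rP fin2 by simp
    moreover have "path_ends X r + of_bool (a \<in> X) + of_bool (b \<in> X) = path_ends X p' + path_ends X q'"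
      unfolding path_ends_def r_def using p'(2) q'(2) ne' by simp
    ultimately show ?thesis using e' by simp
  qed
  ultimately show ?thesis using that[of P' r] setr P'_def by blast
qed

lemma singleton_path_system:
  assumes "finite V"
  shows "path_system E V ((\<lambda>v. [v]) ` V)" "v \<in> V \<Longrightarrow> ends {v} ((\<lambda>v. [v]) ` V) = 2"
proof -
  show "path_system E V ((\<lambda>v. [v]) ` V)" unfolding path_system_def using assms by auto
  assume v: "v \<in> V"
  have "ends {v} ((\<lambda>v. [v]) ` V) = (\<Sum>w\<in>V. path_ends {v} [w])"
    unfolding ends_def by (subst sum.reindex) (auto simp: inj_on_def)
  also have "\<dots> = (\<Sum>w\<in>V. if w = v then 2 else 0)"
    by (rule sum.cong) (auto simp: path_ends_def)
  also have "\<dots> = 2" using assms v by simp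
  finally show "ends {v} ((\<lambda>v. [v]) ` V) = 2" .
qed

lemma ends_sum:
  assumes "finite X"
  shows "ends X P = (\<Sum>v\<in>X. ends {v} P)"
proof -
  have "path_ends X p = (\<Sum>v\<in>X. path_ends {v} p)" for p
  proof -
    have "(\<Sum>v\<in>X. of_bool (w \<in> {v})) = (of_bool (w \<in> X) :: nat)" for w
      using assms by (simp add: of_bool_def)
    then show ?thesis unfolding path_ends_def by (simp add: sum.distrib)
  qed
  then show ?thesis unfolding ends_def using sum.swap[of "\<lambda>p v. path_ends {v} p" X P] by simp
qed

lemma ends_pos:
  assumes "finite P" "ends X P > 0"
  obtains p a where "p \<in> P" "a = hd p \<or> a = last p" "a \<in> X"
proof -
  have "\<exists>p\<in>P. path_ends X p \<noteq> 0"
  proof (rule ccontr)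
    assume "\<not> ?thesis"
    then have "ends X P = 0" unfolding ends_def by simp
    then show False using assms(2) by simp
  qed
  then obtain p where p: "p \<in> P" "path_ends X p \<noteq> 0" by blast
  then have "hd p \<in> X \<or> last p \<in> X" unfolding path_ends_def by auto
  then show ?thesis using that p(1) by blast
qed

text \<open>For a finite graph these are the disjoint unions of cycles; stating this through degrees
  avoids representing cycles as sequences.\<close>

definition two_regular :: "'a set set \<Rightarrow> bool" where
  "two_regular C \<longleftrightarrow> C \<noteq> {} \<and> (\<forall>v. degree C v = 0 \<or> degree C v = 2)"

definition acyclic_edges :: "'a set set \<Rightarrow> bool" where
  "acyclic_edges F \<longleftrightarrow> \<not> (\<exists>C\<subseteq>F. two_regular C)"

lemma degree_insert_edge:
  assumes "finite F" "e \<notin> F"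
  shows "degree (insert e F) v = degree F v + of_bool (v \<in> e)"
proof -
  have "{f \<in> insert e F. v \<in> f} = (if v \<in> e then insert e {f\<in>F. v \<in> f} else {f\<in>F. v \<in> f})" by auto
  then show ?thesis unfolding degree_def using assms by simp
qed

lemma acyclic_subset: "acyclic_edges F \<Longrightarrow> G \<subseteq> F \<Longrightarrow> acyclic_edges G"
  unfolding acyclic_edges_def by blast

text \<open>Each new edge merges two paths at their ends. If both its vertices were ends of one
  path, the edges inside that path and the new one would be two-regular; the clause placing every
  edge inside a path serves to see this.\<close>

theorem linear_forest_path_system:
  assumes "finite F" "finite V" "F \<subseteq> E" "\<And>e. e \<in> F \<Longrightarrow> card e = 2 \<and> e \<subseteq> V"
    and "acyclic_edges F" "\<And>v. degree F v \<le> 2"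
  shows "\<exists>P. path_system E V P \<and> (\<forall>v\<in>V. ends {v} P + degree F v = 2) \<and> (\<forall>e\<in>F. \<exists>p\<in>P. e \<subseteq> set p)"
  using assms
proof (induction F rule: finite_induct)
  case empty
  have "degree {} v = 0" for v :: 'a unfolding degree_def by simp
  then have "\<forall>v\<in>V. ends {v} ((\<lambda>v. [v]) ` V) + degree {} v = 2"
    using singleton_path_system(2)[OF empty.prems(1)] by (metis add.right_neutral)
  then show ?case using singleton_path_system(1)[OF empty.prems(1), of E] by blast
next
  case (insert e F)
  have degi: "degree (insert e F) v = degree F v + of_bool (v \<in> e)" for v
    using degree_insert_edge[OF insert.hyps] .
  have dle: "degree F v \<le> 2" for v using insert.prems(5)[of v] degi[of v] by simp
  obtain P where P: "path_system E V P" "\<And>v. v \<in> V \<Longrightarrow> ends {v} P + degree F v = 2" "\<And>f. f \<in> F \<Longrightarrow> \<exists>p\<in>P. f \<subseteq> set p"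
  proof -
    have "\<exists>P. path_system E V P \<and> (\<forall>v\<in>V. ends {v} P + degree F v = 2) \<and> (\<forall>e\<in>F. \<exists>p\<in>P. e \<subseteq> set p)"
    proof (rule insert.IH)
      show "finite V" "F \<subseteq> E" using insert.prems(1,2) by blast+
      show "card f = 2 \<and> f \<subseteq> V" if "f \<in> F" for f using insert.prems(3) that by blast
      show "acyclic_edges F" using acyclic_subset[OF insert.prems(4)] by blast
      show "degree F v \<le> 2" for v by (rule dle)
    qed
    then show ?thesis using that by blast
  qed
  have finP: "finite P" using P(1) unfolding path_system_def by blast
  obtain a b where e: "e = {a, b}" "a \<noteq> b" using insert.prems(3)[of e] by (metis card_2_iff insertI1)
  have abV: "a \<in> V" "b \<in> V" "adj E a b" using insert.prems(2,3) e(1) by blast+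
  have "degree F a \<le> 1" "degree F b \<le> 1" using insert.prems(5)[of a] insert.prems(5)[of b] degi[of a] degi[of b] e(1) by auto
  then have "ends {a} P > 0" "ends {b} P > 0" using P(2)[OF abV(1)] P(2)[OF abV(2)] by linarith+
  then obtain p q where p: "p \<in> P" "a = hd p \<or> a = last p" and q: "q \<in> P" "b = hd q \<or> b = last q"
    using ends_pos[OF finP, of "{a}"] ends_pos[OF finP, of "{b}"] by (metis singletonD)
  have "p \<noteq> q"
  proof
    assume pq: "p = q"
    have pe: "hd p = a \<and> last p = b \<or> hd p = b \<and> last p = a" using p(2) q(2) pq e(2) by metis
    have pne: "p \<noteq> []" using P(1) p(1) unfolding path_system_def by blast
    have dj: "\<And>s t. s \<in> P \<Longrightarrow> t \<in> P \<Longrightarrow> s \<noteq> t \<Longrightarrow> set s \<inter> set t = {}" using P(1) unfolding path_system_def by blast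
    have abp: "a \<in> set p" "b \<in> set p" using pe pne hd_in_set[of p] last_in_set[of p] by auto
    have pV: "set p \<subseteq> V" using P(1) p(1) unfolding path_system_def by blast
    have endv: "ends {v} P = of_bool (v = a) + of_bool (v = b)" if v: "v \<in> set p" for v
    proof -
      have "path_ends {v} s = 0" if "s \<in> P - {p}" for s
      proof -
        have "s \<noteq> []" using P(1) that unfolding path_system_def by blast
        then have "hd s \<in> set s" "last s \<in> set s" by simp_all
        moreover have "v \<notin> set s" using dj[of s p] p(1) that v by blast
        ultimately show ?thesis unfolding path_ends_def by (metis add_0 of_bool_eq(1) singletonD)
      qed
      then have "ends {v} P = path_ends {v} p" unfolding ends_def using sum.remove[OF finP p(1), of "path_ends {v}"] by simp
      also have "\<dots> = of_bool (v = a) + of_bool (v = b)" unfolding path_ends_def using pe e(2) by auto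
      finally show ?thesis .
    qed
    define C where "C = {f\<in>F. f \<subseteq> set p}"
    have finC: "finite C" unfolding C_def using insert.hyps(1) by simp
    have eC: "e \<notin> C" unfolding C_def using insert.hyps(2) by simp
    have in_p: "{f\<in>C. v \<in> f} = {f\<in>F. v \<in> f}" if "v \<in> set p" for v
    proof -
      have "f \<subseteq> set p" if "f \<in> F" "v \<in> f" for f
      proof -
        from P(3)[OF that(1)] obtain s where s: "s \<in> P" "f \<subseteq> set s" by blast
        then have "v \<in> set s" using that(2) by blast
        then have "s = p" using dj[OF s(1) p(1)] \<open>v \<in> set p\<close> by blast
        then show ?thesis using s(2) by simp
      qed
      then show ?thesis unfolding C_def by blast
    qed
    have "two_regular (insert e C)"
      unfolding two_regular_def
    proof (intro conjI allI)
      fix v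
      have d: "degree (insert e C) v = degree C v + of_bool (v \<in> e)" using degree_insert_edge[OF finC eC] .
      show "degree (insert e C) v = 0 \<or> degree (insert e C) v = 2"
      proof (cases "v \<in> set p")
        case True
        then have "degree C v = degree F v" unfolding degree_def using in_p by simp
        moreover have "of_bool (v \<in> e) = (of_bool (v = a) + of_bool (v = b) :: nat)" using e by auto
        moreover have "ends {v} P + degree F v = 2" using P(2) True pV by blast
        ultimately show ?thesis using d endv[OF True] by simp
      next
        case False
        then have "{f\<in>C. v \<in> f} = {}" unfolding C_def by blast
        then have "degree C v = 0" unfolding degree_def by (metis card.empty)
        moreover have "v \<notin> e" using False abp e(1) by blast
        ultimately show ?thesis using d by simp
      qed
    qed simp
    moreover have "insert e C \<subseteq> insert e F" unfolding C_def by blast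
    ultimately show False using insert.prems(4) unfolding acyclic_edges_def by blast
  qed
  obtain P' r where P': "path_system E V P'"
    "\<And>X. ends X P' + of_bool (a \<in> X) + of_bool (b \<in> X) = ends X P"
    "P' = insert r (P - {p, q})" "set r = set p \<union> set q"
    using merge_paths[OF P(1) p q \<open>p \<noteq> q\<close> abV(3)] by metis
  have "ends {v} P' + degree (insert e F) v = 2" if "v \<in> V" for v
  proof -
    have "of_bool (v \<in> e) = (of_bool (a \<in> {v}) + of_bool (b \<in> {v}) :: nat)" using e by auto
    then show ?thesis using P'(2)[of "{v}"] P(2)[OF that] degi[of v] by linarith
  qed
  moreover have "\<exists>s\<in>P'. f \<subseteq> set s" if f: "f \<in> insert e F" for f
  proof (cases "f = e")
    case True
    have "p \<noteq> []" "q \<noteq> []" using P(1) p(1) q(1) unfolding path_system_def by blast+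
    then have "a \<in> set p" "b \<in> set q" using p(2) q(2) hd_in_set last_in_set by metis+
    then show ?thesis using True e(1) P'(3,4) by blast
  next
    case False
    then obtain s where s: "s \<in> P" "f \<subseteq> set s" using P(3) f by blast
    show ?thesis
    proof (cases "s = p \<or> s = q")
      case True
      then have "f \<subseteq> set r" using s(2) P'(4) by blast
      then show ?thesis using P'(3) by blast
    next
      case False
      then show ?thesis using s P'(3) by blast
    qed
  qed
  ultimately show ?case using P'(1) by blast
qed

text \<open>While there are ends in \<open>Q\<close>, join one to an end in \<open>U\<close>, which
  preserves the surplus. A path with an end in \<open>Q\<close> has at most one end in
  \<open>U\<close>, so the surplus provides a partner on another path. Afterwards all ends lie in
  the clique \<open>K\<close>.\<close>

theorem hamiltonian_from_path_system:
  assumes "path_system E V P" "finite V" "card V \<ge> 3" "simple_graph V E"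
    and clique: "\<And>u v. u \<in> K \<Longrightarrow> v \<in> K \<Longrightarrow> u \<noteq> v \<Longrightarrow> adj E u v"
    and UQ: "\<And>u v. u \<in> U \<Longrightarrow> v \<in> Q \<Longrightarrow> adj E u v"
    and UK: "U \<subseteq> K" and QK: "Q \<inter> K = {}"
    and other: "ends (- (Q \<union> K)) P = 0"
    and few: "ends Q P = 0 \<or> ends Q P < ends U P"
  shows "hamiltonian V E"
  using assms(1) other few
proof (induction "card P" arbitrary: P rule: less_induct)
  case less
  have finP: "finite P" and Pne: "\<And>p. p \<in> P \<Longrightarrow> p \<noteq> []" and VP: "(\<Union>p\<in>P. set p) = V"
    and dj: "\<And>s t. s \<in> P \<Longrightarrow> t \<in> P \<Longrightarrow> s \<noteq> t \<Longrightarrow> set s \<inter> set t = {}"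
    using less.prems(1) unfolding path_system_def by blast+
  have QU: "path_ends Q p + path_ends U p \<le> 2" for p
    unfolding path_ends_def using UK QK by (auto simp: of_bool_def)
  have inQK: "hd p \<in> Q \<union> K" "last p \<in> Q \<union> K" if "p \<in> P" for p
  proof -
    have "path_ends (- (Q \<union> K)) p = 0" using less.prems(2) finP that unfolding ends_def by simp
    then show "hd p \<in> Q \<union> K" "last p \<in> Q \<union> K" unfolding path_ends_def by (simp_all split: if_splits)
  qed
  have Pn: "P \<noteq> {}" using VP assms(3) by auto
  show ?case
  proof (cases "\<exists>p. P = {p}")
    case True
    then obtain p where p: "P = {p}" by blast
    have "ends Q P = path_ends Q p" "ends U P = path_ends U p" unfolding ends_def p by simp_all
    then have "path_ends Q p = 0" using less.prems(3) QU[of p] by linarith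
    then have hl: "hd p \<in> K" "last p \<in> K" using inQK[of p] p unfolding path_ends_def by (auto split: if_splits)
    have pp: "distinct p" "successively (adj E) p" using less.prems(1) p unfolding path_system_def by blast+
    have setp: "set p = V" using VP p by simp
    have len: "length p \<ge> 3" using distinct_card[OF pp(1)] setp assms(3) by simp
    have "hd p \<noteq> last p"
    proof
      assume "hd p = last p"
      then have "p ! 0 = p ! (length p - 1)" using len by (metis Pne p hd_conv_nth last_conv_nth singletonI)
      moreover have "0 < length p" "length p - 1 < length p" using len by auto
      ultimately have "0 = length p - 1" using nth_eq_iff_index_eq[OF pp(1)] by blast
      then show False using len by simp
    qed
    then have "adj E (last p) (hd p)" using clique hl by metis
    then show ?thesis unfolding hamiltonian_iff using pp setp len by blast
  next
    case False
    have "\<exists>p q a b. p \<in> P \<and> q \<in> P \<and> p \<noteq> q \<and> (a = hd p \<or> a = last p) \<and> (b = hd q \<or> b = last q) \<and> adj E a b \<and>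
      (ends Q P = 0 \<or> a \<in> Q \<and> b \<in> U)"
    proof (cases "ends Q P = 0")
      case True
      obtain p where p: "p \<in> P" using Pn by blast
      obtain q where q: "q \<in> P" "q \<noteq> p" using False p by blast
      have "hd p \<in> K" "hd q \<in> K"
      proof -
        have "path_ends Q p = 0" "path_ends Q q = 0" using True finP p q(1) unfolding ends_def by simp_all
        then show "hd p \<in> K" "hd q \<in> K" using inQK[of p] inQK[of q] p q(1) unfolding path_ends_def by (auto split: if_splits)
      qed
      moreover have "hd p \<noteq> hd q"
      proof
        assume "hd p = hd q"
        then have "hd p \<in> set p \<inter> set q" using Pne[OF p] Pne[OF q(1)] hd_in_set by (metis IntI)
        then show False using dj[OF p q(1)] q(2) by blast
      qed
      ultimately show ?thesis using True p q clique[of "hd p" "hd q"] by metis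
    next
      case nz: False
      then have pos: "ends Q P > 0" by simp
      obtain p a where p: "p \<in> P" "a = hd p \<or> a = last p" "a \<in> Q" by (rule ends_pos[OF finP pos])
      have lt: "ends Q P < ends U P" using nz less.prems(3) by simp
      have "path_ends Q p \<ge> 1" using p(2,3) unfolding path_ends_def by auto
      then have pU: "path_ends U p \<le> 1" using QU[of p] by simp
      have "ends U P = path_ends U p + ends U (P - {p})" unfolding ends_def using sum.remove[OF finP p(1)] by simp
      then have pos2: "ends U (P - {p}) > 0" using lt nz pU by linarith
      have finP': "finite (P - {p})" using finP by simp
      obtain q b where q: "q \<in> P - {p}" "b = hd q \<or> b = last q" "b \<in> U" by (rule ends_pos[OF finP' pos2])
      have "adj E a b" using UQ[OF q(3) p(3)] by (simp add: insert_commute)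
      then show ?thesis using p q by blast
    qed
    then obtain p q a b where pq: "p \<in> P" "q \<in> P" "p \<noteq> q" "a = hd p \<or> a = last p" "b = hd q \<or> b = last q" "adj E a b"
      "ends Q P = 0 \<or> a \<in> Q \<and> b \<in> U" by blast
    obtain P' where P': "path_system E V P'" "card P = Suc (card P')"
      "\<And>X. ends X P' + of_bool (a \<in> X) + of_bool (b \<in> X) = ends X P"
      using merge_paths[OF less.prems(1) pq(1,4,2,5,3,6)] by metis
    show ?thesis
    proof (rule less.hyps[OF _ P'(1)])
      show "card P' < card P" using P'(2) by simp
      show "ends (- (Q \<union> K)) P' = 0" using P'(3)[of "- (Q \<union> K)"] less.prems(2) by linarith
      show "ends Q P' = 0 \<or> ends Q P' < ends U P'"
      proof (cases "ends Q P = 0")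
        case True
        then show ?thesis using P'(3)[of Q] by simp
      next
        case nz: False
        then have ab: "a \<in> Q" "b \<in> U" using pq(7) by simp_all
        then have nin: "b \<notin> Q" "a \<notin> U" using UK QK by blast+
        have "ends Q P' + 1 = ends Q P" "ends U P' + 1 = ends U P"
          using P'(3)[of Q] P'(3)[of U] ab nin by simp_all
        then show ?thesis using nz less.prems(3) by linarith
      qed
    qed
  qed
qed

section \<open>Weighted selection of edges with bounded degrees, and the cost of making it
  acyclic\<close>

section \<open>Breaking cycles and heavy colour classes\<close>

lemma degree_mono: "finite F \<Longrightarrow> D \<subseteq> F \<Longrightarrow> degree D v \<le> degree F v"
  unfolding degree_def by (rule card_mono) auto

lemma degree_union_disjoint:
  assumes "finite F" "finite G" "F \<inter> G = {}"
  shows "degree (F \<union> G) v = degree F v + degree G v"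
proof -
  have "{e \<in> F \<union> G. v \<in> e} = {e\<in>F. v \<in> e} \<union> {e\<in>G. v \<in> e}" by blast
  then show ?thesis unfolding degree_def using assms card_Un_disjoint[of "{e\<in>F. v \<in> e}" "{e\<in>G. v \<in> e}"] by auto
qed

text \<open>A vertex met by \<open>C\<close> has all its edges of \<open>F\<close> in
  \<open>C\<close>, as their number is at most 2. So intersecting with \<open>C\<close> keeps or
  removes all edges of \<open>D\<close> at a vertex.\<close>

lemma degree_Int_two_regular:
  assumes fin: "finite F" and deg: "degree F v \<le> 2" and C: "C \<subseteq> F" "two_regular C"
    and D: "D \<subseteq> F" "degree D v = 0 \<or> degree D v = 2"
  shows "degree (D \<inter> C) v = 0 \<or> degree (D \<inter> C) v = 2"
proof (cases "degree C v = 0")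
  case True
  have "finite C" using fin C(1) finite_subset by blast
  then have "degree (D \<inter> C) v \<le> degree C v" by (intro degree_mono) auto
  then show ?thesis using True by simp
next
  case False
  then have "degree C v = 2" using C(2) unfolding two_regular_def by metis
  then have "card {e\<in>F. v \<in> e} \<le> card {e\<in>C. v \<in> e}" using deg unfolding degree_def by simp
  then have "{e\<in>C. v \<in> e} = {e\<in>F. v \<in> e}"
    by (intro card_seteq) (use fin C(1) in auto)
  then have "{e\<in>D \<inter> C. v \<in> e} = {e\<in>D. v \<in> e}" using D(1) by blast
  then show ?thesis using D(2) unfolding degree_def by simp
qed

text \<open>Remove an affordable edge from a smallest two-regular \<open>C\<close> and recurse on
  \<open>F - C\<close>. The charged sets are edge-disjoint, so the charges add up to at most
  \<open>sum \<omega> F\<close>; minimality ensures that no two-regular set survives through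
  \<open>C\<close>.\<close>

theorem break_cycles:
  fixes cost \<omega> :: "'a set \<Rightarrow> real"
  assumes "finite F" "\<And>v. degree F v \<le> 2" "F' \<subseteq> F"
    and nn: "\<And>e. \<omega> e \<ge> 0"
    and "\<And>C. C \<subseteq> F \<Longrightarrow> two_regular C \<Longrightarrow> \<exists>e\<in>C \<inter> F'. cost e \<le> sum \<omega> C"
  shows "\<exists>R\<subseteq>F'. acyclic_edges (F - R) \<and> sum cost R \<le> sum \<omega> F"
  using assms(1,2,3,5)
proof (induction "card F" arbitrary: F F' rule: less_induct)
  case less
  show ?case
  proof (cases "acyclic_edges F")
    case True
    then have "acyclic_edges (F - {}) \<and> sum cost {} \<le> sum \<omega> F" using nn by (simp add: sum_nonneg)
    then show ?thesis by blast
  next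
    case False
    then obtain C0 where "C0 \<subseteq> F \<and> two_regular C0" unfolding acyclic_edges_def by blast
    from ex_has_least_nat[of "\<lambda>C. C \<subseteq> F \<and> two_regular C" C0 card, OF this]
    obtain C where C: "C \<subseteq> F" "two_regular C" and min: "\<And>D. D \<subseteq> F \<Longrightarrow> two_regular D \<Longrightarrow> card C \<le> card D" by blast
    obtain e where e: "e \<in> C" "e \<in> F'" "cost e \<le> sum \<omega> C" using less.prems(4)[OF C] by blast
    have finC: "finite C" using less.prems(1) C(1) finite_subset by blast
    have "C \<noteq> {}" using C(2) unfolding two_regular_def by blast
    then have "F - C \<subset> F" using C(1) by blast
    then have lt: "card (F - C) < card F" using psubset_card_mono[OF less.prems(1)] by blast
    have "\<exists>R\<subseteq>F' - C. acyclic_edges (F - C - R) \<and> sum cost R \<le> sum \<omega> (F - C)"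
    proof (rule less.hyps[OF lt])
      show "finite (F - C)" using less.prems(1) by simp
      show "degree (F - C) v \<le> 2" for v using degree_mono[OF less.prems(1), of "F - C" v] less.prems(2)[of v] by auto
      show "F' - C \<subseteq> F - C" using less.prems(3) by blast
      show "\<exists>e\<in>D \<inter> (F' - C). cost e \<le> sum \<omega> D" if "D \<subseteq> F - C" "two_regular D" for D
        using less.prems(4)[of D] that by blast
    qed
    then obtain R where R: "R \<subseteq> F' - C" "acyclic_edges (F - C - R)" "sum cost R \<le> sum \<omega> (F - C)" by blast
    have "acyclic_edges (F - insert e R)"
      unfolding acyclic_edges_def
    proof (rule notI, elim exE conjE)
      fix D assume D: "D \<subseteq> F - insert e R" "two_regular D"
      have "\<forall>v. degree (D \<inter> C) v = 0 \<or> degree (D \<inter> C) v = 2"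
      proof
        fix v
        have "degree D v = 0 \<or> degree D v = 2" using D(2) unfolding two_regular_def by metis
        then show "degree (D \<inter> C) v = 0 \<or> degree (D \<inter> C) v = 2"
          by (rule degree_Int_two_regular[OF less.prems(1,2) C, rotated]) (use D(1) in blast)
      qed
      moreover have "\<not> two_regular (D \<inter> C)"
      proof
        assume "two_regular (D \<inter> C)"
        then have "card C \<le> card (D \<inter> C)" using min[of "D \<inter> C"] C(1) by blast
        moreover have "D \<inter> C \<subset> C" using D(1) e(1) by blast
        ultimately show False using psubset_card_mono[OF finC, of "D \<inter> C"] by simp
      qed
      ultimately have "D \<inter> C = {}" unfolding two_regular_def by metis
      then have "D \<subseteq> F - C - R" using D(1) by blast
      then show False using R(2) D(2) unfolding acyclic_edges_def by blast
    qed
    moreover have "insert e R \<subseteq> F'" using e(2) R(1) by blast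
    moreover have "sum cost (insert e R) \<le> sum \<omega> F"
    proof -
      have "R \<subseteq> F" using R(1) less.prems(3) by blast
      then have "e \<notin> R" "finite R" using R(1) e(1) finite_subset[OF _ less.prems(1)] by blast+
      then have "sum cost (insert e R) = cost e + sum cost R" by simp
      also have "\<dots> \<le> sum \<omega> C + sum \<omega> (F - C)" using e(3) R(3) by simp
      also have "\<dots> = sum \<omega> F" using sum.subset_diff[OF C(1) less.prems(1), of \<omega>] by simp
      finally show ?thesis .
    qed
    ultimately show ?thesis by blast
  qed
qed

text \<open>Split each vertex into copies of degree at most C - 1 and apply Vizing's theorem. A
  colour occurs at most once per copy, and \<open>\<kappa> v\<close> copies of \<open>v\<close>
  suffice.\<close>

lemma split_coloring:
  assumes g: "fin_graph J" and C: "C > 0" and deg: "\<And>v. degree J v \<le> \<kappa> v * (C - 1)"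
  shows "\<exists>f. (\<forall>e\<in>J. f e < C) \<and> (\<forall>i v. card {e\<in>J. v \<in> e \<and> f e = i} \<le> \<kappa> v)"
proof -
  have finJ: "finite J" using g unfolding fin_graph_def by simp
  have "\<forall>v. \<exists>h. bij_betw h {e\<in>J. v \<in> e} {0..<card {e\<in>J. v \<in> e}}"
    using finJ by (intro allI ex_bij_betw_finite_nat) simp
  then obtain pos where pos: "\<And>v. bij_betw (pos v) {e\<in>J. v \<in> e} {0..<card {e\<in>J. v \<in> e}}" by metis
  \<comment> \<open>The copy receiving \<open>e\<close>: blocks of C - 1 consecutive edges in some
    enumeration of the edges at \<open>v\<close>.\<close>
  define idx where "idx v e = pos v e div (C - 1)" for v e
  define lift where "lift e = (\<lambda>v. (v, idx v e)) ` e" for e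
  have fst_lift: "fst ` lift e = e" for e unfolding lift_def by (simp add: image_image)
  have inj: "inj_on lift J" by (rule inj_on_inverseI[where g = "\<lambda>X. fst ` X"]) (rule fst_lift)
  have mem: "(v, j) \<in> lift e \<longleftrightarrow> v \<in> e \<and> idx v e = j" for v j e unfolding lift_def by auto
  have posl: "pos v e < degree J v" if "e \<in> J" "v \<in> e" for v e
    using bij_betwE[OF pos[of v]] that unfolding degree_def by auto
  have gl: "fin_graph (lift ` J)"
    unfolding fin_graph_def
  proof (intro conjI ballI)
    show "finite (lift ` J)" using finJ by simp
    fix X assume "X \<in> lift ` J"
    then obtain e where e: "e \<in> J" "X = lift e" by blast
    have "card (lift e) = card e" unfolding lift_def by (rule card_image) (auto simp: inj_on_def)
    then show "card X = 2" using e g unfolding fin_graph_def by simp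
  qed
  have "degree (lift ` J) w < C" for w
  proof -
    obtain v j where w: "w = (v, j)" by (cases w)
    let ?S = "{e\<in>J. v \<in> e \<and> idx v e = j}"
    have "{X \<in> lift ` J. w \<in> X} = lift ` ?S" using mem w by blast
    then have "degree (lift ` J) w = card ?S"
      unfolding degree_def using card_image[OF inj_on_subset[OF inj, of ?S]] by auto
    also have "\<dots> \<le> card {j * (C - 1)..<j * (C - 1) + (C - 1)}"
    proof (rule card_inj_on_le[where f = "pos v"])
      show "inj_on (pos v) ?S" using pos[of v] unfolding bij_betw_def by (rule inj_on_subset[OF conjunct1]) blast
      show "pos v ` ?S \<subseteq> {j * (C - 1)..<j * (C - 1) + (C - 1)}"
      proof
        fix t assume "t \<in> pos v ` ?S"
        then obtain e where e: "e \<in> J" "v \<in> e" "idx v e = j" "t = pos v e" by blast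
        have "degree J v > 0" using posl[OF e(1,2)] by simp
        then have C1: "C - 1 > 0" using deg[of v] by (metis gr0I mult_0_right not_less)
        have "j * (C - 1) + t mod (C - 1) = t"
          using e(3,4) div_mult_mod_eq[of t "C - 1"] unfolding idx_def by simp
        then have "j * (C - 1) \<le> t" "t < j * (C - 1) + (C - 1)"
          using mod_less_divisor[OF C1, of t] by linarith+
        then show "t \<in> {j * (C - 1)..<j * (C - 1) + (C - 1)}" by simp
      qed
    qed simp
    finally show ?thesis using C by simp
  qed
  then obtain c where c: "proper_edge_coloring (lift ` J) c C"
    using vizing[OF gl] unfolding colorable_def by blast
  define f where "f e = c (lift e)" for e
  have "f e < C" if "e \<in> J" for e using c that unfolding proper_edge_coloring_def f_def by blast
  moreover have "card {e\<in>J. v \<in> e \<and> f e = i} \<le> \<kappa> v" for i v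
  proof -
    have "card {e\<in>J. v \<in> e \<and> f e = i} \<le> card {..<\<kappa> v}"
    proof (rule card_inj_on_le[where f = "idx v"])
      show "inj_on (idx v) {e\<in>J. v \<in> e \<and> f e = i}"
      proof (rule inj_onI)
        fix e e' assume e: "e \<in> {e\<in>J. v \<in> e \<and> f e = i}" "e' \<in> {e\<in>J. v \<in> e \<and> f e = i}" "idx v e = idx v e'"
        then have "(v, idx v e) \<in> lift e" "(v, idx v e) \<in> lift e'" using mem by auto
        moreover have "lift e \<in> lift ` J" "lift e' \<in> lift ` J" "c (lift e) = c (lift e')"
          using e unfolding f_def by simp_all
        ultimately have "lift e = lift e'" using proper_eqD[OF c] by blast
        then show "e = e'" using inj e unfolding inj_on_def by blast
      qed
      show "idx v ` {e\<in>J. v \<in> e \<and> f e = i} \<subseteq> {..<\<kappa> v}"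
      proof
        fix t assume "t \<in> idx v ` {e\<in>J. v \<in> e \<and> f e = i}"
        then obtain e where e: "e \<in> J" "v \<in> e" "t = idx v e" by blast
        have "pos v e < \<kappa> v * (C - 1)" using posl[OF e(1,2)] deg[of v] by simp
        then show "t \<in> {..<\<kappa> v}" using e(3) less_mult_imp_div_less[of "pos v e" "\<kappa> v" "C - 1"] unfolding idx_def by simp
      qed
    qed simp
    then show ?thesis by simp
  qed
  ultimately show ?thesis by blast
qed

theorem heavy_color_class:
  fixes w :: "'a set \<Rightarrow> real"
  assumes g: "fin_graph J" and C: "C > 0" and deg: "\<And>v. degree J v \<le> \<kappa> v * (C - 1)"
  obtains F where "F \<subseteq> J" "\<And>v. degree F v \<le> \<kappa> v" "sum w J \<le> real C * sum w F"
proof -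
  obtain f where f: "\<And>e. e \<in> J \<Longrightarrow> f e < C" "\<And>i v. card {e\<in>J. v \<in> e \<and> f e = i} \<le> \<kappa> v"
    using split_coloring[OF assms] by blast
  have finJ: "finite J" using g unfolding fin_graph_def by simp
  define S where "S i = sum w {e\<in>J. f e = i}" for i
  have tot: "sum w J = (\<Sum>i<C. S i)"
    unfolding S_def by (rule sum.group[symmetric]) (use finJ f(1) in auto)
  have "\<exists>i<C. sum w J \<le> real C * S i"
  proof (rule ccontr)
    assume n: "\<not> ?thesis"
    have "(\<Sum>i<C. real C * S i) < (\<Sum>i<C. sum w J)"
      by (rule sum_strict_mono) (use n C in \<open>auto simp: not_le\<close>)
    then have "real C * (\<Sum>i<C. S i) < real C * sum w J" by (simp add: sum_distrib_left)
    then show False using tot by simp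
  qed
  then obtain i where i: "sum w J \<le> real C * S i" by blast
  show ?thesis
  proof (rule that[of "{e\<in>J. f e = i}"])
    show "{e\<in>J. f e = i} \<subseteq> J" by blast
    have "{e \<in> {e\<in>J. f e = i}. v \<in> e} = {e\<in>J. v \<in> e \<and> f e = i}" for v by blast
    then show "degree {e\<in>J. f e = i} v \<le> \<kappa> v" for v using f(2)[of v i] unfolding degree_def by simp
    show "sum w J \<le> real C * sum w {e\<in>J. f e = i}" using i unfolding S_def .
  qed
qed

lemma degree_sum_inter:
  assumes "finite F" "finite X"
  shows "(\<Sum>v\<in>X. degree F v) = (\<Sum>e\<in>F. card (e \<inter> X))"
proof -
  have "(\<Sum>v\<in>X. degree F v) = (\<Sum>v\<in>X. \<Sum>e | e \<in> F \<and> v \<in> e. 1)"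
    unfolding degree_def by simp
  also have "\<dots> = (\<Sum>e\<in>F. \<Sum>v | v \<in> X \<and> v \<in> e. 1)"
    by (rule sum.swap_restrict[OF assms(2,1)])
  also have "\<dots> = (\<Sum>e\<in>F. card (e \<inter> X))"
    by (rule sum.cong[OF refl]) (simp add: Int_def conj_commute)
  finally show ?thesis .
qed

lemma handshake:
  assumes "fin_graph F" "finite X" "\<And>e. e \<in> F \<Longrightarrow> e \<subseteq> X"
  shows "(\<Sum>v\<in>X. degree F v) = 2 * card F"
proof -
  have fin: "finite F" using assms(1) unfolding fin_graph_def by simp
  have "(\<Sum>e\<in>F. card (e \<inter> X)) = (\<Sum>e\<in>F. 2)"
  proof (rule sum.cong[OF refl])
    fix e assume e: "e \<in> F"
    then have "e \<inter> X = e" using assms(3) by blast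
    then show "card (e \<inter> X) = 2" using assms(1) e unfolding fin_graph_def by simp
  qed
  then show ?thesis using degree_sum_inter[OF fin assms(2)] by simp
qed

text \<open>Edges inside \<open>Q\<close> together with, at each vertex of \<open>W\<close>, as many edges to \<open>Q\<close> as the colouring can afford.\<close>

lemma build_matching:
  fixes a b :: real
  assumes g: "fin_graph E" and Q: "finite Q" and W: "finite W" and QW: "Q \<inter> W = {}" and C: "C > 0"
    and dQ: "\<And>x. x \<in> Q \<Longrightarrow> card (nbrs E x \<inter> (Q \<union> W)) \<le> \<kappa> x * (C - 1)"
  obtains F where "F \<subseteq> E" "\<And>e. e \<in> F \<Longrightarrow> e \<subseteq> Q \<or> (\<exists>x\<in>Q. \<exists>w\<in>W. e = {x, w})"
    "\<And>v. degree F v \<le> \<kappa> v" "\<And>v. v \<notin> Q \<union> W \<Longrightarrow> degree F v = 0"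
    "a * (\<Sum>x\<in>Q. real (card (nbrs E x \<inter> Q))) / 2 +
      b * (\<Sum>w\<in>W. real (min (card (nbrs E w \<inter> Q)) (\<kappa> w * (C - 1))))
      \<le> real C * (a * real (card {e\<in>F. e \<subseteq> Q}) + b * real (card {e\<in>F. \<not> e \<subseteq> Q}))"
proof -
  define t where "t w = min (card (nbrs E w \<inter> Q)) (\<kappa> w * (C - 1))" for w
  have "\<forall>w. \<exists>T. T \<subseteq> nbrs E w \<inter> Q \<and> card T = t w"
    unfolding t_def by (meson min.cobounded1 obtain_subset_with_card_n)
  then obtain T where T: "\<And>w. T w \<subseteq> nbrs E w \<inter> Q" "\<And>w. card (T w) = t w" by metis
  have finT: "finite (T w)" for w using T(1)[of w] finite_nbrs[OF g, of w] by (meson finite_Int finite_subset)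
  define JQ where "JQ = {e\<in>E. e \<subseteq> Q}"
  define JW where "JW = (\<lambda>(w, x). {w, x}) ` (SIGMA w:W. T w)"
  define J where "J = JQ \<union> JW"
  have JWE: "JW \<subseteq> E" unfolding JW_def using T(1) unfolding nbrs_def by auto
  have JE: "J \<subseteq> E" unfolding J_def JQ_def using JWE by auto
  have gJ: "fin_graph J" "fin_graph JQ" "fin_graph JW" using fin_graph_subset[OF g] JE unfolding J_def by blast+
  have finJ: "finite J" "finite JQ" "finite JW" using gJ unfolding fin_graph_def by blast+
  have JWmem: "\<exists>w\<in>W. \<exists>x\<in>T w. e = {w, x}" if "e \<in> JW" for e using that unfolding JW_def by auto
  have notQ: "\<not> e \<subseteq> Q" if "e \<in> JW" for e using JWmem[OF that] QW by blast
  have dj: "JQ \<inter> JW = {}" using notQ unfolding JQ_def by blast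
  have cJW: "card JW = (\<Sum>w\<in>W. t w)"
  proof -
    have "inj_on (\<lambda>(w, x). {w, x}) (SIGMA w:W. T w)"
    proof (rule inj_onI, clarify)
      fix w x w' x' assume h: "w \<in> W" "x \<in> T w" "w' \<in> W" "x' \<in> T w'" "{w, x} = {w', x'}"
      have "x \<in> Q" "x' \<in> Q" using T(1) h(2,4) by blast+
      then have "w \<noteq> x'" "w' \<noteq> x" using QW h(1,3) by blast+
      then show "w = w' \<and> x = x'" using h(5) by (metis doubleton_eq_iff)
    qed
    then have "card JW = card (SIGMA w:W. T w)" unfolding JW_def by (rule card_image)
    also have "\<dots> = (\<Sum>w\<in>W. card (T w))" by (rule card_SigmaI) (use W finT in auto)
    finally show ?thesis using T(2) by simp
  qed
  have cJQ: "2 * card JQ = (\<Sum>x\<in>Q. card (nbrs E x \<inter> Q))"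
  proof -
    have "(\<Sum>v\<in>Q. degree JQ v) = 2 * card JQ" by (rule handshake[OF gJ(2) Q]) (simp add: JQ_def)
    moreover have "degree JQ v = card (nbrs E v \<inter> Q)" if "v \<in> Q" for v
    proof -
      have "nbrs JQ v = nbrs E v \<inter> Q" unfolding nbrs_def JQ_def using that by auto
      then show ?thesis using degree_nbrs[OF gJ(2)] by simp
    qed
    ultimately show ?thesis by simp
  qed
  have nJ: "nbrs J v \<subseteq> Q \<union> W" for v
  proof
    fix w assume "w \<in> nbrs J v"
    then have "{v, w} \<in> J" unfolding nbrs_def by simp
    then have "{v, w} \<subseteq> Q \<or> {v, w} \<in> JW" unfolding J_def JQ_def by blast
    then show "w \<in> Q \<union> W"
    proof
      assume "{v, w} \<in> JW"
      from JWmem[OF this] obtain w' x where "w' \<in> W" "x \<in> T w'" "{v, w} = {w', x}" by blast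
      then have "w = w' \<or> w = x" "x \<in> Q" using T(1) by blast+
      then show ?thesis using \<open>w' \<in> W\<close> by blast
    qed blast
  qed
  have deg0: "degree J v = 0" if "v \<notin> Q \<union> W" for v
  proof -
    have "nbrs J v = {}"
    proof (rule ccontr)
      assume "nbrs J v \<noteq> {}"
      then obtain w where "w \<in> nbrs J v" by blast
      then have "v \<in> nbrs J w" using nbrs_sym by metis
      then show False using nJ that by blast
    qed
    then show ?thesis using degree_nbrs[OF gJ(1)] by simp
  qed
  have degW: "degree J w \<le> t w" if w: "w \<in> W" for w
  proof -
    have "nbrs J w \<subseteq> T w"
    proof
      fix x assume "x \<in> nbrs J w"
      then have "{w, x} \<in> J" unfolding nbrs_def by simp
      moreover have "{w, x} \<notin> JQ" unfolding JQ_def using w QW by blast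
      ultimately have "{w, x} \<in> JW" unfolding J_def by blast
      from JWmem[OF this] obtain w' x' where h: "w' \<in> W" "x' \<in> T w'" "{w, x} = {w', x'}" by blast
      have "x' \<in> Q" using h(2) T(1) by blast
      then have "w \<noteq> x'" using w QW by blast
      then have "w = w'" "x = x'" using h(3) by (metis doubleton_eq_iff)+
      then show "x \<in> T w" using h(2) by simp
    qed
    then have "card (nbrs J w) \<le> card (T w)" using finT card_mono by blast
    then show ?thesis using degree_nbrs[OF gJ(1)] T(2) by simp
  qed
  have degJ: "degree J v \<le> \<kappa> v * (C - 1)" for v
  proof -
    consider "v \<in> Q" | "v \<in> W" | "v \<notin> Q \<union> W" by blast
    then show ?thesis
    proof cases
      case 1
      have "nbrs J v \<subseteq> nbrs E v \<inter> (Q \<union> W)" using nJ[of v] JE unfolding nbrs_def by blast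
      then have "card (nbrs J v) \<le> card (nbrs E v \<inter> (Q \<union> W))" using finite_nbrs[OF g, of v] by (intro card_mono) auto
      then show ?thesis using dQ[OF 1] degree_nbrs[OF gJ(1), of v] by simp
    next
      case 2
      then show ?thesis using degW[OF 2] unfolding t_def by simp
    next
      case 3
      then show ?thesis using deg0 by simp
    qed
  qed
  define wt where "wt e = (if e \<subseteq> Q then a else b)" for e :: "'a set"
  obtain F where F: "F \<subseteq> J" "\<And>v. degree F v \<le> \<kappa> v" "sum wt J \<le> real C * sum wt F"
    using heavy_color_class[OF gJ(1) C degJ] by metis
  have sw: "sum wt G = a * real (card {e\<in>G. e \<subseteq> Q}) + b * real (card {e\<in>G. \<not> e \<subseteq> Q})" if "finite G" for G
  proof -
    have "sum wt G = sum wt {e\<in>G. e \<subseteq> Q} + sum wt {e\<in>G. \<not> e \<subseteq> Q}"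
      using sum.union_disjoint[of "{e\<in>G. e \<subseteq> Q}" "{e\<in>G. \<not> e \<subseteq> Q}" wt] that by (simp add: Collect_disj_eq[symmetric] disjoint_iff flip: Collect_disj_eq) (metis (no_types, lifting) Collect_cong Collect_mem_eq)
    then show ?thesis unfolding wt_def by (simp add: mult.commute)
  qed
  have "{e\<in>J. e \<subseteq> Q} = JQ" "{e\<in>J. \<not> e \<subseteq> Q} = JW" unfolding J_def using notQ unfolding JQ_def by blast+
  then have "sum wt J = a * real (card JQ) + b * real (card JW)" using sw[OF finJ(1)] by simp
  moreover have "2 * real (card JQ) = (\<Sum>x\<in>Q. real (card (nbrs E x \<inter> Q)))"
    using arg_cong[OF cJQ, of real] by simp
  ultimately have sJ: "sum wt J = a * (\<Sum>x\<in>Q. real (card (nbrs E x \<inter> Q))) / 2 + b * (\<Sum>w\<in>W. real (t w))"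
    using cJW by (simp add: field_simps)
  have finF: "finite F" using F(1) finJ(1) finite_subset by blast
  show ?thesis
  proof (rule that[of F])
    show "F \<subseteq> E" using F(1) JE by blast
    show "e \<subseteq> Q \<or> (\<exists>x\<in>Q. \<exists>w\<in>W. e = {x, w})" if "e \<in> F" for e
    proof -
      have "e \<in> JQ \<or> e \<in> JW" using that F(1) unfolding J_def by blast
      then show ?thesis
      proof
        assume "e \<in> JW"
        from JWmem[OF this] obtain w x where "w \<in> W" "x \<in> T w" "e = {w, x}" by blast
        moreover have "x \<in> Q" using \<open>x \<in> T w\<close> T(1) by blast
        moreover have "{w, x} = {x, w}" by (rule insert_commute)
        ultimately show ?thesis by metis
      qed (simp add: JQ_def)
    qed
    show "degree F v \<le> \<kappa> v" for v by (rule F(2))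
    show "degree F v = 0" if "v \<notin> Q \<union> W" for v using deg0[OF that] degree_mono[OF finJ(1) F(1), of v] by simp
    show "a * (\<Sum>x\<in>Q. real (card (nbrs E x \<inter> Q))) / 2 +
      b * (\<Sum>w\<in>W. real (min (card (nbrs E w \<inter> Q)) (\<kappa> w * (C - 1))))
      \<le> real C * (a * real (card {e\<in>F. e \<subseteq> Q}) + b * real (card {e\<in>F. \<not> e \<subseteq> Q}))"
      using F(3) sJ sw[OF finF] unfolding t_def by simp
  qed
qed

section \<open>Degrees relative to the universal vertices of the closure\<close>

section \<open>Dense critical graphs\<close>

text \<open>Two edge sets are kept: the adjacency lemma is applied in \<open>E\<close>, path ends
  are joined in \<open>E'\<close>. The assumption \<open>dense\<close> is the degree hypothesis
  cleared of denominators.\<close>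

locale dense_critical = critical_graph E k for E :: "'a set set" and k :: nat +
  fixes V :: "'a set" and E' :: "'a set set"
  assumes simple: "simple_graph V E"
    and degree_pos: "v \<in> V \<Longrightarrow> degree E v > 0"
    and dense: "2 * card V + 36 \<le> 3 * k"
    and sub: "E \<subseteq> E'"
    and simple': "simple_graph V E'"
    and closed: "u \<in> V \<Longrightarrow> v \<in> V \<Longrightarrow> u \<noteq> v \<Longrightarrow> card V \<le> degree E' u + degree E' v \<Longrightarrow> {u, v} \<in> E'"
begin

definition Lo :: "'a set" where "Lo = {v\<in>V. low v}"
definition Hi :: "'a set" where "Hi = {v\<in>V. \<not> low v}"
definition Uv :: "'a set" where "Uv = {v\<in>Hi. \<forall>w\<in>Hi. w \<noteq> v \<longrightarrow> {v, w} \<in> E'}"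
definition Bi :: "'a set" where "Bi = {v\<in>Hi - Uv. card V \<le> 2 * degree E' v}"
definition Sm :: "'a set" where "Sm = {v\<in>Hi - Uv. 2 * degree E' v < card V}"
text \<open>\<open>Uv\<close> comes from the closure, but its members are counted among neighbours
  in \<open>E\<close>, where the adjacency lemma holds.\<close>

definition un_deg :: "'a \<Rightarrow> nat" where "un_deg v = card (nbrs E v \<inter> Uv)"
definition out_deg :: "'a \<Rightarrow> nat" where "out_deg v = card (nbrs E v - Uv)"

lemma finV: "finite V" using simple unfolding simple_graph_def by blast

lemma graph': "fin_graph E'" using simple_graph_fin_graph[OF simple'] .

lemma nbrs_V: "nbrs E v \<subseteq> V" using simple unfolding simple_graph_def nbrs_def by auto

lemma nbrs_sub: "nbrs E v \<subseteq> nbrs E' v" using sub unfolding nbrs_def by blast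

lemma degree_le': "degree E v \<le> degree E' v"
  using degree_nbrs[OF graph] degree_nbrs[OF graph'] card_mono[OF finite_nbrs[OF graph'] nbrs_sub] by simp

lemma parts: "V = Lo \<union> Hi" "Hi = Uv \<union> Bi \<union> Sm"
  "Lo \<inter> Hi = {}" "Uv \<inter> Bi = {}" "Uv \<inter> Sm = {}" "Bi \<inter> Sm = {}" "Lo \<subseteq> V" "Hi \<subseteq> V"
  unfolding Lo_def Hi_def Uv_def Bi_def Sm_def by force+

lemma part_subs: "Uv \<subseteq> Hi" "Bi \<subseteq> Hi" "Sm \<subseteq> Hi" "Lo \<inter> Uv = {}" "Lo \<inter> Bi = {}" "Lo \<inter> Sm = {}"
  using parts by blast+

lemma fin_parts: "finite Lo" "finite Hi" "finite Uv" "finite Bi" "finite Sm"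
  unfolding Lo_def Hi_def Uv_def Bi_def Sm_def using finV by simp_all

lemma Hi_degree: "v \<in> Hi \<Longrightarrow> k \<le> 2 * degree E v"
  unfolding Hi_def low_def by auto

lemma Lo_degree: "v \<in> Lo \<Longrightarrow> 2 * degree E v < k"
  unfolding Lo_def low_def by auto

lemma Lo_nbrs: "v \<in> Lo \<Longrightarrow> nbrs E v \<subseteq> Hi"
proof
  fix w assume v: "v \<in> Lo" and w: "w \<in> nbrs E v"
  have "{v, w} \<in> E" using w unfolding nbrs_def by simp
  then have "\<not> low w" using low_independent v unfolding Lo_def by simp
  then show "w \<in> Hi" using w nbrs_V unfolding Hi_def by blast
qed

text \<open>By \<open>dense\<close>, k plus at least k/2 is at least n, so the closure joins
  \<open>v\<close> to every other non-low vertex.\<close>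

lemma max_in_Uv:
  assumes "v \<in> V" "degree E v = k"
  shows "v \<in> Uv"
proof -
  have kpos: "k > 0" using dense by simp
  have v: "v \<in> Hi" unfolding Hi_def low_def using assms by simp
  moreover have "{v, w} \<in> E'" if w: "w \<in> Hi" "w \<noteq> v" for w
  proof (rule closed)
    show "v \<in> V" "w \<in> V" "v \<noteq> w" using assms(1) w unfolding Hi_def by auto
    have "degree E v + degree E w \<le> degree E' v + degree E' w" using degree_le' by (simp add: add_mono)
    moreover have "k \<le> 2 * degree E w" using Hi_degree[OF w(1)] .
    ultimately show "card V \<le> degree E' v + degree E' w" using dense assms(2) by linarith
  qed
  ultimately show ?thesis unfolding Uv_def by blast
qed

lemma Uv_adj:
  assumes "u \<in> Uv" "w \<in> Hi" "u \<noteq> w"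
  shows "{u, w} \<in> E'"
proof -
  have "\<forall>w\<in>Hi. w \<noteq> u \<longrightarrow> {u, w} \<in> E'" using assms(1) unfolding Uv_def by simp
  then show ?thesis using assms(2,3) by metis
qed

lemma clique: "u \<in> Uv \<union> Bi \<Longrightarrow> v \<in> Uv \<union> Bi \<Longrightarrow> u \<noteq> v \<Longrightarrow> {u, v} \<in> E'"
proof -
  assume h: "u \<in> Uv \<union> Bi" "v \<in> Uv \<union> Bi" "u \<noteq> v"
  have Hi: "u \<in> Hi" "v \<in> Hi" using h(1,2) part_subs(1,2) by auto
  show "{u, v} \<in> E'"
  proof (cases "u \<in> Uv \<or> v \<in> Uv")
    case True
    then show ?thesis using Uv_adj[of u v] Uv_adj[of v u] Hi h(3) by (metis insert_commute)
  next
    case False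
    then have "u \<in> Bi" "v \<in> Bi" using h(1,2) by auto
    then have "card V \<le> degree E' u + degree E' v" unfolding Bi_def by simp
    then show ?thesis using closed[of u v] Hi h(3) unfolding Hi_def by simp
  qed
qed

lemma degree_split: "degree E v = un_deg v + out_deg v"
proof -
  have "card (nbrs E v) = card (nbrs E v \<inter> Uv) + card (nbrs E v - Uv)"
    by (rule card_Int_Diff[OF finite_nbrs[OF graph]])
  then show ?thesis using degree_nbrs[OF graph] unfolding un_deg_def out_deg_def by simp
qed

lemma out_deg_le':
  assumes "v \<in> Hi - Uv"
  shows "out_deg v + card Uv \<le> degree E' v"
proof -
  have "Uv \<subseteq> nbrs E' v"
  proof
    fix u assume u: "u \<in> Uv"
    then have "{u, v} \<in> E'" using Uv_adj assms by blast
    then show "u \<in> nbrs E' v" unfolding nbrs_def by (simp add: insert_commute)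
  qed
  then have "(nbrs E v - Uv) \<union> Uv \<subseteq> nbrs E' v" using nbrs_sub by blast
  then have "card ((nbrs E v - Uv) \<union> Uv) \<le> degree E' v"
    using card_mono[OF finite_nbrs[OF graph']] degree_nbrs[OF graph'] by simp
  moreover have "card ((nbrs E v - Uv) \<union> Uv) = out_deg v + card Uv"
    unfolding out_deg_def using finite_nbrs[OF graph] fin_parts by (intro card_Un_disjoint) auto
  ultimately show ?thesis by simp
qed

lemma Sm_out_deg: "v \<in> Sm \<Longrightarrow> 2 * out_deg v + 2 * card Uv < card V"
  using out_deg_le'[of v] unfolding Sm_def by auto

lemma Sm_degree: "v \<in> Sm \<Longrightarrow> 2 * degree E v < card V"
  using degree_le'[of v] unfolding Sm_def by auto

text \<open>Some non-low vertex is not joined to \<open>v\<close> in the closure. It is outside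
  \<open>Uv\<close> too, so its closure degree is at least |Uv|, while the two closure degrees add
  up to less than n.\<close>

lemma not_Uv_degree:
  assumes v: "v \<in> Hi - Uv"
  shows "degree E v + card Uv < card V"
proof -
  obtain w where w: "w \<in> Hi" "w \<noteq> v" "{v, w} \<notin> E'" using v unfolding Uv_def by blast
  have "w \<notin> Uv" using Uv_adj[of w v] v w by (metis DiffD1 insert_commute)
  then have "card Uv \<le> degree E' w" using out_deg_le'[of w] w(1) by simp
  moreover have "degree E' v + degree E' w < card V"
    using closed[of v w] v w parts by (metis DiffD1 not_le subsetD)
  ultimately show ?thesis using degree_le'[of v] by simp
qed

lemma un_deg_ge:
  assumes "x \<in> nbrs E y"
  shows "k + 1 \<le> degree E x + un_deg y"
proof -
  have e: "{x, y} \<in> E" using assms unfolding nbrs_def by (simp add: insert_commute)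
  have "{v \<in> nbrs E y. v \<noteq> x \<and> degree E v = k} \<subseteq> nbrs E y \<inter> Uv"
    using max_in_Uv nbrs_V[of y] by blast
  then have "card {v \<in> nbrs E y. v \<noteq> x \<and> degree E v = k} \<le> un_deg y"
    unfolding un_deg_def using finite_nbrs[OF graph] by (intro card_mono) auto
  then show ?thesis using vizing_adjacency[OF e] by simp
qed

lemma out_deg_le:
  assumes "x \<in> nbrs E y"
  shows "out_deg y + k + 1 \<le> degree E x + degree E y"
  using un_deg_ge[OF assms] degree_split[of y] by simp

lemma double_count:
  fixes f :: "'a \<Rightarrow> real"
  assumes "finite X" "finite Y"
  shows "(\<Sum>x\<in>X. real (card (nbrs E x \<inter> Y)) * f x) = (\<Sum>y\<in>Y. \<Sum>x\<in>nbrs E y \<inter> X. f x)"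
proof -
  have "(\<Sum>x\<in>X. real (card (nbrs E x \<inter> Y)) * f x) = (\<Sum>x\<in>X. \<Sum>y | y \<in> Y \<and> x \<in> nbrs E y. f x)"
  proof (rule sum.cong[OF refl])
    fix x
    have "{y. y \<in> Y \<and> x \<in> nbrs E y} = nbrs E x \<inter> Y" using nbrs_sym[of x E] by blast
    then show "real (card (nbrs E x \<inter> Y)) * f x = (\<Sum>y | y \<in> Y \<and> x \<in> nbrs E y. f x)" by simp
  qed
  also have "\<dots> = (\<Sum>y\<in>Y. \<Sum>x | x \<in> X \<and> x \<in> nbrs E y. f x)" by (rule sum.swap_restrict[OF assms])
  also have "\<dots> = (\<Sum>y\<in>Y. \<Sum>x\<in>nbrs E y \<inter> X. f x)"
    by (intro sum.cong refl) auto
  finally show ?thesis .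
qed

text \<open>Give each edge from \<open>x\<close> outside \<open>Uv\<close> to \<open>Uv\<close> the
  weight 1/d(x). A vertex \<open>y\<close> of \<open>Uv\<close> receives \<open>out_deg y\<close>
  weights, each at most 1/(\<open>out_deg y\<close> + 1) by the adjacency lemma, hence less than 1
  altogether.\<close>

lemma Uv_weight:
  assumes "Uv \<noteq> {}"
  shows "(\<Sum>x\<in>V - Uv. real (un_deg x) / real (degree E x)) < real (card Uv)"
proof -
  have "(\<Sum>x\<in>V - Uv. real (un_deg x) / real (degree E x)) = (\<Sum>y\<in>Uv. \<Sum>x\<in>nbrs E y \<inter> (V - Uv). 1 / real (degree E x))"
    using double_count[of "V - Uv" Uv "\<lambda>x. 1 / real (degree E x)"] finV fin_parts unfolding un_deg_def by simp
  also have "\<dots> < (\<Sum>y\<in>Uv. 1)"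
  proof (rule sum_strict_mono[OF fin_parts(3) assms])
    fix y assume y: "y \<in> Uv"
    have eq: "nbrs E y \<inter> (V - Uv) = nbrs E y - Uv" using nbrs_V by blast
    have "(\<Sum>x\<in>nbrs E y - Uv. 1 / real (degree E x)) \<le> (\<Sum>x\<in>nbrs E y - Uv. 1 / real (out_deg y + 1))"
    proof (rule sum_mono)
      fix x assume "x \<in> nbrs E y - Uv"
      then have "out_deg y + k + 1 \<le> degree E x + degree E y" using out_deg_le by blast
      then have "out_deg y + 1 \<le> degree E x" using degree_le[of y] by linarith
      then show "1 / real (degree E x) \<le> 1 / real (out_deg y + 1)" by (intro divide_left_mono) auto
    qed
    also have "\<dots> = real (out_deg y) / real (out_deg y + 1)" unfolding out_deg_def by simp
    also have "\<dots> < 1" by simp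
    finally show "(\<Sum>x\<in>nbrs E y \<inter> (V - Uv). 1 / real (degree E x)) < 1" unfolding eq .
  qed
  finally show ?thesis by simp
qed

text \<open>The smallest degree m in \<open>T\<close> acts twice: it bounds the sum by |T|/m, and
  the adjacency lemma yields \<open>un_deg w\<close> \<ge> k + 1 - m. Since |T| < m, this pays for
  replacing 1/m by 1/k.\<close>

lemma nbr_weight:
  assumes T: "T \<subseteq> nbrs E w - Uv"
  shows "(\<Sum>x\<in>T. 1 / real (degree E x)) - real (un_deg w) / real (degree E w) \<le> real (card T) / real k"
proof (cases "T = {}")
  case True
  then show ?thesis by simp
next
  case False
  have finT: "finite T" using T finite_nbrs[OF graph, of w] by (meson finite_Diff finite_subset)
  define m where "m = Min (degree E ` T)"
  have "m \<in> degree E ` T" unfolding m_def using finT False by simp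
  then obtain x0 where x0: "x0 \<in> T" "degree E x0 = m" by auto
  have mle: "m \<le> degree E x" if "x \<in> T" for x unfolding m_def using finT that by simp
  have kpos: "k > 0" using dense by simp
  have tout: "card T \<le> out_deg w" unfolding out_deg_def using T finite_nbrs[OF graph, of w] by (intro card_mono) auto
  have x0n: "x0 \<in> nbrs E w" using x0(1) T by blast
  have tm: "card T + 1 \<le> m" using out_deg_le[OF x0n] tout x0(2) degree_le[of w] by linarith
  have mk: "m \<le> k" using x0(2) degree_le by blast
  have b: "k + 1 \<le> m + un_deg w" using un_deg_ge[OF x0n] x0(2) by simp
  have dw: "degree E w > 0" using b mk degree_split[of w] by linarith
  have "(\<Sum>x\<in>T. 1 / real (degree E x)) \<le> (\<Sum>x\<in>T. 1 / real m)"
  proof (rule sum_mono)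
    fix x assume "x \<in> T"
    then have "m \<le> degree E x" "0 < m" using mle tm by auto
    then show "1 / real (degree E x) \<le> 1 / real m" by (simp add: frac_le)
  qed
  then have s: "(\<Sum>x\<in>T. 1 / real (degree E x)) \<le> real (card T) / real m" by simp
  have "real (k + 1 - m) / real k \<le> real (un_deg w) / real (degree E w)"
    using b mk dw degree_le[of w] by (intro frac_le) auto
  moreover have "real (card T) / real m - real (k + 1 - m) / real k \<le> real (card T) / real k"
  proof -
    define t where "t = real (card T)" define m' where "m' = real m" define k' where "k' = real k"
    have h: "t \<le> m'" "m' > 0" "k' > 0" "m' \<le> k'" "t \<ge> 0" using tm mk kpos unfolding t_def m'_def k'_def by auto
    have "t * (k' - m') \<le> m' * (k' + 1 - m')" using h by (intro mult_mono) auto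
    then have "t * (k' - m') / (m' * k') \<le> m' * (k' + 1 - m') / (m' * k')"
      using h by (intro divide_right_mono) simp_all
    moreover have "t * (k' - m') / (m' * k') = t / m' - t / k'"
      using h diff_frac_eq[of m' k' t t] by (simp add: right_diff_distrib)
    moreover have "m' * (k' + 1 - m') / (m' * k') = (k' + 1 - m') / k'" using h by simp
    ultimately have "t / m' - (k' + 1 - m') / k' \<le> t / k'" by linarith
    moreover have "real (k + 1 - m) = k' + 1 - m'" unfolding k'_def m'_def using mk by (simp add: of_nat_diff)
    ultimately show ?thesis unfolding t_def m'_def k'_def by simp
  qed
  ultimately show ?thesis using s by linarith
qed

end

section \<open>Charging the neighbours outside \<open>Uv\<close> of small and low vertices\<close>

section \<open>The counting inequality\<close>

text \<open>
\<open>asg y = Some x\<close> says that \<open>y\<close> is a private neighbour of the low vertex \<open>x\<close>. The set \<open>A\<close> consists of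
the low vertices reachable by alternating paths from those with a private neighbour in \<open>Uv\<close>; by
maximality of the assignment on \<open>Sm \<union> Bi\<close> all neighbours of \<open>A\<close> in \<open>Sm \<union> Bi\<close> are taken by \<open>A\<close>.
\<close>

locale cherries = dense_critical E k V E' for E :: "'a set set" and k :: nat and V E' +
  fixes asg :: "'a \<Rightarrow> 'a option" and A :: "'a set"
  assumes asg: "asg y = Some x \<Longrightarrow> x \<in> Lo \<and> y \<in> nbrs E x"
    and owned2: "x \<in> Lo \<Longrightarrow> card (owned asg x) = 2"
    and A_Lo: "A \<subseteq> Lo"
    and A_closed: "x \<in> A \<Longrightarrow> y \<in> nbrs E x \<Longrightarrow> y \<in> Sm \<union> Bi \<Longrightarrow> \<exists>x'\<in>A. asg y = Some x'"
    and A_rest: "x \<in> Lo - A \<Longrightarrow> owned asg x \<subseteq> Sm \<union> Bi"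
begin

text \<open>By \<open>A_closed\<close> these vertices are all private neighbours of
  \<open>A\<close>; the forest edges are chosen on the remaining sets \<open>Q'\<close> and
  \<open>W'\<close>.\<close>

definition Z :: "'a set" where "Z = {y \<in> Sm \<union> Bi. nbrs E y \<inter> A \<noteq> {}}"
definition Q' :: "'a set" where "Q' = Sm - Z"
definition W' :: "'a set" where "W' = Bi - Z"

lemma fin_sets: "finite A" "finite Z" "finite Q'" "finite W'"
  using fin_parts A_Lo finite_subset unfolding Z_def Q'_def W'_def by (blast, simp_all)

lemma deg_pos: "v \<in> V \<Longrightarrow> real (degree E v) > 0"
  using degree_pos by simp

lemma out_deg_ge: "T \<subseteq> nbrs E y - Uv \<Longrightarrow> card T \<le> out_deg y"
  unfolding out_deg_def using finite_nbrs[OF graph] by (intro card_mono) auto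

lemma disjoint_Uv: "A \<inter> Uv = {}" "Q' \<inter> Uv = {}" "A \<inter> Q' = {}"
  using A_Lo part_subs(4,6) parts(5) unfolding Q'_def by blast+

text \<open>A low neighbour together with d(y) < n/2 makes every neighbour's degree at least twice
  \<open>out_deg y\<close>, so the two sums contribute at most 1/2. The low neighbour alone bounds
  the middle term by 1/2.\<close>

lemma count_ZQ:
  assumes y: "y \<in> Z \<inter> Sm"
  shows "(\<Sum>x\<in>nbrs E y \<inter> A. 1 / real (degree E x)) + real (out_deg y) / real (degree E y)
    + (\<Sum>x\<in>nbrs E y \<inter> Q'. 1 / real (degree E x)) \<le> 1"
proof -
  obtain x0 where x0: "x0 \<in> nbrs E y" "x0 \<in> A" using y unfolding Z_def by blast
  have x0d: "2 * degree E x0 < k" using Lo_degree A_Lo x0(2) by blast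
  have yd: "2 * degree E y < card V" using Sm_degree y by blast
  have s: "out_deg y + k + 1 \<le> degree E x0 + degree E y" using out_deg_le[OF x0(1)] .
  define e where "e = k + 1 - degree E y"
  have dy: "degree E y \<le> k" using degree_le .
  have se: "out_deg y \<le> e" using s x0d yd dense dy unfolding e_def by linarith
  have e1: "e \<ge> 1" unfolding e_def using dy by simp
  have deg: "out_deg y + e \<le> degree E x" if "x \<in> nbrs E y" for x
    using out_deg_le[OF that] dy unfolding e_def by linarith
  have dj: "(nbrs E y \<inter> A) \<inter> (nbrs E y \<inter> Q') = {}" using disjoint_Uv(3) by blast
  have fin: "finite (nbrs E y \<inter> A)" "finite (nbrs E y \<inter> Q')" using fin_sets by auto
  have "(\<Sum>x\<in>nbrs E y \<inter> A. 1 / real (degree E x)) + (\<Sum>x\<in>nbrs E y \<inter> Q'. 1 / real (degree E x))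
    = (\<Sum>x\<in>(nbrs E y \<inter> A) \<union> (nbrs E y \<inter> Q'). 1 / real (degree E x))"
    by (rule sum.union_disjoint[OF fin dj, symmetric])
  also have "\<dots> \<le> (\<Sum>x\<in>(nbrs E y \<inter> A) \<union> (nbrs E y \<inter> Q'). 1 / real (out_deg y + e))"
  proof (rule sum_mono)
    fix x assume "x \<in> (nbrs E y \<inter> A) \<union> (nbrs E y \<inter> Q')"
    then have "out_deg y + e \<le> degree E x" using deg by blast
    then show "1 / real (degree E x) \<le> 1 / real (out_deg y + e)" using e1 by (intro frac_le) auto
  qed
  also have "\<dots> = real (card ((nbrs E y \<inter> A) \<union> (nbrs E y \<inter> Q'))) / real (out_deg y + e)" by simp
  also have "\<dots> \<le> real (out_deg y) / real (out_deg y + e)"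
  proof -
    have "card ((nbrs E y \<inter> A) \<union> (nbrs E y \<inter> Q')) \<le> out_deg y"
      by (rule out_deg_ge) (use disjoint_Uv in blast)
    then show ?thesis by (intro divide_right_mono) simp_all
  qed
  also have "\<dots> \<le> 1 / 2"
  proof -
    have "2 * real (out_deg y) \<le> real (out_deg y + e)" using se by simp
    moreover have "real (out_deg y + e) > 0" using e1 by simp
    ultimately show ?thesis by (simp add: divide_le_eq)
  qed
  finally have 1: "(\<Sum>x\<in>nbrs E y \<inter> A. 1 / real (degree E x)) + (\<Sum>x\<in>nbrs E y \<inter> Q'. 1 / real (degree E x)) \<le> 1 / 2" .
  have "2 * out_deg y \<le> degree E y" using s x0d dy by linarith
  moreover have "degree E y > 0" using degree_pos y part_subs parts by blast
  ultimately have "real (out_deg y) / real (degree E y) \<le> 1 / 2" by (simp add: divide_le_eq)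
  then show ?thesis using 1 by linarith
qed

text \<open>A neighbour in \<open>Sm\<close> has degree below n/2, hence below 3k/4, so by the
  adjacency lemma more than half of the neighbours of the low vertex \<open>x\<close> lie in
  \<open>Uv\<close>. The neighbours counted have degree at least d(x).\<close>

lemma count_Lo:
  assumes x: "x \<in> Lo - A"
  shows "(\<Sum>y\<in>nbrs E x \<inter> Q'. 1 / real (degree E y)) \<le> real (un_deg x) / real (degree E x)"
proof (cases "nbrs E x \<inter> Q' = {}")
  case True
  then show ?thesis by simp
next
  case False
  then obtain y0 where y0: "y0 \<in> nbrs E x" "y0 \<in> Q'" by blast
  have y0S: "y0 \<in> Sm" using y0(2) unfolding Q'_def by blast
  have b: "k + 1 \<le> degree E y0 + un_deg x" using un_deg_ge[OF y0(1)] .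
  have xd: "2 * degree E x < k" using Lo_degree x by blast
  have xp: "degree E x > 0" using degree_pos x parts by blast
  have "card (nbrs E x \<inter> Q') \<le> out_deg x"
    by (rule out_deg_ge) (use disjoint_Uv in blast)
  also have "out_deg x \<le> un_deg x" using b xd Sm_degree[OF y0S] dense degree_split[of x] by linarith
  finally have c: "card (nbrs E x \<inter> Q') \<le> un_deg x" .
  have "(\<Sum>y\<in>nbrs E x \<inter> Q'. 1 / real (degree E y)) \<le> (\<Sum>y\<in>nbrs E x \<inter> Q'. 1 / real (degree E x))"
  proof (rule sum_mono)
    fix y assume "y \<in> nbrs E x \<inter> Q'"
    then have "y \<in> Hi" using part_subs unfolding Q'_def by blast
    then have "degree E x \<le> degree E y" using Hi_degree[of y] xd by linarith
    then show "1 / real (degree E y) \<le> 1 / real (degree E x)" using xp by (intro frac_le) auto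
  qed
  also have "\<dots> = real (card (nbrs E x \<inter> Q')) / real (degree E x)" by simp
  also have "\<dots> \<le> real (un_deg x) / real (degree E x)" using c by (intro divide_right_mono) auto
  finally show ?thesis .
qed

text \<open>A low neighbour forces \<open>out_deg w\<close> to be at most k/2, so the bound in
  \<open>nbr_weight\<close> is at most 1/2.\<close>

lemma count_ZW:
  assumes w: "w \<in> Z \<inter> Bi"
  shows "2 * (\<Sum>x\<in>nbrs E w \<inter> A. 1 / real (degree E x)) + 2 * (\<Sum>x\<in>nbrs E w \<inter> Q'. 1 / real (degree E x))
    - 2 * (real (un_deg w) / real (degree E w)) \<le> 1"
proof -
  obtain x0 where x0: "x0 \<in> nbrs E w" "x0 \<in> A" using w unfolding Z_def by blast
  let ?T = "(nbrs E w \<inter> A) \<union> (nbrs E w \<inter> Q')"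
  have T: "?T \<subseteq> nbrs E w - Uv" using disjoint_Uv by blast
  have dj: "(nbrs E w \<inter> A) \<inter> (nbrs E w \<inter> Q') = {}" using disjoint_Uv(3) by blast
  have fin: "finite (nbrs E w \<inter> A)" "finite (nbrs E w \<inter> Q')" using fin_sets by auto
  have "out_deg w + k + 1 \<le> degree E x0 + degree E w" using out_deg_le[OF x0(1)] .
  moreover have "2 * degree E x0 < k" using Lo_degree A_Lo x0(2) by blast
  ultimately have "2 * out_deg w \<le> k" using degree_le[of w] by linarith
  then have "2 * card ?T \<le> k" using out_deg_ge[OF T] by linarith
  then have "2 * real (card ?T) \<le> real k" by linarith
  moreover have "k > 0" using dense by simp
  ultimately have "real (card ?T) / real k \<le> 1 / 2" by (simp add: divide_le_eq)
  moreover have "(\<Sum>x\<in>?T. 1 / real (degree E x)) - real (un_deg w) / real (degree E w) \<le> real (card ?T) / real k"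
    by (rule nbr_weight[OF T])
  moreover have "(\<Sum>x\<in>?T. 1 / real (degree E x)) = (\<Sum>x\<in>nbrs E w \<inter> A. 1 / real (degree E x)) + (\<Sum>x\<in>nbrs E w \<inter> Q'. 1 / real (degree E x))"
    by (rule sum.union_disjoint[OF fin dj])
  ultimately show ?thesis by linarith
qed

lemma count_W:
  assumes w: "w \<in> W'"
  shows "(\<Sum>x\<in>nbrs E w \<inter> Q'. 1 / real (degree E x)) - real (un_deg w) / real (degree E w)
    \<le> real (card (nbrs E w \<inter> Q')) / real k"
  by (rule nbr_weight) (use disjoint_Uv in blast)

text \<open>Each vertex of \<open>A\<close> and \<open>Sm\<close> counts 1 = \<open>un_deg\<close>/d
  + \<open>out_deg\<close>/d. The outer part from \<open>A\<close> goes to \<open>Z\<close> only,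
  that from \<open>Q'\<close> to \<open>Q'\<close>, \<open>Z\<close>, \<open>W'\<close> and the low
  vertices outside \<open>A\<close>; double counting moves it to the receiving vertices, where the
  previous lemmas bound it. The remaining sums over \<open>Q'\<close> and \<open>W'\<close> are what
  the forest must make up for.\<close>

lemma count:
  "2 * real (card Sm) + 2 * real (card A) \<le>
    2 * (\<Sum>x\<in>V - Uv. real (un_deg x) / real (degree E x))
    + 2 * (\<Sum>x\<in>Q'. real (card (nbrs E x \<inter> Q')) / real (degree E x))
    + 2 * (\<Sum>w\<in>W'. real (card (nbrs E w \<inter> Q')) / real k)
    + 2 * real (card (Z \<inter> Sm)) + real (card (Z \<inter> Bi))"
proof -
  define g where "g x = real (un_deg x) / real (degree E x)" for x
  define h where "h x = 1 / real (degree E x)" for x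
  define r where "r Y x = real (card (nbrs E x \<inter> Y)) * h x" for Y x
  define inv where "inv Y y = (\<Sum>x\<in>nbrs E y \<inter> Y. h x)" for Y y
  have dc: "(\<Sum>x\<in>X. r Y x) = (\<Sum>y\<in>Y. inv X y)" if "finite X" "finite Y" for X Y
    unfolding r_def inv_def by (rule double_count[OF that])
  have ZQ: "finite (Z \<inter> Sm)" "finite (Z \<inter> Bi)" using fin_sets by auto
  have one: "g x + real (out_deg x) * h x = 1" if "x \<in> V" for x
    unfolding g_def h_def using deg_pos[OF that] arg_cong[OF degree_split[of x], of real]
    by (simp add: add_divide_distrib[symmetric])
  have AZ: "out_deg x = card (nbrs E x \<inter> Z)" if x: "x \<in> A" for x
  proof -
    have "nbrs E x - Uv = nbrs E x \<inter> Z"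
    proof (intro equalityI subsetI)
      fix y assume y: "y \<in> nbrs E x - Uv"
      then have "y \<in> Sm \<union> Bi" using Lo_nbrs[of x] x A_Lo parts by blast
      moreover have "x \<in> nbrs E y" using y nbrs_sym by (metis DiffD1)
      ultimately show "y \<in> nbrs E x \<inter> Z" using y x unfolding Z_def by blast
    next
      fix y assume "y \<in> nbrs E x \<inter> Z"
      then show "y \<in> nbrs E x - Uv" using parts unfolding Z_def by blast
    qed
    then show ?thesis unfolding out_deg_def by simp
  qed
  have "real (card A) = (\<Sum>x\<in>A. g x + r Z x)"
  proof -
    have "(\<Sum>x\<in>A. g x + r Z x) = (\<Sum>x\<in>A. 1)"
    proof (rule sum.cong[OF refl])
      fix x assume x: "x \<in> A"
      then have "x \<in> V" using A_Lo parts by blast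
      then show "g x + r Z x = 1" using one[of x] AZ[OF x] unfolding r_def by metis
    qed
    then show ?thesis by simp
  qed
  then have cA: "real (card A) = sum g A + sum (inv A) Z"
    using dc[OF fin_sets(1,2)] by (simp add: sum.distrib)
  have outQ: "out_deg y = card (nbrs E y \<inter> Q') + card (nbrs E y \<inter> (Z \<inter> Sm)) + card (nbrs E y \<inter> Bi) + card (nbrs E y \<inter> (Lo - A))"
    if y: "y \<in> Q'" for y
  proof -
    have nA: "nbrs E y \<inter> A = {}" using y unfolding Q'_def Z_def by blast
    let ?n = "nbrs E y"
    have fn: "finite ?n" using finite_nbrs[OF graph] .
    have "?n - Uv = (((?n \<inter> Q') \<union> (?n \<inter> (Z \<inter> Sm))) \<union> (?n \<inter> Bi)) \<union> (?n \<inter> (Lo - A))"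
      using nbrs_V[of y] nA parts A_Lo unfolding Q'_def by blast
    moreover have "(?n \<inter> Q') \<inter> (?n \<inter> (Z \<inter> Sm)) = {}" "((?n \<inter> Q') \<union> (?n \<inter> (Z \<inter> Sm))) \<inter> (?n \<inter> Bi) = {}"
      "(((?n \<inter> Q') \<union> (?n \<inter> (Z \<inter> Sm))) \<union> (?n \<inter> Bi)) \<inter> (?n \<inter> (Lo - A)) = {}"
      using parts part_subs unfolding Q'_def by blast+
    ultimately show ?thesis unfolding out_deg_def using fn by (simp add: card_Un_disjoint)
  qed
  have SmV: "y \<in> V" if "y \<in> Sm" for y using that part_subs parts by blast
  have "real (card Sm) = (\<Sum>y\<in>Sm. g y + real (out_deg y) * h y)"
  proof -
    have "(\<Sum>y\<in>Sm. g y + real (out_deg y) * h y) = (\<Sum>y\<in>Sm. 1)"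
      by (rule sum.cong[OF refl]) (rule one[OF SmV])
    then show ?thesis by simp
  qed
  also have "\<dots> = sum g Sm + (\<Sum>y\<in>Sm. real (out_deg y) * h y)" by (simp add: sum.distrib)
  also have "(\<Sum>y\<in>Sm. real (out_deg y) * h y) = (\<Sum>y\<in>Z \<inter> Sm. real (out_deg y) * h y) + (\<Sum>y\<in>Q'. real (out_deg y) * h y)"
  proof -
    have eq: "(Z \<inter> Sm) \<union> Q' = Sm" and dj: "(Z \<inter> Sm) \<inter> Q' = {}" unfolding Q'_def by blast+
    show ?thesis using sum.union_disjoint[OF ZQ(1) fin_sets(3) dj, of "\<lambda>y. real (out_deg y) * h y"] unfolding eq .
  qed
  also have "(\<Sum>y\<in>Q'. real (out_deg y) * h y) = (\<Sum>y\<in>Q'. r Q' y + r (Z \<inter> Sm) y + r Bi y + r (Lo - A) y)"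
    by (rule sum.cong[OF refl]) (use outQ in \<open>simp add: r_def distrib_right\<close>)
  also have "\<dots> = sum (r Q') Q' + sum (inv Q') (Z \<inter> Sm) + sum (inv Q') Bi + sum (inv Q') (Lo - A)"
    using dc[OF fin_sets(3) ZQ(1)] dc[OF fin_sets(3) fin_parts(4)] dc[OF fin_sets(3), of "Lo - A"] fin_parts(1)
    by (simp add: sum.distrib)
  finally have cS: "real (card Sm) = sum g Sm + (\<Sum>y\<in>Z \<inter> Sm. real (out_deg y) * h y)
    + sum (r Q') Q' + sum (inv Q') (Z \<inter> Sm) + sum (inv Q') Bi + sum (inv Q') (Lo - A)" by simp
  have split_Z: "sum f Z = sum f (Z \<inter> Sm) + sum f (Z \<inter> Bi)" for f :: "'a \<Rightarrow> real"
  proof -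
    have eq: "(Z \<inter> Sm) \<union> (Z \<inter> Bi) = Z" and dj: "(Z \<inter> Sm) \<inter> (Z \<inter> Bi) = {}"
      using parts(6) unfolding Z_def by blast+
    show ?thesis using sum.union_disjoint[OF ZQ dj, of f] unfolding eq .
  qed
  have split_Bi: "sum f Bi = sum f (Z \<inter> Bi) + sum f W'" for f :: "'a \<Rightarrow> real"
  proof -
    have eq: "(Z \<inter> Bi) \<union> W' = Bi" and dj: "(Z \<inter> Bi) \<inter> W' = {}" unfolding W'_def by blast+
    show ?thesis using sum.union_disjoint[OF ZQ(2) fin_sets(4) dj, of f] unfolding eq .
  qed
  have split_V: "sum g (V - Uv) = sum g A + sum g (Lo - A) + sum g Sm + sum g Bi"
  proof -
    have eq: "(Lo \<union> Sm) \<union> Bi = V - Uv" using parts(1,2,4,5) part_subs(4) by auto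
    have "sum g ((Lo \<union> Sm) \<union> Bi) = sum g (Lo \<union> Sm) + sum g Bi"
      by (rule sum.union_disjoint) (use fin_parts part_subs(5) parts(6) in auto)
    moreover have "sum g (Lo \<union> Sm) = sum g Lo + sum g Sm"
      by (rule sum.union_disjoint) (use fin_parts part_subs(6) in auto)
    moreover have "sum g Lo = sum g (Lo - A) + sum g A" by (rule sum.subset_diff[OF A_Lo fin_parts(1)])
    ultimately show ?thesis unfolding eq by linarith
  qed
  have a: "sum (inv A) (Z \<inter> Sm) + (\<Sum>y\<in>Z \<inter> Sm. real (out_deg y) * h y) + sum (inv Q') (Z \<inter> Sm) \<le> real (card (Z \<inter> Sm))"
  proof -
    have "(\<Sum>y\<in>Z \<inter> Sm. inv A y + real (out_deg y) * h y + inv Q' y) \<le> (\<Sum>y\<in>Z \<inter> Sm. 1)"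
      by (rule sum_mono) (unfold inv_def h_def, use count_ZQ in simp)
    then show ?thesis by (simp add: sum.distrib)
  qed
  have b: "sum (inv Q') (Lo - A) \<le> sum g (Lo - A)"
    by (rule sum_mono) (unfold inv_def h_def g_def, rule count_Lo)
  have c: "2 * sum (inv A) (Z \<inter> Bi) + 2 * sum (inv Q') (Z \<inter> Bi) - 2 * sum g (Z \<inter> Bi) \<le> real (card (Z \<inter> Bi))"
  proof -
    have "(\<Sum>w\<in>Z \<inter> Bi. 2 * inv A w + 2 * inv Q' w - 2 * g w) \<le> (\<Sum>w\<in>Z \<inter> Bi. 1)"
      by (rule sum_mono) (unfold inv_def h_def g_def, rule count_ZW)
    then show ?thesis by (simp add: sum.distrib sum_subtractf sum_distrib_left)
  qed
  have d: "sum (inv Q') W' - sum g W' \<le> (\<Sum>w\<in>W'. real (card (nbrs E w \<inter> Q')) / real k)"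
  proof -
    have "(\<Sum>w\<in>W'. inv Q' w - g w) \<le> (\<Sum>w\<in>W'. real (card (nbrs E w \<inter> Q')) / real k)"
      by (rule sum_mono) (unfold inv_def h_def g_def, rule count_W)
    then show ?thesis by (simp add: sum_subtractf)
  qed
  have G: "sum (r Q') Q' = (\<Sum>x\<in>Q'. real (card (nbrs E x \<inter> Q')) / real (degree E x))"
    unfolding r_def h_def by simp
  define S1 where "S1 = sum (inv A) (Z \<inter> Sm)"
  define S2 where "S2 = sum (inv A) (Z \<inter> Bi)"
  define S3 where "S3 = (\<Sum>y\<in>Z \<inter> Sm. real (out_deg y) * h y)"
  define S4 where "S4 = sum (inv Q') (Z \<inter> Sm)"
  define S5 where "S5 = sum (inv Q') (Z \<inter> Bi)"
  define S6 where "S6 = sum (inv Q') W'"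
  define S7 where "S7 = sum (inv Q') (Lo - A)"
  define S8 where "S8 = (\<Sum>w\<in>W'. real (card (nbrs E w \<inter> Q')) / real k)"
  have e1: "real (card A) = sum g A + (S1 + S2)" unfolding S1_def S2_def using cA split_Z[of "inv A"] by simp
  have e2: "real (card Sm) = sum g Sm + S3 + sum (r Q') Q' + S4 + (S5 + S6) + S7"
    unfolding S3_def S4_def S5_def S6_def S7_def using cS split_Bi[of "inv Q'"] by simp
  have e3: "sum g (V - Uv) = sum g A + sum g (Lo - A) + sum g Sm + (sum g (Z \<inter> Bi) + sum g W')"
    using split_V split_Bi[of g] by simp
  have e4: "S1 + S3 + S4 \<le> real (card (Z \<inter> Sm))" unfolding S1_def S3_def S4_def by (rule a)
  have e5: "S7 \<le> sum g (Lo - A)" unfolding S7_def by (rule b)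
  have e6: "2 * S2 + 2 * S5 - 2 * sum g (Z \<inter> Bi) \<le> real (card (Z \<inter> Bi))" unfolding S2_def S5_def by (rule c)
  have e7: "S6 - sum g W' \<le> S8" unfolding S6_def S8_def by (rule d)
  have "2 * real (card Sm) + 2 * real (card A) \<le> 2 * sum g (V - Uv) + 2 * sum (r Q') Q' + 2 * S8
    + 2 * real (card (Z \<inter> Sm)) + real (card (Z \<inter> Bi))"
    using e1 e2 e3 e4 e5 e6 e7 by linarith
  then show ?thesis unfolding G S8_def g_def .
qed

end

section \<open>Counting the path ends left by cherries and forest edges\<close>

section \<open>From linear forests to Hamilton cycles\<close>

context dense_critical
begin

lemma un_deg_le_Uv: "un_deg v \<le> card Uv"
  unfolding un_deg_def using fin_parts by (intro card_mono) auto

text \<open>Any neighbour of \<open>x\<close> has at least k + 1 - d(x) neighbours in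
  \<open>Uv\<close>; a vertex of small degree thus makes \<open>Uv\<close> large.\<close>

lemma Uv_lower:
  assumes "x \<in> V"
  shows "k + 1 \<le> degree E x + card Uv"
proof -
  have "nbrs E x \<noteq> {}" using degree_pos[OF assms] degree_nbrs[OF graph, of x] by auto
  then obtain y where "y \<in> nbrs E x" by blast
  then have "x \<in> nbrs E y" using nbrs_sym by metis
  then show ?thesis using un_deg_ge[of x y] un_deg_le_Uv[of y] by linarith
qed

lemma degree_outside: "v \<notin> V \<Longrightarrow> degree E v = 0"
proof -
  assume v: "v \<notin> V"
  have "nbrs E v = {}"
  proof (rule ccontr)
    assume "nbrs E v \<noteq> {}"
    then obtain w where "w \<in> nbrs E v" by blast
    then have "v \<in> nbrs E w" using nbrs_sym by metis
    then show False using nbrs_V v by blast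
  qed
  then show ?thesis using degree_nbrs[OF graph] by simp
qed

lemma V_large: "card V \<ge> 3" "Uv \<noteq> {}"
proof -
  have "E \<noteq> {}" using not_colorable unfolding colorable_def proper_edge_coloring_def by auto
  then obtain e where e: "e \<in> E" by blast
  obtain x y where xy: "e = {x, y}" using graph e unfolding fin_graph_def by (metis card_2_iff)
  have xV: "x \<in> V" using e xy simple unfolding simple_graph_def by blast
  have d: "degree E v \<le> card V" for v
    using degree_nbrs[OF graph, of v] card_mono[OF finV nbrs_V[of v]] by simp
  show "card V \<ge> 3" using edge_degree_sum[of x y] e xy d[of x] d[of y] dense by simp
  have "card Uv > 0" using Uv_lower[OF xV] degree_le[of x] by linarith
  then show "Uv \<noteq> {}" by auto
qed

end

context cherries
begin

definition cherry :: "'a set set" where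
  "cherry = {{x, y} | x y. asg y = Some x}"

lemma cherryE:
  assumes "e \<in> cherry"
  obtains x y where "e = {x, y}" "asg y = Some x" "x \<in> Lo" "y \<in> Hi"
proof -
  from assms obtain x y where xy: "e = {x, y}" "asg y = Some x" unfolding cherry_def by blast
  have "x \<in> Lo" "y \<in> nbrs E x" using asg[OF xy(2)] by simp_all
  then show ?thesis using that[OF xy] Lo_nbrs by blast
qed

lemma cherry_sub: "cherry \<subseteq> E"
proof
  fix e assume "e \<in> cherry"
  then obtain x y where "e = {x, y}" "asg y = Some x" unfolding cherry_def by blast
  then show "e \<in> E" using asg unfolding nbrs_def by simp
qed

lemma cherry_graph: "fin_graph cherry" "finite cherry"
  using fin_graph_subset[OF graph cherry_sub] unfolding fin_graph_def by simp_all

lemma Lo_not_Hi: "x \<in> Lo \<Longrightarrow> x \<notin> Hi"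
  using parts(3) by blast

lemma cherry_mem: "{y, x} \<in> cherry \<longleftrightarrow> asg y = Some x \<or> asg x = Some y"
  unfolding cherry_def by (auto simp: doubleton_eq_iff)

lemma degree_cherry_Hi:
  assumes y: "y \<in> Hi"
  shows "degree cherry y = of_bool (asg y \<noteq> None)"
proof -
  have "nbrs cherry y = {x. asg y = Some x}"
    unfolding nbrs_def cherry_mem using asg[of _ y] y Lo_not_Hi by blast
  also have "\<dots> = set_option (asg y)" by auto
  finally show ?thesis using degree_nbrs[OF cherry_graph(1), of y] by (cases "asg y") simp_all
qed

lemma degree_cherry_Lo:
  assumes x: "x \<in> Lo"
  shows "degree cherry x = 2"
proof -
  have "asg x \<noteq> Some y" for y using asg[of x y] Lo_nbrs[of y] x Lo_not_Hi by blast
  then have "nbrs cherry x = owned asg x"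
    unfolding nbrs_def cherry_mem owned_def by simp
  then show ?thesis using degree_nbrs[OF cherry_graph(1), of x] owned2[OF x] by simp
qed

text \<open>The 2|A| private neighbours of \<open>A\<close> are exactly \<open>Z\<close> and the
  assigned vertices of \<open>Uv\<close>, because low vertices outside \<open>A\<close> own nothing
  in \<open>Uv\<close>.\<close>

lemma covered_count: "card {y\<in>Uv. asg y \<noteq> None} + card Z = 2 * card A"
proof -
  have fo: "finite (owned asg x)" if "x \<in> A" for x using owned2[of x] that A_Lo by (metis card.infinite subsetD zero_neq_numeral)
  have "(\<Union>x\<in>A. owned asg x) = {y\<in>Uv. asg y \<noteq> None} \<union> Z"
  proof (intro equalityI subsetI)
    fix y assume "y \<in> (\<Union>x\<in>A. owned asg x)"
    then obtain x where x: "x \<in> A" "asg y = Some x" unfolding owned_def by blast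
    then have xy: "x \<in> Lo" "y \<in> nbrs E x" using asg by simp_all
    then have "y \<in> Hi" using Lo_nbrs by blast
    then have "y \<in> Uv \<or> y \<in> Sm \<union> Bi" using parts(2) by blast
    then show "y \<in> {y\<in>Uv. asg y \<noteq> None} \<union> Z"
    proof
      assume "y \<in> Sm \<union> Bi"
      moreover have "x \<in> nbrs E y" using xy(2) nbrs_sym by metis
      ultimately show ?thesis using x(1) unfolding Z_def by blast
    qed (use x(2) in simp)
  next
    fix y assume "y \<in> {y\<in>Uv. asg y \<noteq> None} \<union> Z"
    then show "y \<in> (\<Union>x\<in>A. owned asg x)"
    proof
      assume y: "y \<in> {y\<in>Uv. asg y \<noteq> None}"
      then obtain x where x: "asg y = Some x" by auto
      have "x \<in> A"
      proof (rule ccontr)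
        assume "x \<notin> A"
        then have "y \<in> Sm \<union> Bi" using A_rest[of x] asg[OF x] x unfolding owned_def by blast
        then show False using y parts(4,5) by blast
      qed
      then show ?thesis using x unfolding owned_def by blast
    next
      assume y: "y \<in> Z"
      then obtain x where x: "x \<in> nbrs E y" "x \<in> A" unfolding Z_def by blast
      have "y \<in> nbrs E x" using x(1) nbrs_sym by metis
      moreover have "y \<in> Sm \<union> Bi" using y unfolding Z_def by blast
      ultimately obtain x' where "x' \<in> A" "asg y = Some x'" using A_closed[OF x(2)] by blast
      then show ?thesis unfolding owned_def by blast
    qed
  qed
  moreover have "card (\<Union>x\<in>A. owned asg x) = (\<Sum>x\<in>A. card (owned asg x))"
    by (rule card_UN_disjoint) (use fin_sets fo in \<open>auto simp: owned_def\<close>)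
  moreover have "(\<Sum>x\<in>A. card (owned asg x)) = (\<Sum>x\<in>A. 2)"
    by (rule sum.cong[OF refl]) (use owned2 A_Lo in blast)
  moreover have "card ({y\<in>Uv. asg y \<noteq> None} \<union> Z) = card {y\<in>Uv. asg y \<noteq> None} + card Z"
    by (rule card_Un_disjoint) (use fin_parts fin_sets parts(4,5) in \<open>auto simp: Z_def\<close>)
  ultimately show ?thesis by simp
qed

lemma Z_covered: "y \<in> Z \<Longrightarrow> asg y \<noteq> None"
proof -
  assume y: "y \<in> Z"
  then obtain x where x: "x \<in> nbrs E y" "x \<in> A" unfolding Z_def by blast
  have "y \<in> nbrs E x" using x(1) nbrs_sym by metis
  moreover have "y \<in> Sm \<union> Bi" using y unfolding Z_def by blast
  ultimately show "asg y \<noteq> None" using A_closed[OF x(2)] by auto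
qed

text \<open>Cherries give every low vertex degree 2 in the forest, so no path ends there. By
  \<open>covered_count\<close>, \<open>ineq\<close> says precisely that fewer ends remain in
  \<open>Sm\<close> than in \<open>Uv\<close>.\<close>

lemma finish:
  assumes FE: "F \<subseteq> E" and shape: "\<And>e. e \<in> F \<Longrightarrow> e \<subseteq> Q' \<or> (\<exists>x\<in>Q'. \<exists>w\<in>W'. e = {x, w})"
    and deg: "\<And>v. degree (cherry \<union> F) v \<le> 2"
    and R: "R \<subseteq> F" "acyclic_edges (cherry \<union> F - R)"
    and ineq: "2 * real (card Sm) + 2 * real (card A) - 2 * real (card (Z \<inter> Sm)) - real (card (Z \<inter> Bi))
      - real (card {y\<in>Q'. asg y \<noteq> None}) - real (\<Sum>e\<in>F - R. card (e \<inter> Sm)) < 2 * real (card Uv)"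
  shows "hamiltonian V E'"
proof -
  have QW: "Q' \<subseteq> Hi" "W' \<subseteq> Hi" "Q' \<inter> Uv = {}" "W' \<inter> Uv = {}" using part_subs parts(4,5) unfolding Q'_def W'_def by blast+
  have FHi: "e \<subseteq> Q' \<union> W'" if "e \<in> F" for e using shape[OF that] by blast
  have dj: "cherry \<inter> F = {}"
  proof (rule ccontr)
    assume "cherry \<inter> F \<noteq> {}"
    then obtain e where e: "e \<in> cherry" "e \<in> F" by blast
    obtain x y where "e = {x, y}" "x \<in> Lo" using cherryE[OF e(1)] by metis
    then have "x \<in> Hi" using FHi[OF e(2)] QW by blast
    then show False using \<open>x \<in> Lo\<close> Lo_not_Hi by blast
  qed
  have finE: "finite E" using graph unfolding fin_graph_def by simp
  have finF: "finite F" using FE finE finite_subset by blast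
  define G where "G = F - R"
  have finG: "finite G" unfolding G_def using finF by simp
  have eqF: "cherry \<union> F - R = cherry \<union> G" unfolding G_def using dj R(1) by blast
  have djG: "cherry \<inter> G = {}" unfolding G_def using dj by blast
  have dsum: "degree (cherry \<union> G) v = degree cherry v + degree G v" for v
    by (rule degree_union_disjoint[OF cherry_graph(2) finG djG])
  have dle: "degree (cherry \<union> G) v \<le> 2" for v
  proof -
    have "degree (cherry \<union> G) v \<le> degree (cherry \<union> F) v"
      by (rule degree_mono) (use cherry_graph finF in \<open>auto simp: G_def\<close>)
    then show ?thesis using deg[of v] by simp
  qed
  have G0: "degree G v = 0" if "v \<notin> Q' \<union> W'" for v
  proof -
    have "{e\<in>G. v \<in> e} = {}" using FHi that unfolding G_def by blast
    then show ?thesis unfolding degree_def by (metis card.empty)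
  qed
  have GE: "cherry \<union> G \<subseteq> E" using cherry_sub FE unfolding G_def by blast
  have "\<exists>P. path_system E' V P \<and> (\<forall>v\<in>V. ends {v} P + degree (cherry \<union> G) v = 2) \<and> (\<forall>e\<in>cherry \<union> G. \<exists>p\<in>P. e \<subseteq> set p)"
  proof (rule linear_forest_path_system)
    show "finite (cherry \<union> G)" using cherry_graph finG by simp
    show "finite V" by (rule finV)
    show "cherry \<union> G \<subseteq> E'" using GE sub by blast
    show "card e = 2 \<and> e \<subseteq> V" if "e \<in> cherry \<union> G" for e using that GE simple unfolding simple_graph_def by blast
    show "acyclic_edges (cherry \<union> G)" using R(2) unfolding eqF .
    show "degree (cherry \<union> G) v \<le> 2" for v by (rule dle)
  qed
  then obtain P where P: "path_system E' V P" "\<And>v. v \<in> V \<Longrightarrow> ends {v} P + degree (cherry \<union> G) v = 2" by blast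
  have sumX: "ends X P + (\<Sum>v\<in>X. degree (cherry \<union> G) v) = 2 * card X" if "X \<subseteq> V" for X
  proof -
    have fX: "finite X" using that finV finite_subset by blast
    have "ends X P + (\<Sum>v\<in>X. degree (cherry \<union> G) v) = (\<Sum>v\<in>X. ends {v} P + degree (cherry \<union> G) v)"
      using ends_sum[OF fX, of P] by (simp add: sum.distrib)
    also have "\<dots> = (\<Sum>v\<in>X. 2)" by (rule sum.cong[OF refl]) (use P(2) that in blast)
    finally show ?thesis by simp
  qed
  have dHi: "(\<Sum>v\<in>X. degree cherry v) = card {y\<in>X. asg y \<noteq> None}" if "X \<subseteq> Hi" for X
  proof -
    have fX: "finite X" using that fin_parts finite_subset by blast
    have "(\<Sum>v\<in>X. degree cherry v) = (\<Sum>v\<in>X. of_bool (asg v \<noteq> None))"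
      by (rule sum.cong[OF refl]) (use degree_cherry_Hi that in blast)
    also have "\<dots> = card {y\<in>X. asg y \<noteq> None}" using fX by (simp add: Int_def)
    finally show ?thesis .
  qed
  have LoV: "Lo \<subseteq> V" "Sm \<subseteq> V" "Uv \<subseteq> V" using parts part_subs by blast+
  have eLo: "ends Lo P = 0"
  proof -
    have "(\<Sum>v\<in>Lo. degree (cherry \<union> G) v) = (\<Sum>v\<in>Lo. 2)"
    proof (rule sum.cong[OF refl])
      fix v assume v: "v \<in> Lo"
      then have "v \<notin> Q' \<union> W'" using QW Lo_not_Hi by blast
      then show "degree (cherry \<union> G) v = 2" using dsum G0 degree_cherry_Lo[OF v] by simp
    qed
    then show ?thesis using sumX[OF LoV(1)] by simp
  qed
  have eSm: "ends Sm P + (card {y\<in>Sm. asg y \<noteq> None} + (\<Sum>e\<in>G. card (e \<inter> Sm))) = 2 * card Sm"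
  proof -
    have "(\<Sum>v\<in>Sm. degree (cherry \<union> G) v) = (\<Sum>v\<in>Sm. degree cherry v) + (\<Sum>v\<in>Sm. degree G v)"
      using dsum by (simp add: sum.distrib)
    also have "\<dots> = card {y\<in>Sm. asg y \<noteq> None} + (\<Sum>e\<in>G. card (e \<inter> Sm))"
      using dHi[OF part_subs(3)] degree_sum_inter[OF finG fin_parts(5)] by simp
    finally show ?thesis using sumX[OF LoV(2)] by simp
  qed
  have eUv: "ends Uv P + card {y\<in>Uv. asg y \<noteq> None} = 2 * card Uv"
  proof -
    have "(\<Sum>v\<in>Uv. degree (cherry \<union> G) v) = (\<Sum>v\<in>Uv. degree cherry v)"
    proof (rule sum.cong[OF refl])
      fix v assume "v \<in> Uv"
      then have "v \<notin> Q' \<union> W'" using QW by blast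
      then show "degree (cherry \<union> G) v = degree cherry v" using dsum G0 by simp
    qed
    then show ?thesis using sumX[OF LoV(3)] dHi[OF part_subs(1)] by simp
  qed
  have cSm: "card {y\<in>Sm. asg y \<noteq> None} = card (Z \<inter> Sm) + card {y\<in>Q'. asg y \<noteq> None}"
  proof -
    have "{y\<in>Sm. asg y \<noteq> None} = (Z \<inter> Sm) \<union> {y\<in>Q'. asg y \<noteq> None}" using Z_covered unfolding Q'_def by blast
    moreover have "card ((Z \<inter> Sm) \<union> {y\<in>Q'. asg y \<noteq> None}) = card (Z \<inter> Sm) + card {y\<in>Q'. asg y \<noteq> None}"
      by (rule card_Un_disjoint) (use fin_sets in \<open>auto simp: Q'_def\<close>)
    ultimately show ?thesis by simp
  qed
  have cZ: "card Z = card (Z \<inter> Sm) + card (Z \<inter> Bi)"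
  proof -
    have "Z = (Z \<inter> Sm) \<union> (Z \<inter> Bi)" unfolding Z_def by blast
    moreover have "card ((Z \<inter> Sm) \<union> (Z \<inter> Bi)) = card (Z \<inter> Sm) + card (Z \<inter> Bi)"
      by (rule card_Un_disjoint) (use fin_sets parts(6) in auto)
    ultimately show ?thesis by simp
  qed
  have "real (ends Sm P) < real (ends Uv P)"
  proof -
    have 1: "real (ends Sm P) + (real (card (Z \<inter> Sm)) + real (card {y\<in>Q'. asg y \<noteq> None}) + real (\<Sum>e\<in>G. card (e \<inter> Sm))) = 2 * real (card Sm)"
      using arg_cong[OF eSm, of real] cSm by simp
    have 2: "real (ends Uv P) + real (card {y\<in>Uv. asg y \<noteq> None}) = 2 * real (card Uv)"
      using arg_cong[OF eUv, of real] by simp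
    have 3: "real (card {y\<in>Uv. asg y \<noteq> None}) + (real (card (Z \<inter> Sm)) + real (card (Z \<inter> Bi))) = 2 * real (card A)"
      using arg_cong[OF covered_count, of real] cZ by simp
    show ?thesis using 1 2 3 ineq unfolding G_def by linarith
  qed
  then have few: "ends Sm P < ends Uv P" by simp
  show ?thesis
  proof (rule hamiltonian_from_path_system[OF P(1) finV V_large(1) simple', of "Uv \<union> Bi" Uv Sm])
    show "adj E' u v" if "u \<in> Uv \<union> Bi" "v \<in> Uv \<union> Bi" "u \<noteq> v" for u v using clique[OF that] .
    show "adj E' u v" if "u \<in> Uv" "v \<in> Sm" for u v
    proof (rule Uv_adj[OF that(1)])
      show "v \<in> Hi" using that(2) part_subs by blast
      show "u \<noteq> v" using that parts(5) by blast
    qed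
    show "Uv \<subseteq> Uv \<union> Bi" by blast
    show "Sm \<inter> (Uv \<union> Bi) = {}" using parts(5,6) by blast
    show "ends (- (Sm \<union> (Uv \<union> Bi))) P = 0"
    proof -
      have "path_ends (- (Sm \<union> (Uv \<union> Bi))) p = path_ends Lo p" if p: "p \<in> P" for p
      proof -
        have "p \<noteq> []" "set p \<subseteq> V" using P(1) p unfolding path_system_def by blast+
        then have V: "hd p \<in> V" "last p \<in> V" using hd_in_set last_in_set by blast+
        have "v \<in> - (Sm \<union> (Uv \<union> Bi)) \<longleftrightarrow> v \<in> Lo" if "v \<in> V" for v
          using that parts(1,2) part_subs(4,5,6) by blast
        then have "hd p \<in> - (Sm \<union> (Uv \<union> Bi)) \<longleftrightarrow> hd p \<in> Lo" "last p \<in> - (Sm \<union> (Uv \<union> Bi)) \<longleftrightarrow> last p \<in> Lo"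
          using V by simp_all
        then show ?thesis unfolding path_ends_def by (simp only:)
      qed
      then have "(\<Sum>p\<in>P. path_ends (- (Sm \<union> (Uv \<union> Bi))) p) = (\<Sum>p\<in>P. path_ends Lo p)"
        by (intro sum.cong refl)
      then have "ends (- (Sm \<union> (Uv \<union> Bi))) P = ends Lo P" unfolding ends_def .
      then show ?thesis using eLo by simp
    qed
    show "ends Sm P = 0 \<or> ends Sm P < ends Uv P" using few by simp
  qed
qed

end

context dense_critical
begin

text \<open>The adjacency lemma provides a vertex of degree \<open>k\<close>, so n \<ge> k + 1, and
  \<open>dense\<close> becomes 2(k + 1) + 36 \<le> 3k.\<close>

lemma k_ge: "k \<ge> 38"
proof -
  obtain u where u: "u \<in> Uv" using V_large(2) by blast
  have uV: "u \<in> V" using u parts(8) part_subs(1) by blast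
  have "nbrs E u \<noteq> {}" using degree_pos[OF uV] degree_nbrs[OF graph, of u] by auto
  then obtain y where "y \<in> nbrs E u" by blast
  then have "{u, y} \<in> E" unfolding nbrs_def by simp
  then have "k + 1 \<le> degree E u + card {v \<in> nbrs E y. v \<noteq> u \<and> degree E v = k}" by (rule vizing_adjacency)
  then have "card {v \<in> nbrs E y. v \<noteq> u \<and> degree E v = k} \<noteq> 0" using degree_le[of u] by linarith
  then have "{v \<in> nbrs E y. v \<noteq> u \<and> degree E v = k} \<noteq> {}" by (metis card.empty)
  then obtain v where v: "v \<in> nbrs E y" "degree E v = k" by blast
  have vV: "v \<in> V" using v(1) nbrs_V by blast
  have "nbrs E v \<subseteq> V - {v}" using nbrs_V[of v] nbrs_irrefl[OF graph, of v] by blast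
  then have "card (nbrs E v) \<le> card (V - {v})" using finV by (intro card_mono) simp_all
  then have "k + 1 \<le> card V" using v(2) degree_nbrs[OF graph, of v] vV finV card_Diff_singleton[of v V] V_large(1) by simp
  then show ?thesis using dense by linarith
qed

end

section \<open>Choosing the forest, with and without low vertices\<close>

context cherries
begin

text \<open>The cardinality is the number of path ends in \<open>Sm\<close> that the edge removes,
  which is its value in \<open>finish\<close>.\<close>

lemma shape_weight:
  assumes g: "F \<subseteq> E" and shape: "\<And>e. e \<in> F \<Longrightarrow> e \<subseteq> Q' \<or> (\<exists>x\<in>Q'. \<exists>w\<in>W'. e = {x, w})" and e: "e \<in> F"
  shows "card (e \<inter> Sm) = (if e \<subseteq> Q' then 2 else 1)" "e \<inter> Sm \<subseteq> Q'"
proof -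
  have sub: "e \<inter> Sm \<subseteq> Q' \<and> card (e \<inter> Sm) = (if e \<subseteq> Q' then 2 else 1)"
  proof (cases "e \<subseteq> Q'")
    case True
    then have "e \<inter> Sm = e" unfolding Q'_def by blast
    moreover have "card e = 2" using graph g e unfolding fin_graph_def by blast
    ultimately show ?thesis using True by simp
  next
    case False
    then obtain x w where xw: "x \<in> Q'" "w \<in> W'" "e = {x, w}" using shape[OF e] by blast
    have "x \<in> Sm" "w \<notin> Sm" using xw parts(6) unfolding Q'_def W'_def by blast+
    then have "e \<inter> Sm = {x}" using xw(3) by blast
    then show ?thesis using False xw(1) by simp
  qed
  then show "card (e \<inter> Sm) = (if e \<subseteq> Q' then 2 else 1)" "e \<inter> Sm \<subseteq> Q'" by blast+
qed

lemma total_weight: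
  assumes g: "F \<subseteq> E" and shape: "\<And>e. e \<in> F \<Longrightarrow> e \<subseteq> Q' \<or> (\<exists>x\<in>Q'. \<exists>w\<in>W'. e = {x, w})"
  shows "real (\<Sum>e\<in>F. card (e \<inter> Sm)) = 2 * real (card {e\<in>F. e \<subseteq> Q'}) + real (card {e\<in>F. \<not> e \<subseteq> Q'})"
proof -
  have fin: "finite F" using g graph unfolding fin_graph_def by (meson finite_subset)
  have "(\<Sum>e\<in>F. card (e \<inter> Sm)) = (\<Sum>e\<in>F. if e \<subseteq> Q' then 2 else 1)"
    by (rule sum.cong[OF refl]) (rule shape_weight(1)[OF g shape])
  also have "\<dots> = 2 * card {e\<in>F. e \<subseteq> Q'} + card {e\<in>F. \<not> e \<subseteq> Q'}"
    using fin by (simp add: sum.If_cases Int_def)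
  finally show ?thesis by simp
qed

lemma Sm_nbrs_bound:
  assumes "x \<in> Q'"
  shows "card (nbrs E x \<inter> (Q' \<union> W')) \<le> out_deg x"
  by (rule out_deg_ge) (use parts(4,5) in \<open>auto simp: Q'_def W'_def\<close>)

text \<open>A neighbour in \<open>Q'\<close> has degree below n/2, so the adjacency lemma limits
  \<open>out_deg w\<close> to less than n/2 - 1; the constant is 36 + 6 after inserting
  \<open>dense\<close>.\<close>

lemma W_nbrs_bound:
  assumes t: "t = card (nbrs E w \<inter> Q')" "t > 0"
  shows "4 * t + 42 \<le> 3 * k" "t \<le> out_deg w"
proof -
  show to: "t \<le> out_deg w" unfolding t(1) by (rule out_deg_ge) (use disjoint_Uv in blast)
  have "nbrs E w \<inter> Q' \<noteq> {}" using t by auto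
  then obtain x where x: "x \<in> nbrs E w" "x \<in> Q'" by blast
  have "2 * degree E x < card V" using Sm_degree x(2) unfolding Q'_def by blast
  then show "4 * t + 42 \<le> 3 * k" using out_deg_le[OF x(1)] degree_le[of w] to dense by linarith
qed

text \<open>A termwise comparison. An edge inside \<open>Q'\<close> enters the left side with 2/d(x)
  + 2/d(y), at most a/C by \<open>dQ\<close>. At \<open>w\<close> only the edges within the
  truncation are available, and \<open>dW\<close> says that they still outweigh all neighbours in
  \<open>Q'\<close>.\<close>

lemma class_weight:
  fixes a b :: real and C :: nat
  assumes C: "C > 0" and ab: "a \<ge> 0" "b \<ge> 0"
    and build: "a * (\<Sum>x\<in>Q'. real (card (nbrs E x \<inter> Q'))) / 2
      + b * (\<Sum>w\<in>W'. real (min (card (nbrs E w \<inter> Q')) (\<kappa> w * (C - 1)))) \<le> real C * S"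
    and dQ: "\<And>x. x \<in> Q' \<Longrightarrow> 4 * real C \<le> a * real (degree E x)"
    and dW: "\<And>w. w \<in> W' \<Longrightarrow> 2 * real C * real (card (nbrs E w \<inter> Q'))
      \<le> b * real k * real (min (card (nbrs E w \<inter> Q')) (\<kappa> w * (C - 1)))"
  shows "2 * (\<Sum>x\<in>Q'. real (card (nbrs E x \<inter> Q')) / real (degree E x))
    + 2 * (\<Sum>w\<in>W'. real (card (nbrs E w \<inter> Q')) / real k) \<le> S"
proof -
  have kpos: "real k > 0" using dense by simp
  have "real C * (2 * (\<Sum>x\<in>Q'. real (card (nbrs E x \<inter> Q')) / real (degree E x)))
    = (\<Sum>x\<in>Q'. real C * 2 * (real (card (nbrs E x \<inter> Q')) / real (degree E x)))"
    by (simp add: sum_distrib_left mult.assoc)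
  also have "\<dots> \<le> (\<Sum>x\<in>Q'. a / 2 * real (card (nbrs E x \<inter> Q')))"
  proof (rule sum_mono)
    fix x assume x: "x \<in> Q'"
    then have "x \<in> V" using part_subs parts unfolding Q'_def by blast
    then have d: "real (degree E x) > 0" by (rule deg_pos)
    define r where "r = real (card (nbrs E x \<inter> Q'))"
    have r0: "r \<ge> 0" unfolding r_def by simp
    have "2 * real C \<le> a / 2 * real (degree E x)" using dQ[OF x] by linarith
    then have "2 * real C * r \<le> a / 2 * real (degree E x) * r" using r0 by (rule mult_right_mono)
    then have "2 * real C * r / real (degree E x) \<le> a / 2 * r" using d by (simp add: divide_le_eq mult.assoc mult.commute mult.left_commute)
    then show "real C * 2 * (real (card (nbrs E x \<inter> Q')) / real (degree E x)) \<le> a / 2 * real (card (nbrs E x \<inter> Q'))"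
      unfolding r_def[symmetric] by (simp add: mult.commute)
  qed
  finally have 1: "real C * (2 * (\<Sum>x\<in>Q'. real (card (nbrs E x \<inter> Q')) / real (degree E x)))
    \<le> a * (\<Sum>x\<in>Q'. real (card (nbrs E x \<inter> Q'))) / 2" by (simp add: sum_distrib_left sum_divide_distrib)
  have "real C * (2 * (\<Sum>w\<in>W'. real (card (nbrs E w \<inter> Q')) / real k))
    = (\<Sum>w\<in>W'. real C * 2 * (real (card (nbrs E w \<inter> Q')) / real k))"
    by (simp add: sum_distrib_left mult.assoc)
  also have "\<dots> \<le> (\<Sum>w\<in>W'. b * real (min (card (nbrs E w \<inter> Q')) (\<kappa> w * (C - 1))))"
  proof (rule sum_mono)
    fix w assume w: "w \<in> W'"
    define t where "t = real (card (nbrs E w \<inter> Q'))"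
    define s where "s = real (min (card (nbrs E w \<inter> Q')) (\<kappa> w * (C - 1)))"
    have "2 * real C * t \<le> b * real k * s" using dW[OF w] unfolding t_def s_def .
    then have "2 * real C * t / real k \<le> b * s" using kpos by (simp add: divide_le_eq mult.assoc mult.commute mult.left_commute)
    then show "real C * 2 * (real (card (nbrs E w \<inter> Q')) / real k) \<le> b * real (min (card (nbrs E w \<inter> Q')) (\<kappa> w * (C - 1)))"
      unfolding t_def[symmetric] s_def[symmetric] by (simp add: mult.commute)
  qed
  finally have 2: "real C * (2 * (\<Sum>w\<in>W'. real (card (nbrs E w \<inter> Q')) / real k))
    \<le> b * (\<Sum>w\<in>W'. real (min (card (nbrs E w \<inter> Q')) (\<kappa> w * (C - 1))))" by (simp add: sum_distrib_left)
  define p where "p = 2 * (\<Sum>x\<in>Q'. real (card (nbrs E x \<inter> Q')) / real (degree E x))"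
  define q where "q = 2 * (\<Sum>w\<in>W'. real (card (nbrs E w \<inter> Q')) / real k)"
  have "real C * p + real C * q \<le> real C * S"
    using 1[folded p_def] 2[folded q_def] build by linarith
  then have "real C * (p + q) \<le> real C * S" by (simp only: distrib_left)
  then have "p + q \<le> S" using C by simp
  then show ?thesis unfolding p_def q_def .
qed

text \<open>The weights 2 and 1 are the full numbers of ends removed, so the class itself keeps no
  reserve. Breaking cycles is paid by the assigned vertices inside \<open>Q'\<close>, whose cherries
  do not enter \<open>count\<close>.\<close>

lemma hamiltonian_with_low:
  assumes Lo: "Lo \<noteq> {}"
  shows "hamiltonian V E'"
proof -
  obtain x0 where x0: "x0 \<in> Lo" using Lo by blast
  have "x0 \<in> V" using x0 parts(7) by blast
  then have u: "k + 3 \<le> 2 * card Uv" using Uv_lower[of x0] Lo_degree[OF x0] by linarith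
  \<comment> \<open>Non-low vertices have degree at least k/2 \<ge> 2C, so an edge inside
    \<open>Q'\<close> has to bring at most 4/(2C), its weight 2 divided by C.\<close>
  define C where "C = k div 4"
  have C: "4 * C \<le> k" "k < 4 * C + 4" "C \<ge> 9" unfolding C_def using k_ge by presburger+
  \<comment> \<open>A vertex with a low neighbour may carry a cherry, so it gets at most one more
    edge. The value 1 on all of \<open>Q'\<close> forces a cycle to pass from \<open>F\<close> to a
    cherry at each vertex of \<open>Q'\<close> on an edge of \<open>F\<close>.\<close>
  define \<kappa> where "\<kappa> v = (if v \<in> Q' \<or> nbrs E v \<inter> Lo \<noteq> {} then 1 else 2 :: nat)" for v
  have dQ: "card (nbrs E x \<inter> (Q' \<union> W')) \<le> \<kappa> x * (C - 1)" if x: "x \<in> Q'" for x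
  proof -
    have "2 * out_deg x + 2 * card Uv < card V" using Sm_out_deg x unfolding Q'_def by blast
    then have "out_deg x \<le> C - 1" using u C dense by linarith
    then show ?thesis using Sm_nbrs_bound[OF x] x unfolding \<kappa>_def by simp
  qed
  have QW: "Q' \<inter> W' = {}" using parts(6) unfolding Q'_def W'_def by blast
  have Cpos: "C > 0" using C by simp
  obtain F where F: "F \<subseteq> E" "\<And>e. e \<in> F \<Longrightarrow> e \<subseteq> Q' \<or> (\<exists>x\<in>Q'. \<exists>w\<in>W'. e = {x, w})"
    "\<And>v. degree F v \<le> \<kappa> v" "\<And>v. v \<notin> Q' \<union> W' \<Longrightarrow> degree F v = 0"
    "2 * (\<Sum>x\<in>Q'. real (card (nbrs E x \<inter> Q'))) / 2 +
      1 * (\<Sum>w\<in>W'. real (min (card (nbrs E w \<inter> Q')) (\<kappa> w * (C - 1))))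
      \<le> real C * (2 * real (card {e\<in>F. e \<subseteq> Q'}) + 1 * real (card {e\<in>F. \<not> e \<subseteq> Q'}))"
    by (rule build_matching[OF graph fin_sets(3,4) QW Cpos dQ, where a = 2 and b = 1]) (assumption, (rule that; assumption))
  have finF: "finite F" using F(1) graph unfolding fin_graph_def by (meson finite_subset)
  define S where "S = 2 * real (card {e\<in>F. e \<subseteq> Q'}) + 1 * real (card {e\<in>F. \<not> e \<subseteq> Q'})"
  have need: "2 * (\<Sum>x\<in>Q'. real (card (nbrs E x \<inter> Q')) / real (degree E x))
    + 2 * (\<Sum>w\<in>W'. real (card (nbrs E w \<inter> Q')) / real k) \<le> S"
  proof (rule class_weight[OF Cpos _ _ F(5)[folded S_def]])
    fix x assume x: "x \<in> Q'"
    then have "k \<le> 2 * degree E x" using Hi_degree part_subs unfolding Q'_def by blast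
    then have "4 * C \<le> 2 * degree E x" using C by linarith
    then show "4 * real C \<le> 2 * real (degree E x)" by linarith
  next
    fix w assume w: "w \<in> W'"
    define t where "t = card (nbrs E w \<inter> Q')"
    have wHi: "w \<in> Hi - Uv" using w part_subs parts(4) unfolding W'_def by blast
    have "2 * C * t \<le> k * min t (\<kappa> w * (C - 1))"
    proof (cases "t = 0 \<or> t \<le> \<kappa> w * (C - 1)")
      case True
      then have "min t (\<kappa> w * (C - 1)) = t" by auto
      moreover have "2 * C * t \<le> k * t" using C by (intro mult_le_mono1) linarith
      ultimately show ?thesis by simp
    next
      case False
      then have t0: "t > 0" and mn: "min t (\<kappa> w * (C - 1)) = \<kappa> w * (C - 1)" by auto
      note tb = W_nbrs_bound[OF t_def t0]
      show ?thesis
      proof (cases "nbrs E w \<inter> Lo = {}")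
        case True
        have "w \<notin> Q'" using w QW by blast
        then have k2: "\<kappa> w = 2" using True unfolding \<kappa>_def by simp
        have "C * (4 * t + 42) \<le> C * (3 * k)" using tb(1) by (rule mult_le_mono2)
        then have "4 * (C * t) + 42 * C \<le> 3 * (C * k)" by (simp add: distrib_left mult.left_commute)
        moreover have "9 * k \<le> C * k" using C by (intro mult_le_mono1)
        moreover have "k * (2 * (C - 1)) + 2 * k = 2 * (C * k)" using Cpos by (cases C) simp_all
        ultimately have "2 * (C * t) \<le> k * (2 * (C - 1))" by linarith
        then show ?thesis unfolding mn[unfolded k2] k2 by (simp only: mult.assoc)
      next
        case False
        then have k1: "\<kappa> w = 1" unfolding \<kappa>_def by simp
        obtain x where x: "x \<in> nbrs E w" "x \<in> Lo" using False by blast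
        have "2 * t + 44 \<le> k"
          using out_deg_le[OF x(1)] Lo_degree[OF x(2)] not_Uv_degree[OF wHi] u dense tb(2) by linarith
        then have "C * (2 * t + 44) \<le> C * k" by (rule mult_le_mono2)
        then have "2 * (C * t) + 44 * C \<le> C * k" by (simp add: distrib_left mult.left_commute)
        moreover have "k * (C - 1) + k = C * k" using Cpos by (cases C) simp_all
        ultimately have "2 * (C * t) \<le> k * (C - 1)" using C by linarith
        then show ?thesis unfolding mn[unfolded k1] k1 by (simp only: mult.assoc mult_1)
      qed
    qed
    then have "real (2 * C * t) \<le> real (k * min t (\<kappa> w * (C - 1)))" by (rule of_nat_mono)
    then show "2 * real C * real (card (nbrs E w \<inter> Q')) \<le> 1 * real k * real (min (card (nbrs E w \<inter> Q')) (\<kappa> w * (C - 1)))"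
      unfolding t_def[symmetric] by (simp only: of_nat_mult of_nat_numeral mult_1)
  qed simp_all
  have QHi: "Q' \<union> W' \<subseteq> Hi" using part_subs unfolding Q'_def W'_def by blast
  have dj: "cherry \<inter> F = {}"
  proof (rule ccontr)
    assume "cherry \<inter> F \<noteq> {}"
    then obtain e where e: "e \<in> cherry" "e \<in> F" by blast
    obtain x y where "e = {x, y}" "x \<in> Lo" using cherryE[OF e(1)] by metis
    moreover have "e \<subseteq> Q' \<union> W'" using F(2)[OF e(2)] by blast
    ultimately have "x \<in> Hi" using QHi by blast
    then show False using \<open>x \<in> Lo\<close> Lo_not_Hi by blast
  qed
  have dsum: "degree (cherry \<union> F) v = degree cherry v + degree F v" for v
    by (rule degree_union_disjoint[OF cherry_graph(2) finF dj])
  have deg: "degree (cherry \<union> F) v \<le> 2" for v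
  proof -
    consider "v \<in> Lo" | "v \<in> Hi" | "v \<notin> V" using parts(1) by blast
    then show ?thesis
    proof cases
      case 1
      then have "v \<notin> Q' \<union> W'" using QHi Lo_not_Hi by blast
      then show ?thesis using dsum degree_cherry_Lo[OF 1] F(4) by simp
    next
      case 2
      show ?thesis
      proof (cases "asg v")
        case None
        have "\<kappa> v \<le> 2" unfolding \<kappa>_def by simp
        then show ?thesis using dsum[of v] degree_cherry_Hi[OF 2] F(3)[of v] None by simp
      next
        case (Some x)
        then have "x \<in> nbrs E v \<inter> Lo" using asg[OF Some] nbrs_sym[of v E x] by blast
        then have "\<kappa> v = 1" unfolding \<kappa>_def by auto
        then show ?thesis using dsum[of v] degree_cherry_Hi[OF 2] F(3)[of v] Some by simp
      qed
    next
      case 3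
      have "degree (cherry \<union> F) v \<le> degree E v"
        by (rule degree_mono) (use graph cherry_sub F(1) in \<open>auto simp: fin_graph_def\<close>)
      then show ?thesis using degree_outside[OF 3] by simp
    qed
  qed
  \<comment> \<open>A removed edge is charged to the cherry edges that continue the cycle at its
    vertices in \<open>Sm\<close>; these are different, as the other vertex of a cherry edge is
    low.\<close>
  define \<omega> where "\<omega> e = (if e \<in> cherry \<and> e \<inter> Q' \<noteq> {} then 1 else 0 :: real)" for e
  have brk: "\<exists>e\<in>D \<inter> F. real (card (e \<inter> Sm)) \<le> sum \<omega> D" if D: "D \<subseteq> cherry \<union> F" "two_regular D" for D
  proof -
    have finD: "finite D" using D(1) cherry_graph finF finite_subset by blast
    have D2: "degree D v = 2" if "e \<in> D" "v \<in> e" for e v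
    proof -
      have "e \<in> {e\<in>D. v \<in> e}" using that by blast
      then have "degree D v \<noteq> 0" unfolding degree_def using finD by auto
      then show ?thesis using D(2) unfolding two_regular_def by metis
    qed
    have other: "\<exists>f\<in>D - X. v \<in> f" if e: "e \<in> D" "v \<in> e" and X: "finite X" "degree X v \<le> 1" for e v X
    proof (rule ccontr)
      assume "\<not> ?thesis"
      then have "{f\<in>D. v \<in> f} \<subseteq> {f\<in>X. v \<in> f}" by blast
      then have "degree D v \<le> degree X v" unfolding degree_def using X(1) by (intro card_mono) auto
      then show False using D2[OF e] X(2) by simp
    qed
    obtain e0 where e0: "e0 \<in> D" using D(2) unfolding two_regular_def by blast
    \<comment> \<open>Cherries alone contain no cycle, since a non-low vertex lies on at most one
      cherry edge.\<close>
    have "\<exists>e1\<in>D. e1 \<in> F"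
    proof (cases "e0 \<in> F")
      case True
      then show ?thesis using e0 by blast
    next
      case False
      then have "e0 \<in> cherry" using e0 D(1) by blast
      then obtain x y where y: "e0 = {x, y}" "y \<in> Hi" by (metis cherryE)
      have "degree cherry y \<le> 1" using degree_cherry_Hi[OF y(2)] by simp
      then obtain f where "f \<in> D - cherry" using other[OF e0 _ cherry_graph(2), of y] y(1) by blast
      then show ?thesis using D(1) by blast
    qed
    then obtain e1 where e1: "e1 \<in> D" "e1 \<in> F" by blast
    have inQ: "e1 \<inter> Sm \<subseteq> Q'" using shape_weight(2)[OF F(1,2) e1(2)] .
    have "\<forall>v\<in>e1 \<inter> Sm. \<exists>f. f \<in> D \<and> f \<in> cherry \<and> v \<in> f"
    proof
      fix v assume v: "v \<in> e1 \<inter> Sm"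
      then have "\<kappa> v = 1" using inQ unfolding \<kappa>_def by auto
      then have "degree F v \<le> 1" using F(3)[of v] by simp
      then obtain f where "f \<in> D - F" "v \<in> f" using other[OF e1(1) _ finF, of v] v by blast
      then show "\<exists>f. f \<in> D \<and> f \<in> cherry \<and> v \<in> f" using D(1) by blast
    qed
    then obtain f where f: "\<And>v. v \<in> e1 \<inter> Sm \<Longrightarrow> f v \<in> D \<and> f v \<in> cherry \<and> v \<in> f v" by metis
    have "inj_on f (e1 \<inter> Sm)"
    proof (rule inj_onI)
      fix v v' assume v: "v \<in> e1 \<inter> Sm" "v' \<in> e1 \<inter> Sm" "f v = f v'"
      have "v \<in> Hi" "v' \<in> Hi" using v(1,2) part_subs by blast+
      obtain x y where xy: "f v = {x, y}" "x \<in> Lo" by (metis cherryE f[OF v(1)])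
      have "v \<in> {x, y}" "v' \<in> {x, y}" using f[OF v(1)] f[OF v(2)] v(3) xy(1) by simp_all
      moreover have "v \<noteq> x" "v' \<noteq> x" using \<open>v \<in> Hi\<close> \<open>v' \<in> Hi\<close> xy(2) Lo_not_Hi by blast+
      ultimately show "v = v'" by blast
    qed
    then have "card (e1 \<inter> Sm) = card (f ` (e1 \<inter> Sm))" by (rule card_image[symmetric])
    also have "\<dots> \<le> card {e\<in>D. e \<in> cherry \<and> e \<inter> Q' \<noteq> {}}"
    proof (rule card_mono)
      show "finite {e\<in>D. e \<in> cherry \<and> e \<inter> Q' \<noteq> {}}" using finD by simp
      show "f ` (e1 \<inter> Sm) \<subseteq> {e\<in>D. e \<in> cherry \<and> e \<inter> Q' \<noteq> {}}"
      proof
        fix e assume "e \<in> f ` (e1 \<inter> Sm)"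
        then obtain v where v: "v \<in> e1 \<inter> Sm" "e = f v" by blast
        then have "v \<in> Q'" "e \<in> D" "e \<in> cherry" "v \<in> e" using f[OF v(1)] inQ by blast+
        then show "e \<in> {e\<in>D. e \<in> cherry \<and> e \<inter> Q' \<noteq> {}}" by blast
      qed
    qed
    finally have "real (card (e1 \<inter> Sm)) \<le> real (card {e\<in>D. e \<in> cherry \<and> e \<inter> Q' \<noteq> {}})" by simp
    also have "\<dots> = sum \<omega> D" unfolding \<omega>_def using finD by (simp add: sum.If_cases Int_def)
    finally show ?thesis using e1 by blast
  qed
  have finCF: "finite (cherry \<union> F)" using cherry_graph finF by simp
  have "\<exists>R\<subseteq>F. acyclic_edges (cherry \<union> F - R) \<and> (\<Sum>e\<in>R. real (card (e \<inter> Sm))) \<le> sum \<omega> (cherry \<union> F)"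
    by (rule break_cycles[OF finCF deg _ _ brk]) (simp_all add: \<omega>_def)
  then obtain R where R: "R \<subseteq> F" "acyclic_edges (cherry \<union> F - R)" "(\<Sum>e\<in>R. real (card (e \<inter> Sm))) \<le> sum \<omega> (cherry \<union> F)" by blast
  have "sum \<omega> (cherry \<union> F) \<le> real (card {y\<in>Q'. asg y \<noteq> None})"
  proof -
    have "sum \<omega> (cherry \<union> F) = real (card {e\<in>cherry \<union> F. e \<in> cherry \<and> e \<inter> Q' \<noteq> {}})"
      unfolding \<omega>_def using finCF by (simp add: sum.If_cases Int_def)
    moreover have "{e\<in>cherry \<union> F. e \<in> cherry \<and> e \<inter> Q' \<noteq> {}} \<subseteq> (\<lambda>y. {the (asg y), y}) ` {y\<in>Q'. asg y \<noteq> None}"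
    proof
      fix e assume e: "e \<in> {e\<in>cherry \<union> F. e \<in> cherry \<and> e \<inter> Q' \<noteq> {}}"
      then have "e \<in> cherry" by blast
      then obtain x y where xy: "e = {x, y}" "asg y = Some x" "x \<in> Lo" by (metis cherryE)
      have "x \<notin> Q'" using xy(3) QHi Lo_not_Hi by blast
      then have "y \<in> Q'" using e xy(1) by blast
      then show "e \<in> (\<lambda>y. {the (asg y), y}) ` {y\<in>Q'. asg y \<noteq> None}" using xy by (intro image_eqI[of _ _ y]) simp_all
    qed
    then have "card {e\<in>cherry \<union> F. e \<in> cherry \<and> e \<inter> Q' \<noteq> {}} \<le> card {y\<in>Q'. asg y \<noteq> None}"
      using surj_card_le[of "{y\<in>Q'. asg y \<noteq> None}"] fin_sets(3) by simp
    ultimately show ?thesis by simp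
  qed
  then have wR: "(\<Sum>e\<in>R. real (card (e \<inter> Sm))) \<le> real (card {y\<in>Q'. asg y \<noteq> None})" using R(3) by linarith
  have "real (\<Sum>e\<in>F. card (e \<inter> Sm)) = real (\<Sum>e\<in>F - R. card (e \<inter> Sm)) + (\<Sum>e\<in>R. real (card (e \<inter> Sm)))"
    using sum.subset_diff[OF R(1) finF, of "\<lambda>e. card (e \<inter> Sm)"] by simp
  moreover have "real (\<Sum>e\<in>F. card (e \<inter> Sm)) = S" unfolding S_def using total_weight[OF F(1,2)] by simp
  ultimately have "real (\<Sum>e\<in>F - R. card (e \<inter> Sm)) + real (card {y\<in>Q'. asg y \<noteq> None}) \<ge> S" using wR by linarith
  then show ?thesis
    using finish[OF F(1,2) deg R(1,2)] count need Uv_weight[OF V_large(2)] by linarith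
qed

text \<open>There are no private neighbours to pay for broken cycles, so the edge weights are
  divided as 2 = 4/3 + 2/3 and 1 = 3/4 + 1/4: the first parts serve the inequality, the second ones
  the cycles. In return vertices of \<open>Sm\<close> may be used twice, so fewer colours
  suffice.\<close>

lemma hamiltonian_without_low:
  assumes Lo: "Lo = {}"
  shows "hamiltonian V E'"
proof -
  have noasg: "asg y = None" for y using asg[of y] Lo by (cases "asg y") auto
  have cherry0: "cherry = {}" unfolding cherry_def using noasg by simp
  have A0: "A = {}" using A_Lo Lo by blast
  have Z0: "Z = {}" unfolding Z_def using A0 by blast
  have zero: "card A = 0" "card (Z \<inter> Sm) = 0" "card (Z \<inter> Bi) = 0" "card {y\<in>Q'. asg y \<noteq> None} = 0"
    using A0 Z0 noasg by simp_all
  have QS: "Q' = Sm" "W' = Bi" unfolding Q'_def W'_def using Z0 by simp_all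
  have fin_main: "hamiltonian V E'"
    if F: "F \<subseteq> E" "\<And>e. e \<in> F \<Longrightarrow> e \<subseteq> Q' \<or> (\<exists>x\<in>Q'. \<exists>w\<in>W'. e = {x, w})" "\<And>v. degree F v \<le> 2"
      "R \<subseteq> F" "acyclic_edges (F - R)"
      "2 * real (card Sm) - real (\<Sum>e\<in>F - R. card (e \<inter> Sm)) < 2 * real (card Uv)" for F R
  proof (rule finish[OF F(1,2)])
    show "degree (cherry \<union> F) v \<le> 2" for v unfolding cherry0 using F(3)[of v] by simp
    show "R \<subseteq> F" by (rule F(4))
    show "acyclic_edges (cherry \<union> F - R)" unfolding cherry0 using F(5) by simp
    show "2 * real (card Sm) + 2 * real (card A) - 2 * real (card (Z \<inter> Sm)) - real (card (Z \<inter> Bi))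
      - real (card {y\<in>Q'. asg y \<noteq> None}) - real (\<Sum>e\<in>F - R. card (e \<inter> Sm)) < 2 * real (card Uv)"
      using F(6) zero by linarith
  qed
  show ?thesis
  proof (cases "Sm = {}")
    case True
    have "card Uv > 0" using V_large(2) fin_parts(3) by (simp add: card_gt_0_iff)
    then show ?thesis
      by (intro fin_main[of "{}" "{}"]) (simp_all add: True degree_def acyclic_edges_def two_regular_def)
  next
    case False
    define \<delta> where "\<delta> = Min (degree E ` V)"
    have Vne: "V \<noteq> {}" using V_large(1) by auto
    have "\<delta> \<in> degree E ` V" unfolding \<delta>_def using finV Vne by simp
    then obtain x0 where x0: "x0 \<in> V" "degree E x0 = \<delta>" by auto
    have dle: "\<delta> \<le> degree E v" if "v \<in> V" for v unfolding \<delta>_def using finV that by simp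
    have u: "k + 1 \<le> \<delta> + card Uv" using Uv_lower[OF x0(1)] x0(2) by simp
    have dk: "k \<le> 2 * \<delta>" using Hi_degree[of x0] x0 parts(1) Lo by blast
    have SmV: "x \<in> V" if "x \<in> Sm" for x using that part_subs(3) parts(8) by blast
    obtain s0 where "s0 \<in> Sm" using False by blast
    then have dn: "2 * \<delta> < card V" using Sm_degree[of s0] dle[OF SmV] by fastforce
    \<comment> \<open>All degrees are at least 3C, so 2/d(x) + 2/d(y) is at most 4/3 divided by
      C.\<close>
    define C where "C = \<delta> div 3"
    have C: "3 * C \<le> \<delta>" "\<delta> \<le> 3 * C + 2" unfolding C_def by presburger+
    have C5: "C \<ge> 5" using C dk k_ge by linarith
    have Cpos: "C > 0" using C5 by simp
    define \<kappa> :: "'a \<Rightarrow> nat" where "\<kappa> v = 2" for v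
    have dQ: "card (nbrs E x \<inter> (Q' \<union> W')) \<le> \<kappa> x * (C - 1)" if x: "x \<in> Q'" for x
    proof -
      have "2 * out_deg x + 2 * card Uv < card V" using Sm_out_deg x QS by blast
      then have "out_deg x \<le> 2 * (C - 1)" using u C dense dn by linarith
      then show ?thesis using Sm_nbrs_bound[OF x] unfolding \<kappa>_def by simp
    qed
    have QW: "Q' \<inter> W' = {}" using parts(6) unfolding QS by blast
    obtain F where F: "F \<subseteq> E" "\<And>e. e \<in> F \<Longrightarrow> e \<subseteq> Q' \<or> (\<exists>x\<in>Q'. \<exists>w\<in>W'. e = {x, w})"
      "\<And>v. degree F v \<le> \<kappa> v" "\<And>v. v \<notin> Q' \<union> W' \<Longrightarrow> degree F v = 0"
      "(4/3) * (\<Sum>x\<in>Q'. real (card (nbrs E x \<inter> Q'))) / 2 +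
        (3/4) * (\<Sum>w\<in>W'. real (min (card (nbrs E w \<inter> Q')) (\<kappa> w * (C - 1))))
        \<le> real C * ((4/3) * real (card {e\<in>F. e \<subseteq> Q'}) + (3/4) * real (card {e\<in>F. \<not> e \<subseteq> Q'}))"
      by (rule build_matching[OF graph fin_sets(3,4) QW Cpos dQ, where a = "4/3" and b = "3/4"]) (assumption, (rule that; assumption))
    have finF: "finite F" using F(1) graph unfolding fin_graph_def by (meson finite_subset)
    have degF: "degree F v \<le> 2" for v using F(3)[of v] unfolding \<kappa>_def .
    define S where "S = (4/3) * real (card {e\<in>F. e \<subseteq> Q'}) + (3/4) * real (card {e\<in>F. \<not> e \<subseteq> Q'})"
    have need: "2 * (\<Sum>x\<in>Q'. real (card (nbrs E x \<inter> Q')) / real (degree E x))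
      + 2 * (\<Sum>w\<in>W'. real (card (nbrs E w \<inter> Q')) / real k) \<le> S"
    proof (rule class_weight[OF Cpos _ _ F(5)[folded S_def]])
      fix x assume x: "x \<in> Q'"
      then have "3 * C \<le> degree E x" using dle SmV C unfolding QS by (meson order_trans)
      then have "3 * real C \<le> real (degree E x)" by linarith
      then show "4 * real C \<le> 4 / 3 * real (degree E x)" by linarith
    next
      fix w assume w: "w \<in> W'"
      define t where "t = card (nbrs E w \<inter> Q')"
      have "8 * C * t \<le> 3 * k * min t (2 * (C - 1))"
      proof (cases "t = 0 \<or> t \<le> 2 * (C - 1)")
        case True
        then have "min t (2 * (C - 1)) = t" by auto
        moreover have "8 * C \<le> 3 * k" using C dn dense by linarith
        then have "8 * C * t \<le> 3 * k * t" by (rule mult_le_mono1)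
        ultimately show ?thesis by simp
      next
        case False
        then have t0: "t > 0" and mn: "min t (2 * (C - 1)) = 2 * (C - 1)" by auto
        note tb = W_nbrs_bound[OF t_def t0]
        have "C * (4 * t + 42) \<le> C * (3 * k)" using tb(1) by (rule mult_le_mono2)
        then have "4 * (C * t) + 42 * C \<le> 3 * (C * k)" by (simp add: distrib_left mult.left_commute)
        moreover have "k * (C - 1) + k = C * k" using Cpos by (cases C) simp_all
        moreover have "k \<le> 14 * C" using C dk k_ge by linarith
        ultimately have "8 * (C * t) \<le> 6 * (k * (C - 1))" by linarith
        then show ?thesis unfolding mn by simp
      qed
      then have "real (8 * C * t) \<le> real (3 * k * min t (2 * (C - 1)))" by (rule of_nat_mono)
      then have "8 * real C * real t \<le> 3 * real k * real (min t (2 * (C - 1)))" by (simp only: of_nat_mult of_nat_numeral)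
      then show "2 * real C * real (card (nbrs E w \<inter> Q')) \<le> 3 / 4 * real k * real (min (card (nbrs E w \<inter> Q')) (\<kappa> w * (C - 1)))"
        unfolding t_def[symmetric] \<kappa>_def by simp
    qed simp_all
    \<comment> \<open>A cycle meeting \<open>Bi\<close> has four edges or is a triangle with one edge in \<open>Sm\<close>, and may be cut at an edge of
      weight 1; any other cycle has at least three edges, each of weight 2.\<close>
    define \<omega> :: "'a set \<Rightarrow> real" where "\<omega> e = (if e \<subseteq> Q' then 2/3 else 1/4)" for e
    have brk: "\<exists>e\<in>D \<inter> F. real (card (e \<inter> Sm)) \<le> sum \<omega> D" if D: "D \<subseteq> F" "two_regular D" for D
    proof -
      have finD: "finite D" using D(1) finF finite_subset by blast
      have gD: "fin_graph D" using fin_graph_subset[OF graph] D(1) F(1) by blast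
      have other: "\<exists>f\<in>D. v \<in> f \<and> f \<noteq> e" if e: "e \<in> D" "v \<in> e" for e v
      proof (rule ccontr)
        assume "\<not> ?thesis"
        then have eq: "{f\<in>D. v \<in> f} = {e}" using e by blast
        then have "degree D v = 1" unfolding degree_def by simp
        then show False using D(2) unfolding two_regular_def by (metis one_eq_numeral_iff semiring_norm(85) zero_neq_one)
      qed
      have sumge: "sum \<omega> X \<le> sum \<omega> D" if "X \<subseteq> D" for X
        by (rule sum_mono2[OF finD that]) (simp add: \<omega>_def)
      have w14: "\<omega> e \<ge> 1/4" for e unfolding \<omega>_def by simp
      show ?thesis
      proof (cases "\<exists>e\<in>D. \<not> e \<subseteq> Q'")
        case True
        then obtain e1 where e1: "e1 \<in> D" "\<not> e1 \<subseteq> Q'" by blast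
        then obtain x1 w where x1: "x1 \<in> Q'" "w \<in> W'" "e1 = {x1, w}" using F(2)[of e1] D(1) by blast
        have wQ: "w \<notin> Q'" using x1(2) QW by blast
        obtain e2 where e2: "e2 \<in> D" "w \<in> e2" "e2 \<noteq> e1" using other[OF e1(1), of w] x1(3) by blast
        obtain x2 where x2: "e2 = {w, x2}" "x2 \<noteq> w" using fin_graph_edge_ex[OF gD e2(1,2)] by blast
        have "\<not> e2 \<subseteq> Q'" using e2(2) wQ by blast
        then obtain a b where ab: "a \<in> Q'" "b \<in> W'" "e2 = {a, b}" using F(2)[of e2] e2(1) D(1) by blast
        have "w = b" using ab wQ e2(2) by blast
        then have x2Q: "x2 \<in> Q'" using ab x2 by (metis doubleton_eq_iff)
        have x12: "x1 \<noteq> x2" "x1 \<noteq> w" using e2(3) x2(1) x1(3,1) wQ by (auto simp: insert_commute)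
        obtain f1 where f1: "f1 \<in> D" "x1 \<in> f1" "f1 \<noteq> e1" using other[OF e1(1), of x1] x1(3) by blast
        obtain f2 where f2: "f2 \<in> D" "x2 \<in> f2" "f2 \<noteq> e2" using other[OF e2(1), of x2] x2(1) by blast
        have ne: "f1 \<noteq> e2" "f2 \<noteq> e1"
        proof -
          have "x1 \<notin> e2" using x2(1) x12 by simp
          then show "f1 \<noteq> e2" using f1(2) by blast
          have "x2 \<notin> e1" using x1(3) x12 x2(2) by simp
          then show "f2 \<noteq> e1" using f2(2) by blast
        qed
        have "1 \<le> sum \<omega> D"
        proof (cases "f1 = f2")
          case True
          obtain z where z: "f1 = {x1, z}" using fin_graph_edge_ex[OF gD f1(1,2)] by blast
          then have "f1 = {x1, x2}" using f2(2) True x12(1) by blast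
          then have "\<omega> f1 = 2/3" unfolding \<omega>_def using x1(1) x2Q by simp
          moreover have "sum \<omega> {e1, e2, f1} = \<omega> e1 + \<omega> e2 + \<omega> f1"
            using e2(3) f1(3) ne(1) by simp
          moreover have "sum \<omega> {e1, e2, f1} \<le> sum \<omega> D" by (rule sumge) (use e1 e2 f1 in blast)
          ultimately show ?thesis using w14[of e1] w14[of e2] by linarith
        next
          case False
          have "sum \<omega> {e1, e2, f1, f2} = \<omega> e1 + \<omega> e2 + \<omega> f1 + \<omega> f2"
            using e2(3) f1(3) f2(3) ne False by simp
          moreover have "sum \<omega> {e1, e2, f1, f2} \<le> sum \<omega> D" by (rule sumge) (use e1 e2 f1 f2 in blast)
          ultimately show ?thesis using w14[of e1] w14[of e2] w14[of f1] w14[of f2] by linarith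
        qed
        moreover have "card (e1 \<inter> Sm) = 1" using shape_weight(1)[OF F(1,2), of e1] e1 D(1) by auto
        ultimately show ?thesis using e1(1) D(1) by (intro bexI[of _ e1]) auto
      next
        case False
        obtain e where e: "e \<in> D" using D(2) unfolding two_regular_def by blast
        have "card e = 2" using gD e unfolding fin_graph_def by blast
        then obtain x y where xy: "e = {x, y}" "x \<noteq> y" by (meson card_2_iff)
        obtain f where f: "f \<in> D" "x \<in> f" "f \<noteq> e" using other[OF e, of x] xy(1) by blast
        obtain h where h: "h \<in> D" "y \<in> h" "h \<noteq> e" using other[OF e, of y] xy(1) by blast
        have "f \<noteq> h"
        proof
          assume "f = h"
          obtain z where z: "f = {x, z}" using fin_graph_edge_ex[OF gD f(1,2)] by blast
          then have "f = {x, y}" using h(2) \<open>f = h\<close> xy(2) by blast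
          then show False using f(3) xy(1) by simp
        qed
        then have "sum \<omega> {e, f, h} = \<omega> e + \<omega> f + \<omega> h" using f(3) h(3) by simp
        moreover have "\<omega> e = 2/3" "\<omega> f = 2/3" "\<omega> h = 2/3" using False e f(1) h(1) unfolding \<omega>_def by simp_all
        moreover have "sum \<omega> {e, f, h} \<le> sum \<omega> D" by (rule sumge) (use e f h in blast)
        ultimately have "2 \<le> sum \<omega> D" by linarith
        moreover have "card (e \<inter> Sm) = 2" using shape_weight(1)[OF F(1,2), of e] e False D(1) by auto
        ultimately show ?thesis using e D(1) by (intro bexI[of _ e]) auto
      qed
    qed
    have "\<exists>R\<subseteq>F. acyclic_edges (F - R) \<and> (\<Sum>e\<in>R. real (card (e \<inter> Sm))) \<le> sum \<omega> F"
      by (rule break_cycles[OF finF degF _ _ brk]) (simp_all add: \<omega>_def)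
    then obtain R where R: "R \<subseteq> F" "acyclic_edges (F - R)" "(\<Sum>e\<in>R. real (card (e \<inter> Sm))) \<le> sum \<omega> F" by blast
    have "sum \<omega> F = (2/3) * real (card {e\<in>F. e \<subseteq> Q'}) + (1/4) * real (card {e\<in>F. \<not> e \<subseteq> Q'})"
      unfolding \<omega>_def using finF by (simp add: sum.If_cases Int_def)
    moreover have "real (\<Sum>e\<in>F. card (e \<inter> Sm)) = real (\<Sum>e\<in>F - R. card (e \<inter> Sm)) + (\<Sum>e\<in>R. real (card (e \<inter> Sm)))"
      using sum.subset_diff[OF R(1) finF, of "\<lambda>e. card (e \<inter> Sm)"] by simp
    ultimately have net: "real (\<Sum>e\<in>F - R. card (e \<inter> Sm)) \<ge> S"
      using total_weight[OF F(1,2)] R(3) unfolding S_def by linarith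
    have "2 * real (card Sm) \<le> 2 * (\<Sum>x\<in>V - Uv. real (un_deg x) / real (degree E x)) + S"
      using count need zero by linarith
    then have fin: "2 * real (card Sm) - real (\<Sum>e\<in>F - R. card (e \<inter> Sm)) < 2 * real (card Uv)"
      using net Uv_weight[OF V_large(2)] by linarith
    show ?thesis by (rule fin_main[OF F(1) _ degF R(1,2) fin]) (rule F(2))
  qed
qed

end

context dense_critical
begin

text \<open>The assignment is maximized on \<open>Sm \<union> Bi\<close> because ends in
  \<open>Uv\<close> are the resource for joining paths and should not be spent on cherries.\<close>

theorem closure_hamiltonian: "hamiltonian V E'"
proof -
  define Adj where "Adj x = (if x \<in> Lo then nbrs E x else {})" for x
  have w: "2 \<le> (\<Sum>y\<in>Adj x. 1 / real (card {x'\<in>Lo. y \<in> Adj x'}))" if x: "x \<in> Lo" for x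
  proof -
    have "{x'\<in>Lo. y \<in> Adj x'} = low_nbrs y" for y
    proof (rule set_eqI)
      fix v
      have "v \<in> nbrs E y \<Longrightarrow> v \<in> V" using nbrs_V by blast
      moreover have "y \<in> nbrs E v \<longleftrightarrow> v \<in> nbrs E y" by (rule nbrs_sym)
      ultimately show "v \<in> {x'\<in>Lo. y \<in> Adj x'} \<longleftrightarrow> v \<in> low_nbrs y"
        unfolding Adj_def low_nbrs_def Lo_def by auto
    qed
    moreover have "Adj x = nbrs E x" using x unfolding Adj_def by simp
    moreover have "low x" "degree E x > 0" using x degree_pos unfolding Lo_def by simp_all
    ultimately show ?thesis using low_weight[of x] by simp
  qed
  have fin: "finite (Adj x)" if "x \<in> Lo" for x unfolding Adj_def using finite_nbrs[OF graph] by simp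
  have none: "Adj x = {}" if "x \<notin> Lo" for x unfolding Adj_def using that by simp
  from two_fold_assignment[OF fin_parts(1) fin none w, of "Sm \<union> Bi"]
  obtain m A where mA: "valid_assignment Adj m" "\<forall>x\<in>Lo. card (owned m x) = 2" "A \<subseteq> Lo"
    "\<forall>x\<in>A. \<forall>y\<in>Adj x \<inter> (Sm \<union> Bi). \<exists>x'\<in>A. m y = Some x'" "\<forall>x\<in>Lo - A. owned m x \<subseteq> Sm \<union> Bi"
    by auto
  interpret cherries E k V E' m A
  proof unfold_locales
    show "x \<in> Lo \<and> y \<in> nbrs E x" if "m y = Some x" for x y
      using mA(1) that unfolding valid_assignment_def Adj_def by (metis empty_iff)
    show "card (owned m x) = 2" if "x \<in> Lo" for x using mA(2) that by blast
    show "A \<subseteq> Lo" by (rule mA(3))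
    show "\<exists>x'\<in>A. m y = Some x'" if "x \<in> A" "y \<in> nbrs E x" "y \<in> Sm \<union> Bi" for x y
    proof -
      have "y \<in> Adj x \<inter> (Sm \<union> Bi)" using that mA(3) unfolding Adj_def by auto
      then show ?thesis using mA(4) that(1) by blast
    qed
    show "owned m x \<subseteq> Sm \<union> Bi" if "x \<in> Lo - A" for x using mA(5) that by blast
  qed
  show ?thesis using hamiltonian_with_low hamiltonian_without_low by blast
qed

end

section \<open>Translation from the chromatic index\<close>

lemma colorable_chromatic_index:
  assumes "fin_graph E"
  shows "colorable E (chromatic_index E)"
proof -
  have "degree E v < card E + 1" for v
    using card_mono[of E "{e\<in>E. v \<in> e}"] assms unfolding degree_def fin_graph_def by (simp add: less_Suc_eq_le)
  then have "colorable E (card E + 1)" using vizing[OF assms] by blast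
  \<comment> \<open>Existence of some colouring ensures that the \<open>LEAST\<close> in
    \<open>chromatic_index\<close> is attained.\<close>
  then have "\<exists>k c. proper_edge_coloring E c k" unfolding colorable_def by blast
  then show ?thesis unfolding colorable_def chromatic_index_def by (rule LeastI_ex)
qed

theorem theorem1:
  fixes V :: "'a set" and E :: "'a set set"
  assumes "simple_graph V E"
    and "edge_critical V E"
    and "real (max_degree V E) \<ge> 2 * real (card V) / 3 + 12"
  shows "hamiltonian V E"
proof -
  define k where "k = max_degree V E"
  have finV: "finite V" using assms(1) unfolding simple_graph_def by blast
  have g: "fin_graph E" using simple_graph_fin_graph[OF assms(1)] .
  have EV: "e \<subseteq> V" if "e \<in> E" for e using assms(1) that unfolding simple_graph_def by blast
  have ci: "chromatic_index E = k + 1"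
    and sub: "\<And>V' E'. subgraph V' E' V E \<Longrightarrow> (V', E') \<noteq> (V, E) \<Longrightarrow> chromatic_index E' \<le> k"
    using assms(2) unfolding edge_critical_def k_def by blast+
  obtain E' where E': "E \<subseteq> E'" "simple_graph V E'" "hamiltonian V E' \<Longrightarrow> hamiltonian V E"
    "\<And>u v. u \<in> V \<Longrightarrow> v \<in> V \<Longrightarrow> u \<noteq> v \<Longrightarrow> card V \<le> degree E' u + degree E' v \<Longrightarrow> {u, v} \<in> E'"
    by (rule closure_exists[OF assms(1)]) (rule that; assumption)
  interpret dense_critical E k V E'
  proof unfold_locales
    show "fin_graph E" by (rule g)
    show "degree E v \<le> k" for v
    proof (cases "v \<in> V")
      case True
      then show ?thesis unfolding k_def max_degree_def using finV by auto
    next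
      case False
      then have "{e\<in>E. v \<in> e} = {}" using EV by blast
      then have "degree E v = 0" unfolding degree_def by (metis card.empty)
      then show ?thesis by simp
    qed
    show "\<not> colorable E k"
    proof
      assume "colorable E k"
      then have "chromatic_index E \<le> k" unfolding colorable_def chromatic_index_def by (rule Least_le)
      then show False using ci by simp
    qed
    show "colorable (E - {e}) k" if "e \<in> E" for e
    proof -
      have "subgraph V (E - {e}) V E" unfolding subgraph_def using EV by blast
      moreover have "(V, E - {e}) \<noteq> (V, E)" using that by blast
      ultimately have "chromatic_index (E - {e}) \<le> k" using sub by blast
      then show ?thesis using colorable_mono[OF colorable_chromatic_index] fin_graph_subset[OF g] by blast
    qed
    show "simple_graph V E" by (rule assms(1))
    show "degree E v > 0" if v: "v \<in> V" for v
    proof (rule ccontr)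
      assume "\<not> degree E v > 0"
      then have "{e\<in>E. v \<in> e} = {}" using g unfolding degree_def fin_graph_def by simp
      \<comment> \<open>Deleting an isolated vertex leaves the edge set, so a proper subgraph would
        still need k + 1 colours.\<close>
      then have "subgraph (V - {v}) E V E" unfolding subgraph_def using EV by blast
      moreover have "(V - {v}, E) \<noteq> (V, E)" using v by blast
      ultimately have "chromatic_index E \<le> k" using sub by blast
      then show False using ci by simp
    qed
    show "2 * card V + 36 \<le> 3 * k" using assms(3) unfolding k_def by linarith
    show "E \<subseteq> E'" by (rule E'(1))
    show "simple_graph V E'" by (rule E'(2))
    show "{u, v} \<in> E'" if "u \<in> V" "v \<in> V" "u \<noteq> v" "card V \<le> degree E' u + degree E' v" for u v
      using E'(4)[OF that] .
  qed
  show ?thesis using E'(3) closure_hamiltonian .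
qed

end
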